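(* Let $(\boldsymbol{u}_X,q_X)\in\boldsymbol{X}_D\times\operatorname{div}\boldsymbol{X}_D$ be the solution of $$a(\boldsymbol{u}_X,\boldsymbol{v})-(q_X,\operatorname{div}\boldsymbol{v})=L(\boldsymbol{v})\quad\forall\boldsymbol{v}\in\boldsymbol{X}_D,\qquad-(r,\operatorname{div}\boldsymbol{u}_X)=0\quad\forall r\in\operatorname{div}\boldsymbol{X}_D.$$ Then $$\boldsymbol{u}_X=\tilde{\boldsymbol{u}}+\sum_{K\in\mathcal{T}}\boldsymbol{u}_K\qquad\text{and}\qquad q_X=\tilde q+\sum_{K\in\mathcal{T}}q_K,$$ where: 1. $(\tilde{\boldsymbol{u}},\tilde q)\in\tilde{\boldsymbol{X}}_B\times\operatorname{div}\tilde{\boldsymbol{X}}_B$ satisfies $$a(\tilde{\boldsymbol{u}},\boldsymbol{v})-(\tilde q,\operatorname{div}\boldsymbol{v})=L(\boldsymbol{v})\quad\forall\boldsymbol{v}\in\tilde{\boldsymbol{X}}_B^\dagger,\qquad-(r,\operatorname{div}\tilde{\boldsymbol{u}})=0\quad\forall r\in\operatorname{div}\tilde{\boldsymbol{X}}_B^\dagger;$$ 2. for each $K\in\mathcal{T}$, $(\boldsymbol{u}_K,q_K)\in\boldsymbol{X}_I(K)\times\operatorname{div}\boldsymbol{X}_I(K)$ satisfies $$a_K(\boldsymbol{u}_K,\boldsymbol{v})-(q_K,\operatorname{div}\boldsymbol{v})_K=(\boldsymbol{f},\boldsymbol{v})_K-a_K(\tilde{\boldsymbol{u}},\boldsymbol{v})\quad\forall\boldsymbol{v}\in\boldsymbol{X}_I(K),\qquad-(r,\operatorname{div}\boldsymbol{u}_K)_K=0\quad\forall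 r\in\operatorname{div}\boldsymbol{X}_I(K).$$ Moreover, the system in 1 and the systems in 2 are uniquely solvable.
   Context: Let $d\in\{2,3\}$ and let $\Omega\subset\mathbb{R}^d$ be a polygonal (polyhedral) domain whose boundary $\Gamma$ is partitioned into disjoint subsets $\Gamma_D,\Gamma_N$ with $|\Gamma_D|>0$. $(\cdot,\cdot)_\omega$ is the $L^2(\omega)$ inner product (subscript omitted when $\omega=\Omega$), and $\|\cdot\|_1$ the $H^1(\Omega)^d$ norm. $\boldsymbol{H}^1_D(\Omega)=\{\boldsymbol{v}\in H^1(\Omega)^d:\boldsymbol{v}|_{\Gamma_D}=\boldsymbol{0}\}$. $a(\cdot,\cdot)$ is a (not necessarily symmetric) bilinear form on $H^1(\Omega)^d$ for which there are constants $M,\alpha>0$ with $|a(\boldsymbol{u},\boldsymbol{v})|\le M\|\boldsymbol{u}\|_1\|\boldsymbol{v}\|_1$ and $a(\boldsymbol{u},\boldsymbol{u})\ge\alpha\|\boldsymbol{u}\|_1^2$ for all $\boldsymbol{u},\boldsymbol{v}\in\boldsymbol{H}^1_D(\Omega)$. $L(\boldsymbol{v})=(\boldsymbol{v},\boldsymbol{f})+(\boldsymbol{v},\boldsymbol{g})_{\Gamma_N}$ for given $\boldsymbol{f}\in L^2(\Omega)^d$, $\boldsymbol{g}\in L^2(\Gamma_N)^d$. $\mathcal{T}$ is a partition of $\Omega$ into simplices such that the nonempty intersection of any two distinct elements is a single common sub-simplex of both, with element boundaries located at the intersections of $\bar\Gamma_D$ and $\bar\Gamma_N$. For $p\in\mathbb{N}$,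 $X=\{v\in C^0(\bar\Omega): v|_K\in\mathcal{P}_p(K)\ \forall K\in\mathcal{T}\}$ ($\mathcal{P}_p(K)$: polynomials of degree at most $p$), $X_D=\{v\in X: v|_{\Gamma_D}=0\}$, $\boldsymbol{X}_D=[X_D]^d$; $\operatorname{div}\boldsymbol{Y}$ denotes the image of a space $\boldsymbol{Y}$ under the divergence. $a_K(\cdot,\cdot)$ denotes the restriction of $a(\cdot,\cdot)$ to $K$: $a_K$ is bilinear, $a_K(\boldsymbol{u},\boldsymbol{v})$ depends only on $\boldsymbol{u}|_K,\boldsymbol{v}|_K$, and $a=\sum_{K\in\mathcal{T}}a_K$. Interior spaces: $\boldsymbol{X}_I(K)=\{\boldsymbol{v}\in\boldsymbol{X}_D:\operatorname{supp}\boldsymbol{v}\subseteq K,\ \boldsymbol{v}|_{\partial K}=\boldsymbol{0}\}$, $\boldsymbol{X}_I=\bigoplus_{K\in\mathcal{T}}\boldsymbol{X}_I(K)$, $\boldsymbol{N}_I(K)=\{\boldsymbol{v}\in\boldsymbol{X}_I(K):\operatorname{div}\boldsymbol{v}\equiv0\}$, $\boldsymbol{N}_I=\bigoplus_{K\in\mathcal{T}}\boldsymbol{N}_I(K)$; functions in $\operatorname{div}\boldsymbol{X}_I(K)$ are regarded as functions on $\Omega$ vanishing outside $K$. Boundary spaces: $$\tilde{\boldsymbol{X}}_B=\{\boldsymbol{v}\in\boldsymbol{X}_D:a(\boldsymbol{v},\boldsymbol{z})=0\ \forall\boldsymbol{z}\in\boldsymbol{N}_I\text{ and }(\operatorname{div}\boldsymbol{v},r)=0\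 \forall r\in\operatorname{div}\boldsymbol{X}_I\},$$ $$\tilde{\boldsymbol{X}}_B^\dagger=\{\boldsymbol{v}\in\boldsymbol{X}_D:a(\boldsymbol{z},\boldsymbol{v})=0\ \forall\boldsymbol{z}\in\boldsymbol{N}_I\text{ and }(\operatorname{div}\boldsymbol{v},r)=0\ \forall r\in\operatorname{div}\boldsymbol{X}_I\}.$$ *)

theory Defs
  imports "HOL-Analysis.Analysis"
begin

section \<open>Smooth functions, weak derivatives, and Sobolev spaces\<close>

text \<open>
  Elements of $L^2$ and $H^1$ are represented by functions on the whole space; only their values
  almost everywhere on the domain matter, and equality in $L^2$ is almost-everywhere equality.
\<close>

definition L2 :: "'a measure \<Rightarrow> ('a \<Rightarrow> 'b::euclidean_space) set" where
  "L2 M = {f \<in> borel_measurable M. integrable M (\<lambda>x. (norm (f x))\<^sup>2)}"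

definition inner_L2 :: "'a measure \<Rightarrow> ('a \<Rightarrow> 'b::euclidean_space) \<Rightarrow> ('a \<Rightarrow> 'b) \<Rightarrow> real" where
  "inner_L2 M f g = (\<integral>x. f x \<bullet> g x \<partial>M)"

definition partial_deriv :: "'n::finite \<Rightarrow> (real^'n \<Rightarrow> real) \<Rightarrow> real^'n \<Rightarrow> real" where
  "partial_deriv i f x = frechet_derivative f (at x) (axis i 1)"

fun Ck :: "nat \<Rightarrow> (real^'n::finite \<Rightarrow> real) \<Rightarrow> bool" where
  "Ck 0 f \<longleftrightarrow> continuous_on UNIV f"
| "Ck (Suc k) f \<longleftrightarrow> (\<forall>x. f differentiable (at x)) \<and> (\<forall>i. Ck k (partial_deriv i f))"

definition test_functions :: "(real^'n::finite) set \<Rightarrow> (real^'n \<Rightarrow> real) set" where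
  "test_functions \<Omega> =
     {\<phi>. (\<forall>k. Ck k \<phi>) \<and> compact (closure {x. \<phi> x \<noteq> 0}) \<and> closure {x. \<phi> x \<noteq> 0} \<subseteq> \<Omega>}"

definition locally_integrable :: "(real^'n::finite) set \<Rightarrow> (real^'n \<Rightarrow> real) \<Rightarrow> bool" where
  "locally_integrable \<Omega> f \<longleftrightarrow> (\<forall>C. compact C \<and> C \<subseteq> \<Omega> \<longrightarrow> set_integrable lebesgue C f)"

definition has_weak_partial ::
    "(real^'n::finite) set \<Rightarrow> 'n \<Rightarrow> (real^'n \<Rightarrow> real) \<Rightarrow> (real^'n \<Rightarrow> real) \<Rightarrow> bool" where
  "has_weak_partial \<Omega> i f g \<longleftrightarrow>
     locally_integrable \<Omega> f \<and> locally_integrable \<Omega> g \<and>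
     (\<forall>\<phi>\<in>test_functions \<Omega>.
        (\<integral>x. f x * partial_deriv i \<phi> x \<partial>lebesgue_on \<Omega>) = - (\<integral>x. g x * \<phi> x \<partial>lebesgue_on \<Omega>))"

text \<open>The choice below is determined up to a null set of \<open>\<Omega>\<close>.\<close>

definition weak_partial ::
    "(real^'n::finite) set \<Rightarrow> 'n \<Rightarrow> (real^'n \<Rightarrow> real) \<Rightarrow> real^'n \<Rightarrow> real" where
  "weak_partial \<Omega> i f = (SOME g. has_weak_partial \<Omega> i f g)"

definition weak_div :: "(real^'n::finite) set \<Rightarrow> (real^'n \<Rightarrow> real^'n) \<Rightarrow> real^'n \<Rightarrow> real" where
  "weak_div \<Omega> v x = (\<Sum>i\<in>UNIV. weak_partial \<Omega> i (\<lambda>y. v y $ i) x)"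

definition H1 :: "(real^'n::finite) set \<Rightarrow> (real^'n \<Rightarrow> real) set" where
  "H1 \<Omega> = {f \<in> L2 (lebesgue_on \<Omega>). \<forall>i. \<exists>g\<in>L2 (lebesgue_on \<Omega>). has_weak_partial \<Omega> i f g}"

definition H1v :: "(real^'n::finite) set \<Rightarrow> (real^'n \<Rightarrow> real^'n) set" where
  "H1v \<Omega> = {v. \<forall>i. (\<lambda>x. v x $ i) \<in> H1 \<Omega>}"

definition H1_norm :: "(real^'n::finite) set \<Rightarrow> (real^'n \<Rightarrow> real^'n) \<Rightarrow> real" where
  "H1_norm \<Omega> v = sqrt (\<Sum>i\<in>UNIV.
     (\<integral>x. (v x $ i)\<^sup>2 \<partial>lebesgue_on \<Omega>) +
     (\<Sum>j\<in>UNIV. \<integral>x. (weak_partial \<Omega> j (\<lambda>y. v y $ i) x)\<^sup>2 \<partial>lebesgue_on \<Omega>))"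


section \<open>Surface measure and traces\<close>

text \<open>
  The surface measure is the $(d-1)$-dimensional Hausdorff measure on the Borel sets (on which the
  Hausdorff outer measure is countably additive, by Caratheodory's criterion). The factor
  \<open>unit_ball_vol s\<close> normalises it so that it agrees with the elementary area. The exponent \<open>s\<close> is
  only used for \<open>s \<ge> 1\<close>: for \<open>s = 0\<close> the empty sets of a cover would wrongly be counted, as \<open>0 ^ 0 = 1\<close>.
\<close>

definition hausdorff_content :: "nat \<Rightarrow> real \<Rightarrow> 'a::metric_space set \<Rightarrow> ennreal" where
  "hausdorff_content s \<delta> A =
     (INF C \<in> {C :: nat \<Rightarrow> 'a set. A \<subseteq> (\<Union>i. C i) \<and> (\<forall>i. bounded (C i) \<and> diameter (C i) \<le> \<delta>)}.
        \<Sum>i. ennreal (unit_ball_vol (real s) * (diameter (C i) / 2) ^ s))"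

definition hausdorff_outer :: "nat \<Rightarrow> 'a::metric_space set \<Rightarrow> ennreal" where
  "hausdorff_outer s A = (SUP \<delta>\<in>{0<..}. hausdorff_content s \<delta> A)"

definition surface_measure :: "(real^'n::finite) measure" where
  "surface_measure = measure_of UNIV (sets borel) (hausdorff_outer (CARD('n) - 1))"

abbreviation surface_on :: "(real^'n::finite) set \<Rightarrow> (real^'n) measure" where
  "surface_on S \<equiv> restrict_space surface_measure S"

text \<open>
  The trace operator is the continuous extension to \<open>H1v \<Omega>\<close>, with values in $L^2$ of the boundary,
  of the restriction to the boundary of $H^1$ functions that are continuous up to the boundary.
\<close>

definition has_trace ::
    "(real^'n::finite) set \<Rightarrow> (real^'n \<Rightarrow> real^'n) \<Rightarrow> (real^'n \<Rightarrow> real^'n) \<Rightarrow> bool" where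
  "has_trace \<Omega> v w \<longleftrightarrow> w \<in> L2 (surface_on (frontier \<Omega>)) \<and>
     (\<exists>\<phi> :: nat \<Rightarrow> real^'n \<Rightarrow> real^'n.
        (\<forall>n. \<phi> n \<in> H1v \<Omega> \<and> continuous_on (closure \<Omega>) (\<phi> n)) \<and>
        (\<lambda>n. H1_norm \<Omega> (\<lambda>x. \<phi> n x - v x)) \<longlonglongrightarrow> 0 \<and>
        (\<lambda>n. \<integral>\<^sup>+x. ennreal ((norm (\<phi> n x - w x))\<^sup>2) \<partial>surface_on (frontier \<Omega>)) \<longlonglongrightarrow> 0)"

definition H1D :: "(real^'n::finite) set \<Rightarrow> (real^'n) set \<Rightarrow> (real^'n \<Rightarrow> real^'n) set" where
  "H1D \<Omega> \<Gamma>\<^sub>D = {v \<in> H1v \<Omega>. \<exists>w. has_trace \<Omega> v w \<and> (AE x in surface_on \<Gamma>\<^sub>D. w x = 0)}"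


section \<open>Domains, meshes, and bilinear forms\<close>

definition polyhedral_domain :: "(real^'n::finite) set \<Rightarrow> bool" where
  "polyhedral_domain \<Omega> \<longleftrightarrow> open \<Omega> \<and> connected \<Omega> \<and> bounded \<Omega> \<and> \<Omega> \<noteq> {} \<and>
     (\<exists>\<F>. finite \<F> \<and> (\<forall>P\<in>\<F>. polytope P \<and> aff_dim P = int CARD('n) - 1) \<and> frontier \<Omega> = \<Union>\<F>)"

definition simplicial_mesh :: "(real^'n::finite) set \<Rightarrow> (real^'n) set set \<Rightarrow> bool" where
  "simplicial_mesh \<Omega> \<T> \<longleftrightarrow> triangulation \<T> \<and> (\<forall>K\<in>\<T>. int CARD('n) simplex K \<and> interior K \<subseteq> \<Omega>) \<and>
     \<Union>\<T> = closure \<Omega>"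

definition bilinear_form_on ::
    "(real^'n::finite \<Rightarrow> real^'n) set \<Rightarrow> ((real^'n \<Rightarrow> real^'n) \<Rightarrow> (real^'n \<Rightarrow> real^'n) \<Rightarrow> real) \<Rightarrow> bool" where
  "bilinear_form_on V a \<longleftrightarrow>
     (\<forall>u\<in>V. \<forall>v\<in>V. \<forall>w\<in>V. \<forall>c.
        a (\<lambda>x. u x + v x) w = a u w + a v w \<and> a w (\<lambda>x. u x + v x) = a w u + a w v \<and>
        a (\<lambda>x. c *\<^sub>R u x) w = c * a u w \<and> a w (\<lambda>x. c *\<^sub>R u x) = c * a w u)"


section \<open>Finite element spaces\<close>

definition poly_upto :: "nat \<Rightarrow> (real^'n::finite \<Rightarrow> real) set" where
  "poly_upto p = {P. \<exists>c :: ('n \<Rightarrow> nat) \<Rightarrow> real. \<forall>x.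
     P x = (\<Sum>\<alpha>\<in>{\<alpha>. (\<Sum>i\<in>UNIV. \<alpha> i) \<le> p}. c \<alpha> * (\<Prod>i\<in>UNIV. (x $ i) ^ \<alpha> i))}"

text \<open>
  Functions on \<open>closure \<Omega>\<close> are extended by zero, so that equality in the finite element spaces is
  equality of functions.
\<close>

definition X_space :: "(real^'n::finite) set \<Rightarrow> (real^'n) set set \<Rightarrow> nat \<Rightarrow> (real^'n \<Rightarrow> real) set" where
  "X_space \<Omega> \<T> p = {v. continuous_on (closure \<Omega>) v \<and> (\<forall>x. x \<notin> closure \<Omega> \<longrightarrow> v x = 0) \<and>
     (\<forall>K\<in>\<T>. \<exists>P\<in>poly_upto p. \<forall>x\<in>K. v x = P x)}"

definition XD ::
    "(real^'n::finite) set \<Rightarrow> (real^'n) set set \<Rightarrow> nat \<Rightarrow> (real^'n) set \<Rightarrow> (real^'n \<Rightarrow> real^'n) set" where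
  "XD \<Omega> \<T> p \<Gamma>\<^sub>D = {v. \<forall>i. (\<lambda>x. v x $ i) \<in> X_space \<Omega> \<T> p \<and> (\<forall>x\<in>\<Gamma>\<^sub>D. v x $ i = 0)}"

definition XI_loc ::
    "(real^'n::finite) set \<Rightarrow> (real^'n) set set \<Rightarrow> nat \<Rightarrow> (real^'n) set \<Rightarrow> (real^'n) set
      \<Rightarrow> (real^'n \<Rightarrow> real^'n) set" where
  "XI_loc \<Omega> \<T> p \<Gamma>\<^sub>D K =
     {v \<in> XD \<Omega> \<T> p \<Gamma>\<^sub>D. closure {x. v x \<noteq> 0} \<subseteq> K \<and> (\<forall>x\<in>frontier K. v x = 0)}"

definition NI_loc ::
    "(real^'n::finite) set \<Rightarrow> (real^'n) set set \<Rightarrow> nat \<Rightarrow> (real^'n) set \<Rightarrow> (real^'n) set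
      \<Rightarrow> (real^'n \<Rightarrow> real^'n) set" where
  "NI_loc \<Omega> \<T> p \<Gamma>\<^sub>D K = {v \<in> XI_loc \<Omega> \<T> p \<Gamma>\<^sub>D K. AE x in lebesgue_on \<Omega>. weak_div \<Omega> v x = 0}"

definition mesh_sum ::
    "(real^'n::finite) set set \<Rightarrow> ((real^'n) set \<Rightarrow> (real^'n \<Rightarrow> real^'n) set) \<Rightarrow> (real^'n \<Rightarrow> real^'n) set" where
  "mesh_sum \<T> V = {\<lambda>x. \<Sum>K\<in>\<T>. w K x | w. \<forall>K\<in>\<T>. w K \<in> V K}"

definition XI ::
    "(real^'n::finite) set \<Rightarrow> (real^'n) set set \<Rightarrow> nat \<Rightarrow> (real^'n) set \<Rightarrow> (real^'n \<Rightarrow> real^'n) set" where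
  "XI \<Omega> \<T> p \<Gamma>\<^sub>D = mesh_sum \<T> (XI_loc \<Omega> \<T> p \<Gamma>\<^sub>D)"

definition NI ::
    "(real^'n::finite) set \<Rightarrow> (real^'n) set set \<Rightarrow> nat \<Rightarrow> (real^'n) set \<Rightarrow> (real^'n \<Rightarrow> real^'n) set" where
  "NI \<Omega> \<T> p \<Gamma>\<^sub>D = mesh_sum \<T> (NI_loc \<Omega> \<T> p \<Gamma>\<^sub>D)"

definition XB ::
    "(real^'n::finite) set \<Rightarrow> (real^'n) set set \<Rightarrow> nat \<Rightarrow> (real^'n) set
      \<Rightarrow> ((real^'n \<Rightarrow> real^'n) \<Rightarrow> (real^'n \<Rightarrow> real^'n) \<Rightarrow> real) \<Rightarrow> (real^'n \<Rightarrow> real^'n) set" where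
  "XB \<Omega> \<T> p \<Gamma>\<^sub>D a = {v \<in> XD \<Omega> \<T> p \<Gamma>\<^sub>D. (\<forall>z\<in>NI \<Omega> \<T> p \<Gamma>\<^sub>D. a v z = 0) \<and>
     (\<forall>r\<in>weak_div \<Omega> ` XI \<Omega> \<T> p \<Gamma>\<^sub>D. inner_L2 (lebesgue_on \<Omega>) (weak_div \<Omega> v) r = 0)}"

definition XB_dagger ::
    "(real^'n::finite) set \<Rightarrow> (real^'n) set set \<Rightarrow> nat \<Rightarrow> (real^'n) set
      \<Rightarrow> ((real^'n \<Rightarrow> real^'n) \<Rightarrow> (real^'n \<Rightarrow> real^'n) \<Rightarrow> real) \<Rightarrow> (real^'n \<Rightarrow> real^'n) set" where
  "XB_dagger \<Omega> \<T> p \<Gamma>\<^sub>D a = {v \<in> XD \<Omega> \<T> p \<Gamma>\<^sub>D. (\<forall>z\<in>NI \<Omega> \<T> p \<Gamma>\<^sub>D. a z v = 0) \<and>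
     (\<forall>r\<in>weak_div \<Omega> ` XI \<Omega> \<T> p \<Gamma>\<^sub>D. inner_L2 (lebesgue_on \<Omega>) (weak_div \<Omega> v) r = 0)}"


section \<open>Mixed systems\<close>

definition load ::
    "(real^'n::finite) set \<Rightarrow> (real^'n) set \<Rightarrow> (real^'n \<Rightarrow> real^'n) \<Rightarrow> (real^'n \<Rightarrow> real^'n)
      \<Rightarrow> (real^'n \<Rightarrow> real^'n) \<Rightarrow> real" where
  "load \<Omega> \<Gamma>\<^sub>N f g v = inner_L2 (lebesgue_on \<Omega>) v f + inner_L2 (surface_on \<Gamma>\<^sub>N) v g"

text \<open>
  Trial spaces \<open>V\<close> and \<open>div V\<close>, test spaces \<open>W\<close> and \<open>div W\<close>; the divergence is that of functions
  on \<open>\<Omega>\<close>, and the $L^2$ inner products are taken over the subset \<open>S\<close>.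
\<close>

definition mixed_solution ::
    "(real^'n::finite) set \<Rightarrow> (real^'n) set \<Rightarrow> ((real^'n \<Rightarrow> real^'n) \<Rightarrow> (real^'n \<Rightarrow> real^'n) \<Rightarrow> real)
      \<Rightarrow> ((real^'n \<Rightarrow> real^'n) \<Rightarrow> real) \<Rightarrow> (real^'n \<Rightarrow> real^'n) set \<Rightarrow> (real^'n \<Rightarrow> real^'n) set
      \<Rightarrow> (real^'n \<Rightarrow> real^'n) \<Rightarrow> (real^'n \<Rightarrow> real) \<Rightarrow> bool" where
  "mixed_solution \<Omega> S b l V W u q \<longleftrightarrow> u \<in> V \<and> q \<in> weak_div \<Omega> ` V \<and>
     (\<forall>v\<in>W. b u v - inner_L2 (lebesgue_on S) q (weak_div \<Omega> v) = l v) \<and>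
     (\<forall>r\<in>weak_div \<Omega> ` W. - inner_L2 (lebesgue_on S) r (weak_div \<Omega> u) = 0)"

definition global_system where
  "global_system \<Omega> \<T> p \<Gamma>\<^sub>D \<Gamma>\<^sub>N a f g u q \<longleftrightarrow>
     mixed_solution \<Omega> \<Omega> a (load \<Omega> \<Gamma>\<^sub>N f g) (XD \<Omega> \<T> p \<Gamma>\<^sub>D) (XD \<Omega> \<T> p \<Gamma>\<^sub>D) u q"

definition boundary_system where
  "boundary_system \<Omega> \<T> p \<Gamma>\<^sub>D \<Gamma>\<^sub>N a f g u q \<longleftrightarrow>
     mixed_solution \<Omega> \<Omega> a (load \<Omega> \<Gamma>\<^sub>N f g) (XB \<Omega> \<T> p \<Gamma>\<^sub>D a) (XB_dagger \<Omega> \<T> p \<Gamma>\<^sub>D a) u q"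

definition local_system where
  "local_system \<Omega> \<T> p \<Gamma>\<^sub>D aK f ut K u q \<longleftrightarrow>
     mixed_solution \<Omega> K (aK K) (\<lambda>v. inner_L2 (lebesgue_on K) f v - aK K ut v)
       (XI_loc \<Omega> \<T> p \<Gamma>\<^sub>D K) (XI_loc \<Omega> \<T> p \<Gamma>\<^sub>D K) u q"

definition uniquely_solvable ::
    "(real^'n::finite) set \<Rightarrow> ((real^'n \<Rightarrow> real^'n) \<Rightarrow> (real^'n \<Rightarrow> real) \<Rightarrow> bool) \<Rightarrow> bool" where
  "uniquely_solvable \<Omega> P \<longleftrightarrow> (\<exists>u q. P u q \<and>
     (\<forall>u' q'. P u' q' \<longrightarrow> u' = u \<and> (AE x in lebesgue_on \<Omega>. q' x = q x)))"

end

theory Submission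
  imports Defs
begin

text \<open>
  Since \<open>a\<close> is coercive, it is definite on the divergence-free interior functions, while the form
  \<open>(div u, div v)\<close> is definite modulo its kernel. Projecting first the divergence onto the divergences
  of interior functions and then correcting by a divergence-free interior function gives
  \<open>X\<^sub>D = XB \<oplus> X\<^sub>I = XB\<^sup>\<dagger> \<oplus> X\<^sub>I\<close>. Splitting velocity and pressure of the global solution
  accordingly, the interior part of the velocity is divergence free, so testing with \<open>XB\<^sup>\<dagger>\<close> eliminates
  all interior parts, and testing with functions supported in one element leaves the local system.
  Uniqueness for the Petrov-Galerkin system in \<open>XB \<times> XB\<^sup>\<dagger>\<close> follows by testing with the
  \<open>XB\<^sup>\<dagger>\<close>-part of the solution itself.

  The analytic input is that the weak derivatives of a continuous piecewise polynomial exist, are unique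
  almost everywhere and agree almost everywhere with the classical ones, and that the boundary of a
  polyhedral domain has finite surface measure, so that the finite element functions have traces and
  lie in the space on which \<open>a\<close> is coercive.
\<close>

section \<open>Smooth bump functions\<close>

text \<open>No inf-sup condition enters, because each pressure space is the divergence of the
  velocity space it is paired with: a pressure is stored as a velocity \<open>w\<close> having that
  divergence, and a mixed system becomes a statement about two forms on one finite-dimensional
  space, to be settled by linear algebra. The obstacle is that \<open>weak_div\<close> is built from
  a choice of weak derivatives, so even its additivity and its value on the zero function are known
  only up to null sets. Each algebraic law for the divergence therefore passes through the classical
  derivatives inside the elements, which rests on uniqueness of weak derivatives and hence on having
  enough test functions. Existence of weak derivatives is shown without integrating by parts over
  faces: the product with a test function is Lipschitz with compact support, so its directional
  derivative integrates to zero. Since \<open>a\<close> need not be symmetric, trial and test space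
  of the boundary system differ and coercivity does not apply to the pairing directly; existence
  there is inherited from the global problem, so that only uniqueness needs its own
  argument.\<close>

definition smooth1 :: "(real \<Rightarrow> real) \<Rightarrow> bool" where
  "smooth1 u \<longleftrightarrow> (\<exists>U. U 0 = u \<and> (\<forall>m t. (U m has_real_derivative U (Suc m) t) (at t)))"

lemma smooth1_const: "smooth1 (\<lambda>t. c)"
  unfolding smooth1_def
  by (rule exI[where x="\<lambda>m t. if m = 0 then c else 0"]) auto

lemma smooth1_affine:
  assumes "smooth1 u"
  shows "smooth1 (\<lambda>t. u (c * t + d))"
proof -
  obtain U where U: "U 0 = u" "\<And>m t. (U m has_real_derivative U (Suc m) t) (at t)"
    using assms unfolding smooth1_def by blast
  have "((\<lambda>t. c ^ m * U m (c * t + d)) has_real_derivative c ^ Suc m * U (Suc m) (c * t + d)) (at t)"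
    for m t
    by (rule derivative_eq_intros DERIV_chain2[OF U(2)] refl | simp)+
  then show ?thesis
    unfolding smooth1_def using U(1) by (intro exI[where x="\<lambda>m t. c ^ m * U m (c * t + d)"]) auto
qed

lemma poly_exp_decay: "((\<lambda>s. poly q s * exp (- s)) \<longlongrightarrow> 0) (at_top :: real filter)"
proof -
  have "((\<lambda>s. \<Sum>i\<le>degree q. coeff q i * (s ^ i / exp s)) \<longlongrightarrow> (\<Sum>i\<le>degree q. coeff q i * 0))
      (at_top :: real filter)"
    by (intro tendsto_intros tendsto_power_div_exp_0)
  then show ?thesis
    by (simp add: poly_altdef sum_distrib_right exp_minus divide_inverse mult.assoc)
qed

text \<open>The flat function \<open>exp (- 1 / t)\<close> together with all its derivatives: each
  of them is a polynomial in \<open>1 / t\<close> times the exponential. Carrying the polynomial as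
  a parameter closes the family under differentiation.\<close>

definition poly_cutoff :: "real poly \<Rightarrow> real \<Rightarrow> real" where
  "poly_cutoff q t = (if t > 0 then poly q (1 / t) * exp (- (1 / t)) else 0)"

lemma poly_cutoff_tendsto_0: "(poly_cutoff q \<longlongrightarrow> 0) (at 0)"
proof (rule filterlim_split_at)
  have "eventually (\<lambda>t. 0 = poly_cutoff q t) (at_left 0)"
    by (auto simp: eventually_at_filter poly_cutoff_def)
  then show "(poly_cutoff q \<longlongrightarrow> 0) (at_left 0)"
    by (rule Lim_transform_eventually[OF tendsto_const])
  have "((\<lambda>t. poly q (inverse t) * exp (- inverse t)) \<longlongrightarrow> 0) (at_right 0)"
    by (rule filterlim_compose[OF poly_exp_decay filterlim_inverse_at_top_right])
  moreover have "eventually (\<lambda>t. poly q (inverse t) * exp (- inverse t) = poly_cutoff q t) (at_right 0)"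
    by (auto simp: eventually_at_filter poly_cutoff_def field_simps)
  ultimately show "(poly_cutoff q \<longlongrightarrow> 0) (at_right 0)"
    by (rule Lim_transform_eventually)
qed

text \<open>With \<open>s = 1 / t\<close> one has \<open>ds/dt = - s^2\<close>, so
  \<open>q(s) exp(-s)\<close> has derivative \<open>s^2 (q(s) - q'(s)) exp(-s)\<close>, again a
  member of the family.\<close>

lemma poly_cutoff_deriv:
  "(poly_cutoff q has_real_derivative poly_cutoff ([:0, 0, 1:] * (q - pderiv q)) t) (at t)"
proof -
  consider "t > 0" | "t < 0" | "t = 0" by linarith
  then show ?thesis
  proof cases
    case 1
    have "((\<lambda>t. poly q (1 / t) * exp (- (1 / t))) has_real_derivative
        poly_cutoff ([:0, 0, 1:] * (q - pderiv q)) t) (at t)"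
      using 1 by (auto intro!: derivative_eq_intros DERIV_chain2[OF poly_DERIV]
          simp: poly_cutoff_def field_simps power2_eq_square)
    then show ?thesis
      by (rule has_field_derivative_transform_within_open[of _ _ _ "{0<..}"])
        (use 1 in \<open>auto simp: poly_cutoff_def\<close>)
  next
    case 2
    have "((\<lambda>t. 0) has_real_derivative 0) (at t)" by simp
    then have "(poly_cutoff q has_real_derivative 0) (at t)"
      by (rule has_field_derivative_transform_within_open[of _ _ _ "{..<0}"])
        (use 2 in \<open>auto simp: poly_cutoff_def\<close>)
    then show ?thesis using 2 by (simp add: poly_cutoff_def)
  next
    case 3
    \<comment> \<open>The difference quotient at 0 is itself a cutoff, with polynomial
      \<open>s * q(s)\<close>, so its limit is already known.\<close>
    have "poly_cutoff q h / h = poly_cutoff (pCons 0 q) h" for h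
      by (simp add: poly_cutoff_def)
    then have "((\<lambda>h. (poly_cutoff q (0 + h) - poly_cutoff q 0) / h) \<longlongrightarrow> 0) (at 0)"
      using poly_cutoff_tendsto_0[of "pCons 0 q"] by (simp add: poly_cutoff_def[of _ 0])
    then have "(poly_cutoff q has_real_derivative 0) (at 0)"
      by (simp add: DERIV_def)
    then show ?thesis using 3 by (simp add: poly_cutoff_def)
  qed
qed

lemma smooth1_exp_cutoff: "smooth1 (poly_cutoff 1)"
  unfolding smooth1_def
  by (rule exI[where x="\<lambda>m. poly_cutoff (((\<lambda>q. [:0, 0, 1:] * (q - pderiv q)) ^^ m) 1)"])
    (use poly_cutoff_deriv in auto)

text \<open>An algebra generated by smooth functions of one coordinate. It is closed under partial
  derivatives, so membership alone yields \<open>Ck k\<close> for every \<open>k\<close>, with no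
  Leibniz formula for higher derivatives of products.\<close>

inductive_set smooth_alg :: "(real^'n::finite \<Rightarrow> real) set" where
  coord: "smooth1 u \<Longrightarrow> (\<lambda>x. u (x $ i)) \<in> smooth_alg"
| add: "f \<in> smooth_alg \<Longrightarrow> g \<in> smooth_alg \<Longrightarrow> (\<lambda>x. f x + g x) \<in> smooth_alg"
| mult: "f \<in> smooth_alg \<Longrightarrow> g \<in> smooth_alg \<Longrightarrow> (\<lambda>x. f x * g x) \<in> smooth_alg"

lemma partial_deriv_eq:
  assumes "(f has_derivative f') (at x)"
  shows "partial_deriv i f x = f' (axis i 1)"
  using frechet_derivative_at[OF assms] by (simp add: partial_deriv_def)

lemma smooth_alg_partial:
  fixes f :: "real^'n::finite \<Rightarrow> real"
  assumes "f \<in> smooth_alg"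
  shows "(\<forall>x. f differentiable (at x)) \<and> (\<forall>i. partial_deriv i f \<in> smooth_alg)"
  using assms
proof induction
  case (coord u j)
  obtain U where U: "U 0 = u" "\<And>m t. (U m has_real_derivative U (Suc m) t) (at t)"
    using coord unfolding smooth1_def by blast
  have d: "((\<lambda>x::real^'n. u (x $ j)) has_derivative (\<lambda>h. U 1 (x $ j) * h $ j)) (at x)" for x
  proof -
    have "(u has_derivative (*) (U 1 (x $ j))) (at (x $ j))"
      using U(2)[of 0 "x $ j"] unfolding U(1) has_field_derivative_def by simp
    from has_derivative_compose[OF bounded_linear.has_derivative[OF bounded_linear_vec_nth has_derivative_ident] this]
    show ?thesis .
  qed
  have "smooth1 (U 1)"
    unfolding smooth1_def using U(2) by (intro exI[where x="\<lambda>m. U (Suc m)"]) auto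
  moreover have "partial_deriv i (\<lambda>x. u (x $ j)) = (\<lambda>x. if i = j then U 1 (x $ j) else 0)" for i
    by (auto simp: partial_deriv_eq[OF d] axis_def)
  ultimately have "partial_deriv i (\<lambda>x. u (x $ j)) \<in> smooth_alg" for i
    using smooth_alg.coord smooth_alg.coord[OF smooth1_const] by (cases "i = j") auto
  then show ?case using d differentiable_def by blast
next
  case (add f g)
  then have d: "(f has_derivative frechet_derivative f (at x)) (at x)"
    "(g has_derivative frechet_derivative g (at x)) (at x)" for x
    by (auto simp: frechet_derivative_works)
  have "partial_deriv i (\<lambda>x. f x + g x) = (\<lambda>x. partial_deriv i f x + partial_deriv i g x)" for i
    by (rule ext) (subst partial_deriv_eq[OF has_derivative_add[OF d]], simp add: partial_deriv_def)
  then show ?case using add by (auto intro: smooth_alg.intros)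
next
  case (mult f g)
  then have d: "(f has_derivative frechet_derivative f (at x)) (at x)"
    "(g has_derivative frechet_derivative g (at x)) (at x)" for x
    by (auto simp: frechet_derivative_works)
  have "partial_deriv i (\<lambda>x. f x * g x) = (\<lambda>x. f x * partial_deriv i g x + partial_deriv i f x * g x)"
    for i
    by (rule ext) (subst partial_deriv_eq[OF has_derivative_mult[OF d]], simp add: partial_deriv_def)
  moreover have "(\<lambda>x. f x * partial_deriv i g x + partial_deriv i f x * g x) \<in> smooth_alg" for i
    using mult by (intro smooth_alg.add[OF smooth_alg.mult smooth_alg.mult]) auto
  ultimately show ?case using mult by auto
qed

lemma smooth_alg_Ck: "f \<in> smooth_alg \<Longrightarrow> Ck k f"
proof (induction k arbitrary: f)
  case 0
  then show ?case
    using smooth_alg_partial[of f]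
    by (auto intro!: continuous_at_imp_continuous_on differentiable_imp_continuous_within)
next
  case (Suc k)
  then show ?case using smooth_alg_partial[of f] by auto
qed

lemma smooth_alg_prod:
  assumes "finite I" "\<And>i. i \<in> I \<Longrightarrow> f i \<in> smooth_alg"
  shows "(\<lambda>x. \<Prod>i\<in>I. f i x) \<in> smooth_alg"
  using assms
proof induction
  case empty
  then show ?case using smooth_alg.coord[OF smooth1_const[of 1]] by simp
next
  case (insert i I)
  then show ?case by (auto intro!: smooth_alg.mult)
qed

text \<open>The factor \<open>Suc k\<close> stretches the arguments: inside the box they tend to
  infinity, where \<open>exp (- 1 / t)\<close> tends to 1, so the bumps converge to the indicator of
  the open box. They stay between 0 and 1, which supplies domination.\<close>

definition box_bump :: "nat \<Rightarrow> real^'n::finite \<Rightarrow> real^'n \<Rightarrow> real^'n \<Rightarrow> real" where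
  "box_bump k a b x = (\<Prod>i\<in>UNIV. poly_cutoff 1 (real (Suc k) * (x $ i - a $ i)) *
     poly_cutoff 1 (real (Suc k) * (b $ i - x $ i)))"

lemma poly_cutoff_1_bounds: "0 \<le> poly_cutoff 1 t" "poly_cutoff 1 t \<le> 1"
  by (auto simp: poly_cutoff_def)

lemma box_bump_bounds: "0 \<le> box_bump k a b x" "box_bump k a b x \<le> 1"
  unfolding box_bump_def
  by (auto intro!: prod_nonneg prod_le_1 mult_le_one poly_cutoff_1_bounds mult_nonneg_nonneg)

lemma box_bump_eq_0:
  assumes "x \<notin> box a b"
  shows "box_bump k a b x = 0"
proof -
  obtain i where "\<not> (a $ i < x $ i \<and> x $ i < b $ i)"
    using assms by (auto simp: mem_box_cart)
  then have "poly_cutoff 1 (real (Suc k) * (x $ i - a $ i)) * poly_cutoff 1 (real (Suc k) * (b $ i - x $ i)) = 0"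
    by (auto simp: poly_cutoff_def zero_less_mult_iff)
  then show ?thesis unfolding box_bump_def by (intro prod_zero) auto
qed

lemma box_bump_Ck:
  fixes a b :: "real^'n::finite"
  shows "Ck m (box_bump k a b)"
proof -
  have "(\<lambda>x. poly_cutoff 1 (real (Suc k) * x $ i + (- real (Suc k) * a $ i)) *
     poly_cutoff 1 ((- real (Suc k)) * x $ i + real (Suc k) * b $ i)) \<in> smooth_alg" for i :: 'n
    by (intro smooth_alg.mult smooth_alg.coord smooth1_affine smooth1_exp_cutoff)
  then have "(\<lambda>x. \<Prod>i\<in>UNIV. poly_cutoff 1 (real (Suc k) * x $ i + (- real (Suc k) * a $ i)) *
     poly_cutoff 1 ((- real (Suc k)) * x $ i + real (Suc k) * b $ i)) \<in> smooth_alg"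
    by (intro smooth_alg_prod) auto
  then have "box_bump k a b \<in> smooth_alg"
    by (simp add: box_bump_def[abs_def] algebra_simps)
  then show ?thesis by (rule smooth_alg_Ck)
qed

lemma box_bump_test:
  assumes "cbox a b \<subseteq> \<Omega>"
  shows "box_bump k a b \<in> test_functions \<Omega>"
proof -
  have "{x. box_bump k a b x \<noteq> 0} \<subseteq> cbox a b"
    using box_bump_eq_0 box_subset_cbox by blast
  then have "closure {x. box_bump k a b x \<noteq> 0} \<subseteq> cbox a b"
    by (rule closure_minimal) (rule closed_cbox)
  moreover from this have "compact (closure {x. box_bump k a b x \<noteq> 0})"
    by (meson bounded_cbox bounded_subset closed_closure compact_eq_bounded_closed)
  ultimately show ?thesis
    using assms box_bump_Ck unfolding test_functions_def by auto
qed

lemma box_bump_tendsto: "(\<lambda>k. box_bump k a b x) \<longlonglongrightarrow> indicator (box a b) x"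
proof (cases "x \<in> box a b")
  case True
  have *: "(\<lambda>k. poly_cutoff 1 (real (Suc k) * t)) \<longlonglongrightarrow> 1" if "t > 0" for t
  proof -
    have "(\<lambda>k. exp (- (inverse (real (Suc k)) * (1 / t)))) \<longlonglongrightarrow> exp (- (0 * (1 / t)))"
      by (intro tendsto_intros LIMSEQ_inverse_real_of_nat)
    moreover have "poly_cutoff 1 (real (Suc k) * t) = exp (- (inverse (real (Suc k)) * (1 / t)))" for k
      using that by (simp add: poly_cutoff_def field_simps zero_less_mult_iff add_pos_nonneg del: of_nat_Suc)
    ultimately show ?thesis by simp
  qed
  have "(\<lambda>k. box_bump k a b x) \<longlonglongrightarrow> (\<Prod>i\<in>(UNIV::'a set). 1 * 1)"
    unfolding box_bump_def using True
    by (intro tendsto_intros *) (auto simp: mem_box_cart)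
  then show ?thesis using True by simp
next
  case False
  then show ?thesis by (simp add: box_bump_eq_0)
qed

section \<open>The fundamental lemma of the calculus of variations\<close>

text \<open>Open boxes form an intersection-stable generator of the Borel sets, and the sets over
  which \<open>g\<close> integrates to zero form a Dynkin system; the total integral is needed for
  complements.\<close>

lemma AE_zero_if_box_integrals_zero:
  fixes g :: "'a::euclidean_space \<Rightarrow> real"
  assumes int: "integrable lebesgue g"
    and total: "(\<integral>x. g x \<partial>lebesgue) = 0"
    and box0: "\<And>c d. (LINT x:box c d|lebesgue. g x) = 0"
  shows "AE x in lebesgue. g x = 0"
proof -
  have seti: "set_integrable lebesgue A g" if "A \<in> sets lebesgue" for A
    using integrable_mult_indicator[OF that int] by (simp add: set_integrable_def)
  have borel0: "(LINT x:A|lebesgue. g x) = 0" if "A \<in> sets borel" for A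
  proof -
    let ?G = "range (\<lambda>(a, b). box a b :: 'a set)"
    have sb: "sigma_sets UNIV ?G = sets borel" by (subst borel_eq_box) simp
    have "Int_stable ?G" by (auto simp: Int_stable_def box_Int_box)
    moreover have "?G \<subseteq> Pow UNIV" by simp
    moreover have "A \<in> sigma_sets UNIV ?G" using that sb by simp
    ultimately show ?thesis
    proof (induction rule: sigma_sets_induct_disjoint)
      case (basic A)
      then show ?case using box0 by auto
    next
      case empty
      then show ?case by (simp add: set_lebesgue_integral_def)
    next
      case (compl A)
      then have A: "A \<in> sets lebesgue" using sb by simp
      have "(LINT x:A \<union> (UNIV - A)|lebesgue. g x) = (LINT x:A|lebesgue. g x) + (LINT x:(UNIV - A)|lebesgue. g x)"
        using A by (intro set_integral_Un seti) auto
      moreover have "(LINT x:A \<union> (UNIV - A)|lebesgue. g x) = 0"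
        using total by (simp add: set_lebesgue_integral_def)
      ultimately show ?case using compl by simp
    next
      case (union A)
      then have A: "A i \<in> sets lebesgue" for i using sb by auto
      have "(LINT x:(\<Union>i. A i)|lebesgue. g x) = (\<Sum>i. (LINT x:(A i)|lebesgue. g x))"
        using union A by (intro lebesgue_integral_countable_add seti) (auto simp: disjoint_family_on_def)
      then show ?case using union by simp
    qed
  qed
  \<comment> \<open>The criterion for a vanishing density is applied to \<open>lborel\<close>, so
    \<open>g\<close> is replaced by a Borel function that agrees with it almost everywhere.\<close>
  obtain g' where g': "g' \<in> borel_measurable lborel" "AE x in lborel. g x = g' x"
    using completion_ex_borel_measurable_real[OF borel_measurable_integrable[OF int]] by blast
  have ae: "AE x in lebesgue. g x = g' x"
    by (rule AE_completion[OF g'(2)])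
  have g'_leb: "g' \<in> borel_measurable lebesgue"
    by (rule measurable_completion[OF g'(1)])
  have "integrable lebesgue g'"
    using integrable_cong_AE_imp[OF int g'_leb] ae by (simp add: eq_commute)
  then have "integrable lborel g'"
    using g'(1) by (simp add: integrable_completion)
  then have "AE x in lborel. g' x = 0"
  proof (rule sigma_finite_measure.density_zero[OF sigma_finite_lborel])
    fix A :: "'a set" assume A: "A \<in> sets lborel"
    have "(LINT x:A|lborel. g' x) = (LINT x:A|lebesgue. g' x)"
      using g'(1) A unfolding set_lebesgue_integral_def
      by (intro integral_completion[symmetric]) simp
    also have "\<dots> = (LINT x:A|lebesgue. g x)"
      unfolding set_lebesgue_integral_def
    proof (intro integral_cong_AE borel_measurable_scaleR borel_measurable_indicator)
      show "AE x in lebesgue. indicator A x *\<^sub>R g' x = indicator A x *\<^sub>R g x"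
        using ae by eventually_elim simp
    qed (use A g'_leb borel_measurable_integrable[OF int] in auto)
    also have "\<dots> = 0" using A by (intro borel0) auto
    finally show "(LINT x:A|lborel. g' x) = 0" .
  qed
  then have "AE x in lebesgue. g' x = 0" by (rule AE_completion)
  with ae show ?thesis by eventually_elim simp
qed

lemma lebesgue_on_integral:
  fixes f :: "'a::euclidean_space \<Rightarrow> real"
  assumes "S \<in> sets lebesgue"
  shows "(\<integral>x. f x \<partial>lebesgue_on S) = (\<integral>x. indicator S x * f x \<partial>lebesgue)"
  using assms by (simp add: integral_restrict_space)

lemma locally_integrable_cbox:
  assumes "locally_integrable \<Omega> g" "cbox a b \<subseteq> \<Omega>"
  shows "integrable lebesgue (\<lambda>x. indicator (cbox a b) x * g x)"
  using assms compact_cbox[of a b] by (simp add: locally_integrable_def set_integrable_def)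

lemma test_function_continuous:
  assumes "\<phi> \<in> test_functions \<Omega>"
  shows "continuous_on UNIV \<phi>"
proof -
  have "Ck 0 \<phi>" using assms by (simp add: test_functions_def del: Ck.simps)
  then show ?thesis by simp
qed

text \<open>Dominated convergence along the bumps of the box. The closed box is a compact subset of
  the domain, so \<open>g\<close> restricted to it is integrable and dominates.\<close>

lemma box_integral_zero_if_test_zero:
  fixes g :: "real^'n::finite \<Rightarrow> real"
  assumes \<Omega>: "open \<Omega>" and loc: "locally_integrable \<Omega> g"
    and test: "\<And>\<phi>. \<phi> \<in> test_functions \<Omega> \<Longrightarrow> (\<integral>x. g x * \<phi> x \<partial>lebesgue_on \<Omega>) = 0"
    and sub: "cbox a b \<subseteq> \<Omega>"
  shows "(LINT x:box a b|lebesgue. g x) = 0"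
proof -
  let ?g = "\<lambda>x. indicator (cbox a b) x * g x"
  have int: "integrable lebesgue ?g"
    using locally_integrable_cbox[OF loc sub] .
  have "(\<lambda>k. \<integral>x. ?g x * box_bump k a b x \<partial>lebesgue) \<longlonglongrightarrow> (\<integral>x. indicator (box a b) x * g x \<partial>lebesgue)"
  proof (rule integral_dominated_convergence[where w="\<lambda>x. \<bar>?g x\<bar>"])
    show "(\<lambda>x. indicator (box a b) x * g x) \<in> borel_measurable lebesgue"
    proof -
      have "(\<lambda>x. indicator (box a b) x * ?g x) \<in> borel_measurable lebesgue"
        by (intro borel_measurable_times borel_measurable_indicator borel_measurable_integrable[OF int]) auto
      moreover have "(\<lambda>x. indicator (box a b) x * ?g x) = (\<lambda>x. indicator (box a b) x * g x)"
        using box_subset_cbox[of a b] by (auto simp: indicator_def fun_eq_iff)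
      ultimately show ?thesis by (simp only:)
    qed
    show "(\<lambda>x. ?g x * box_bump k a b x) \<in> borel_measurable lebesgue" for k
    proof (rule borel_measurable_times)
      show "box_bump k a b \<in> borel_measurable lebesgue"
        using test_function_continuous[OF box_bump_test[OF sub]]
        by (intro measurable_completion) (simp add: borel_measurable_continuous_onI)
    qed (rule borel_measurable_integrable[OF int])
    show "integrable lebesgue (\<lambda>x. \<bar>?g x\<bar>)" by (rule integrable_abs[OF int])
    show "AE x in lebesgue. norm (?g x * box_bump k a b x) \<le> \<bar>?g x\<bar>" for k
    proof (intro AE_I2)
      fix x
      show "norm (?g x * box_bump k a b x) \<le> \<bar>?g x\<bar>"
        using mult_left_mono[OF box_bump_bounds(2)[of k a b x], of "\<bar>?g x\<bar>"] box_bump_bounds(1)[of k a b x]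
        by (simp only: real_norm_def abs_mult[of "?g x"] abs_of_nonneg abs_ge_zero mult_1_right)
    qed
    show "AE x in lebesgue. (\<lambda>k. ?g x * box_bump k a b x) \<longlonglongrightarrow> indicator (box a b) x * g x"
    proof (intro AE_I2)
      fix x
      have "(\<lambda>k. ?g x * box_bump k a b x) \<longlonglongrightarrow> ?g x * indicator (box a b) x"
        by (intro tendsto_intros box_bump_tendsto)
      moreover have "?g x * indicator (box a b) x = indicator (box a b) x * g x"
        using box_subset_cbox[of a b] by (auto simp: indicator_def)
      ultimately show "(\<lambda>k. ?g x * box_bump k a b x) \<longlonglongrightarrow> indicator (box a b) x * g x" by simp
    qed
  qed
  moreover have "(\<integral>x. ?g x * box_bump k a b x \<partial>lebesgue) = 0" for k
  proof -
    have "(\<lambda>x. ?g x * box_bump k a b x) = (\<lambda>x. indicator \<Omega> x * (g x * box_bump k a b x))"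
    proof
      fix x
      consider "x \<in> box a b" | "x \<notin> box a b" by blast
      then show "?g x * box_bump k a b x = indicator \<Omega> x * (g x * box_bump k a b x)"
      proof cases
        case 1
        then have "x \<in> cbox a b" "x \<in> \<Omega>" using sub box_subset_cbox by blast+
        then show ?thesis by simp
      qed (simp add: box_bump_eq_0)
    qed
    then show ?thesis
      using test[OF box_bump_test[OF sub, of k]] \<Omega> by (simp add: lebesgue_on_integral)
  qed
  ultimately have "(\<lambda>k::nat. 0) \<longlonglongrightarrow> (\<integral>x. indicator (box a b) x * g x \<partial>lebesgue)"
    by (simp only:)
  then have "(\<integral>x. indicator (box a b) x * g x \<partial>lebesgue) = 0"
    by (simp add: LIMSEQ_const_iff)
  then show ?thesis by (simp add: set_lebesgue_integral_def)
qed

theorem fundamental_lemma_calculus_of_variations: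
  fixes g :: "real^'n::finite \<Rightarrow> real"
  assumes \<Omega>: "open \<Omega>" and loc: "locally_integrable \<Omega> g"
    and test: "\<And>\<phi>. \<phi> \<in> test_functions \<Omega> \<Longrightarrow> (\<integral>x. g x * \<phi> x \<partial>lebesgue_on \<Omega>) = 0"
  shows "AE x in lebesgue_on \<Omega>. g x = 0"
proof -
  have cbox0: "AE x in lebesgue. x \<in> cbox a b \<longrightarrow> g x = 0" if sub: "cbox a b \<subseteq> \<Omega>" for a b
  proof -
    \<comment> \<open>Cutting off at a box makes \<open>g\<close> globally integrable, and since
      boxes intersect in boxes the integrals of the truncated function over all boxes are again of
      the known kind.\<close>
    let ?g = "\<lambda>x. indicator (box a b) x * g x"
    have "AE x in lebesgue. ?g x = 0"
    proof (rule AE_zero_if_box_integrals_zero)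
      have "integrable lebesgue (\<lambda>x. indicator (cbox a b) x * g x)"
        using locally_integrable_cbox[OF loc sub] .
      then have "integrable lebesgue (\<lambda>x. indicator (box a b) x *\<^sub>R (indicator (cbox a b) x * g x))"
        by (intro integrable_mult_indicator) auto
      moreover have "(\<lambda>x. indicator (box a b) x *\<^sub>R (indicator (cbox a b) x * g x)) = ?g"
        using box_subset_cbox[of a b] by (auto simp: indicator_def fun_eq_iff)
      ultimately show "integrable lebesgue ?g" by (simp only:)
      show "(\<integral>x. ?g x \<partial>lebesgue) = 0"
        using box_integral_zero_if_test_zero[OF assms sub] by (simp add: set_lebesgue_integral_def)
      fix c d :: "real^'n"
      obtain a' b' where box: "box c d \<inter> box a b = box a' b'"
        unfolding box_Int_box by blast
      have "(LINT x:box c d|lebesgue. ?g x) = (LINT x:box a' b'|lebesgue. g x)"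
        unfolding set_lebesgue_integral_def box[symmetric] by (simp add: indicator_inter_arith mult.assoc)
      \<comment> \<open>Only for a nonempty open box is the closed box its closure; an empty
        \<open>box a' b'\<close> may have endpoints whose closed box lies outside
        \<open>cbox a b\<close>.\<close>
      also have "\<dots> = 0"
      proof (cases "box a' b' = {}")
        case False
        then have "cbox a' b' = closure (box a' b')" by (simp add: closure_box)
        also have "\<dots> \<subseteq> cbox a b"
          using box box_subset_cbox[of a b] by (intro closure_minimal) auto
        finally show ?thesis using sub by (intro box_integral_zero_if_test_zero[OF assms]) auto
      qed (simp add: set_lebesgue_integral_def)
      finally show "(LINT x:box c d|lebesgue. ?g x) = 0" .
    qed
    moreover have "AE x in lebesgue. x \<notin> cbox a b - box a b"
      using negligible_frontier_interval[of a b] by (intro AE_not_in) (simp add: negligible_iff_null_sets)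
    ultimately show ?thesis by eventually_elim (auto simp: indicator_def)
  qed
  obtain \<D> where D: "countable \<D>" "\<D> \<subseteq> Pow \<Omega>" "\<And>X. X \<in> \<D> \<Longrightarrow> \<exists>a b. X = cbox a b" "\<Union>\<D> = \<Omega>"
    using open_countable_Union_open_cbox[OF \<Omega>] by metis
  have "AE x in lebesgue. \<forall>X\<in>\<D>. x \<in> X \<longrightarrow> g x = 0"
  proof (rule AE_ball_countable'[OF _ D(1)])
    fix X assume X: "X \<in> \<D>"
    then obtain a b where "X = cbox a b" using D(3) by blast
    then show "AE x in lebesgue. x \<in> X \<longrightarrow> g x = 0" using cbox0 X D(2) by blast
  qed
  then have "AE x in lebesgue. x \<in> \<Omega> \<longrightarrow> g x = 0"
    by eventually_elim (use D(4) in blast)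
  then show ?thesis using \<Omega> by (simp add: AE_restrict_space_iff)
qed

section \<open>Functions with a continuous gradient\<close>

text \<open>Continuous differentiability with the gradient as explicit witness. It covers the
  polynomial pieces and the test functions alike, so that their products are handled by a single
  product rule.\<close>

definition has_cont_grad :: "('a::real_inner \<Rightarrow> real) \<Rightarrow> ('a \<Rightarrow> 'a) \<Rightarrow> bool" where
  "has_cont_grad P G \<longleftrightarrow> continuous_on UNIV G \<and> (\<forall>x. (P has_derivative (\<lambda>h. G x \<bullet> h)) (at x))"

lemma has_cont_grad_continuous: "has_cont_grad P G \<Longrightarrow> continuous_on S P"
  unfolding has_cont_grad_def
  by (meson continuous_at_imp_continuous_on has_derivative_continuous)

lemma has_cont_grad_const: "has_cont_grad (\<lambda>x. c) (\<lambda>x. 0)"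
  by (simp add: has_cont_grad_def)

lemma has_cont_grad_coord: "has_cont_grad (\<lambda>x::real^'n::finite. x $ i) (\<lambda>x. axis i 1)"
  by (simp add: has_cont_grad_def inner_axis' bounded_linear_imp_has_derivative bounded_linear_vec_nth)

lemma has_cont_grad_add:
  assumes "has_cont_grad P G" "has_cont_grad Q H"
  shows "has_cont_grad (\<lambda>x. P x + Q x) (\<lambda>x. G x + H x)"
  using assms by (auto simp: has_cont_grad_def inner_add_left intro!: continuous_intros has_derivative_add)

lemma has_cont_grad_mult:
  assumes "has_cont_grad P G" "has_cont_grad Q H"
  shows "has_cont_grad (\<lambda>x. P x * Q x) (\<lambda>x. P x *\<^sub>R H x + Q x *\<^sub>R G x)"
proof -
  have "((\<lambda>x. P x * Q x) has_derivative (\<lambda>h. (P x *\<^sub>R H x + Q x *\<^sub>R G x) \<bullet> h)) (at x)" for x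
    using has_derivative_mult[of P "\<lambda>h. G x \<bullet> h" x UNIV Q "\<lambda>h. H x \<bullet> h"] assms
    by (simp add: has_cont_grad_def inner_add_left algebra_simps)
  moreover have "continuous_on UNIV (\<lambda>x. P x *\<^sub>R H x + Q x *\<^sub>R G x)"
    using assms has_cont_grad_continuous by (auto simp: has_cont_grad_def intro!: continuous_intros)
  ultimately show ?thesis by (simp add: has_cont_grad_def)
qed

lemma has_cont_grad_sum:
  assumes "finite A" "\<And>a. a \<in> A \<Longrightarrow> \<exists>G. has_cont_grad (P a) G"
  shows "\<exists>G. has_cont_grad (\<lambda>x. \<Sum>a\<in>A. P a x) G"
  using assms
proof induction
  case empty
  show ?case using has_cont_grad_const[of 0] by (intro exI[where x="\<lambda>x. 0"]) simp
next
  case (insert a A)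
  obtain G where G: "has_cont_grad (P a) G" using insert.prems by auto
  obtain H where H: "has_cont_grad (\<lambda>x. \<Sum>a\<in>A. P a x) H" using insert.IH insert.prems by auto
  from has_cont_grad_add[OF G H] insert.hyps show ?case by auto
qed

lemma has_cont_grad_prod:
  assumes "finite A" "\<And>a. a \<in> A \<Longrightarrow> \<exists>G. has_cont_grad (P a) G"
  shows "\<exists>G. has_cont_grad (\<lambda>x. \<Prod>a\<in>A. P a x) G"
  using assms
proof induction
  case empty
  show ?case using has_cont_grad_const[of 1] by (intro exI[where x="\<lambda>x. 0"]) simp
next
  case (insert a A)
  obtain G where G: "has_cont_grad (P a) G" using insert.prems by auto
  obtain H where H: "has_cont_grad (\<lambda>x. \<Prod>a\<in>A. P a x) H" using insert.IH insert.prems by auto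
  from has_cont_grad_mult[OF G H] insert.hyps show ?case by auto
qed

lemma has_cont_grad_power:
  assumes "has_cont_grad P G"
  shows "\<exists>H. has_cont_grad (\<lambda>x. P x ^ k) H"
  using has_cont_grad_prod[of "{..<k}" "\<lambda>_. P"] assms by auto

lemma finite_multi_indices: "finite {\<alpha> :: 'n::finite \<Rightarrow> nat. (\<Sum>i\<in>UNIV. \<alpha> i) \<le> p}"
proof (rule finite_subset)
  show "{\<alpha> :: 'n \<Rightarrow> nat. (\<Sum>i\<in>UNIV. \<alpha> i) \<le> p} \<subseteq> UNIV \<rightarrow>\<^sub>E {..p}"
  proof
    fix \<alpha> :: "'n \<Rightarrow> nat" assume "\<alpha> \<in> {\<alpha>. (\<Sum>i\<in>UNIV. \<alpha> i) \<le> p}"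
    then have "\<alpha> i \<le> p" for i
      using member_le_sum[of i UNIV \<alpha>] by (metis UNIV_I finite le_trans mem_Collect_eq zero_le)
    then show "\<alpha> \<in> UNIV \<rightarrow>\<^sub>E {..p}" by auto
  qed
qed (auto intro: finite_PiE)

lemma poly_upto_cont_grad:
  fixes P :: "real^'n::finite \<Rightarrow> real"
  assumes "P \<in> poly_upto p"
  shows "\<exists>G. has_cont_grad P G"
proof -
  obtain c where c: "P = (\<lambda>x. \<Sum>\<alpha>\<in>{\<alpha>. (\<Sum>i\<in>UNIV. \<alpha> i) \<le> p}. c \<alpha> * (\<Prod>i\<in>UNIV. (x $ i) ^ \<alpha> i))"
    using assms unfolding poly_upto_def by blast
  have "\<exists>G. has_cont_grad (\<lambda>x::real^'n. c \<alpha> * (\<Prod>i\<in>UNIV. (x $ i) ^ \<alpha> i)) G" for \<alpha>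
  proof -
    obtain G where "has_cont_grad (\<lambda>x::real^'n. \<Prod>i\<in>UNIV. (x $ i) ^ \<alpha> i) G"
      using has_cont_grad_prod[of UNIV "\<lambda>i x. (x $ i) ^ \<alpha> i"] has_cont_grad_power[OF has_cont_grad_coord]
      by auto
    from has_cont_grad_mult[OF has_cont_grad_const this] show ?thesis by blast
  qed
  then show ?thesis unfolding c by (intro has_cont_grad_sum finite_multi_indices) auto
qed

lemma test_function_cont_grad:
  fixes \<phi> :: "real^'n::finite \<Rightarrow> real"
  assumes "\<phi> \<in> test_functions \<Omega>"
  shows "has_cont_grad \<phi> (\<lambda>x. \<chi> i. partial_deriv i \<phi> x)"
proof -
  have Ck: "Ck (Suc 0) \<phi>" using assms by (simp add: test_functions_def del: Ck.simps)
  then have cont: "continuous_on UNIV (partial_deriv i \<phi>)" for i by simp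
  have "(\<phi> has_derivative (\<lambda>h. (\<chi> i. partial_deriv i \<phi> x) \<bullet> h)) (at x)" for x
  proof -
    have d: "(\<phi> has_derivative frechet_derivative \<phi> (at x)) (at x)"
      using Ck by (simp add: frechet_derivative_works[symmetric])
    then have lin: "linear (frechet_derivative \<phi> (at x))"
      by (rule has_derivative_linear)
    have "frechet_derivative \<phi> (at x) h = (\<chi> i. partial_deriv i \<phi> x) \<bullet> h" for h
    proof -
      have "frechet_derivative \<phi> (at x) h = frechet_derivative \<phi> (at x) (\<Sum>i\<in>UNIV. h $ i *\<^sub>R axis i 1)"
        by (metis (no_types) basis_expansion scalar_mult_eq_scaleR)
      also have "\<dots> = (\<Sum>i\<in>UNIV. h $ i * partial_deriv i \<phi> x)"
        by (simp add: linear_sum[OF lin] linear_cmul[OF lin] partial_deriv_def)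
      finally show ?thesis by (simp add: inner_vec_def mult.commute)
    qed
    then show ?thesis using d by presburger
  qed
  then show ?thesis using cont by (simp add: has_cont_grad_def continuous_on_vec_lambda)
qed

lemma has_cont_grad_lipschitz:
  fixes P :: "'a::euclidean_space \<Rightarrow> real"
  assumes "has_cont_grad P G" "compact K" "convex K"
  shows "\<exists>L\<ge>0. L-lipschitz_on K P"
proof -
  have "continuous_on K G" using assms(1) continuous_on_subset by (auto simp: has_cont_grad_def)
  then have "bounded (G ` K)" by (intro compact_imp_bounded compact_continuous_image assms)
  then obtain B where B: "\<And>x. x \<in> K \<Longrightarrow> norm (G x) \<le> B" by (auto simp: bounded_iff)
  \<comment> \<open>The bound \<open>B\<close> may be negative when \<open>K\<close> is
    empty.\<close>
  let ?B = "max B 0"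
  have "norm (P x - P y) \<le> ?B * norm (x - y)" if "x \<in> K" "y \<in> K" for x y
  proof (rule differentiable_bound[OF \<open>convex K\<close> _ _ that])
    show "(P has_derivative (\<lambda>h. G z \<bullet> h)) (at z within K)" for z
      using assms(1) by (auto simp: has_cont_grad_def intro: has_derivative_at_withinI)
    show "onorm (\<lambda>h. G z \<bullet> h) \<le> ?B" if "z \<in> K" for z
    proof (rule onorm_bound)
      show "norm (G z \<bullet> h) \<le> ?B * norm h" for h
      proof -
        have "norm (G z) \<le> ?B" using B[OF that] by simp
        from mult_right_mono[OF this norm_ge_zero[of h]] Cauchy_Schwarz_ineq2[of "G z" h]
        show ?thesis by (simp only: real_norm_def)
      qed
    qed simp
  qed
  then show ?thesis by (intro exI[of _ ?B]) (auto simp: lipschitz_on_def dist_norm)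
qed

text \<open>By translation invariance every difference quotient of a compactly supported function has
  integral zero; the Lipschitz bound allows passing to the limit.\<close>

lemma integral_directional_derivative_zero:
  fixes F D :: "'a::euclidean_space \<Rightarrow> real"
  assumes cont: "continuous_on UNIV F"
    and supp: "\<And>x. norm x > R \<Longrightarrow> F x = 0"
    and lip: "\<And>x h. \<bar>F (x + h *\<^sub>R e) - F x\<bar> \<le> L * \<bar>h\<bar>"
    and e: "norm e = 1"
    and meas: "D \<in> borel_measurable lebesgue"
    and deriv: "AE x in lebesgue. ((\<lambda>t. F (x + t *\<^sub>R e)) has_real_derivative D x) (at 0)"
  shows "(\<integral>x. D x \<partial>lebesgue) = 0"
proof -
  define s where "s k x = real (Suc k) * (F (x + inverse (real (Suc k)) *\<^sub>R e) - F x)" for k x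
  have intF: "integrable lborel F"
  proof -
    have "integrable lborel (\<lambda>x. indicator (cball 0 R) x *\<^sub>R F x)"
      using cont by (intro borel_integrable_compact) (auto intro: continuous_on_subset)
    moreover have "(\<lambda>x. indicator (cball 0 R) x *\<^sub>R F x) = F"
      using supp by (auto simp: indicator_def fun_eq_iff)
    ultimately show ?thesis by simp
  qed
  have Fb: "F \<in> borel_measurable borel" using cont by (simp add: borel_measurable_continuous_onI)
  have shift: "integrable lborel (\<lambda>x. F (x + c))" "(\<integral>x. F (x + c) \<partial>lborel) = (\<integral>x. F x \<partial>lborel)" for c
  proof -
    have "integrable (distr lborel borel ((+) c)) F" using intF by (simp add: lborel_distr_plus)
    then show "integrable lborel (\<lambda>x. F (x + c))"
      by (subst (asm) integrable_distr_eq) (use Fb in \<open>auto simp: add.commute\<close>)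
    have "(\<integral>x. F x \<partial>distr lborel borel ((+) c)) = (\<integral>x. F (c + x) \<partial>lborel)"
      by (rule integral_distr) (use Fb in auto)
    then show "(\<integral>x. F (x + c) \<partial>lborel) = (\<integral>x. F x \<partial>lborel)"
      by (simp add: lborel_distr_plus add.commute)
  qed
  have sb: "s k \<in> borel_measurable lborel" for k
    unfolding s_def using borel_measurable_integrable[OF shift(1)] borel_measurable_integrable[OF intF]
    by (intro borel_measurable_times borel_measurable_diff) auto
  have s0: "(\<integral>x. s k x \<partial>lebesgue) = 0" for k
  proof -
    have "(\<integral>x. s k x \<partial>lebesgue) = (\<integral>x. s k x \<partial>lborel)" using sb by (rule integral_completion)
    also have "\<dots> = 0" unfolding s_def using shift intF by simp
    finally show ?thesis .
  qed
  have "(\<lambda>k. \<integral>x. s k x \<partial>lebesgue) \<longlonglongrightarrow> (\<integral>x. D x \<partial>lebesgue)"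
  \<comment> \<open>All steps have length at most 1, so every difference quotient vanishes outside
    the ball of radius \<open>R + 1\<close> and is bounded by \<open>L\<close> inside.\<close>
  proof (rule integral_dominated_convergence[where w="\<lambda>x. indicator (cball 0 (R + 1)) x *\<^sub>R L", OF meas])
    show "s k \<in> borel_measurable lebesgue" for k by (rule measurable_completion[OF sb])
    have "integrable lborel (\<lambda>x::'a. indicator (cball 0 (R + 1)) x *\<^sub>R L)"
      by (rule borel_integrable_compact) auto
    then show "integrable lebesgue (\<lambda>x::'a. indicator (cball 0 (R + 1)) x *\<^sub>R L)"
      by (subst integrable_completion) auto
    show "AE x in lebesgue. norm (s k x) \<le> indicator (cball 0 (R + 1)) x *\<^sub>R L" for k
    proof (intro AE_I2)
      fix x
      let ?h = "inverse (real (Suc k))"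
      have h: "0 < ?h" "?h \<le> 1" by (auto simp: inverse_le_1_iff)
      show "norm (s k x) \<le> indicator (cball 0 (R + 1)) x *\<^sub>R L"
      proof (cases "x \<in> cball 0 (R + 1)")
        case True
        have "norm (s k x) = real (Suc k) * \<bar>F (x + ?h *\<^sub>R e) - F x\<bar>"
          by (simp add: s_def abs_mult del: of_nat_Suc)
        also have "\<dots> \<le> real (Suc k) * (L * \<bar>?h\<bar>)" by (intro mult_left_mono lip) auto
        also have "\<dots> = L" using h by (simp del: of_nat_Suc)
        finally show ?thesis using True by simp
      next
        case False
        then have n: "norm x > R + 1" by simp
        have "norm x \<le> norm (x + ?h *\<^sub>R e) + norm (?h *\<^sub>R e)"
          by (metis add_diff_cancel_right' norm_triangle_ineq4)
        then have "norm (x + ?h *\<^sub>R e) > R" using n h e by (simp del: of_nat_Suc)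
        then show ?thesis using False n supp by (simp add: s_def)
      qed
    qed
    show "AE x in lebesgue. (\<lambda>k. s k x) \<longlonglongrightarrow> D x"
      using deriv
    proof eventually_elim
      case (elim x)
      then have "(\<lambda>h. (F (x + h *\<^sub>R e) - F x) / h) \<midarrow>0\<rightarrow> D x" by (simp add: DERIV_def)
      moreover have "filterlim (\<lambda>k. inverse (real (Suc k))) (at 0) sequentially"
        unfolding filterlim_at using LIMSEQ_inverse_real_of_nat by auto
      ultimately have "(\<lambda>k. (F (x + inverse (real (Suc k)) *\<^sub>R e) - F x) / inverse (real (Suc k))) \<longlonglongrightarrow> D x"
        by (rule filterlim_compose)
      then show ?case by (simp add: s_def field_simps del: of_nat_Suc)
    qed
  qed
  then show ?thesis unfolding s0 by (simp add: LIMSEQ_const_iff)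
qed

section \<open>Weak derivatives of continuous piecewise polynomials\<close>

text \<open>Completeness of Lebesgue measure. It is what makes a chosen weak derivative measurable,
  as such a function is known only almost everywhere.\<close>

lemma lebesgue_on_measurable_AE:
  fixes f g :: "'a::euclidean_space \<Rightarrow> real"
  assumes S: "S \<in> sets lebesgue" and f: "f \<in> borel_measurable (lebesgue_on S)"
    and ae: "AE x in lebesgue_on S. f x = g x"
  shows "g \<in> borel_measurable (lebesgue_on S)"
proof -
  have "(\<lambda>x. if x \<in> S then f x else 0) \<in> borel_measurable lebesgue"
    using f S by (simp add: borel_measurable_if)
  moreover have "AE x in lebesgue. (if x \<in> S then f x else 0) = (if x \<in> S then g x else 0)"
    using ae S by (simp add: AE_restrict_space_iff)
  ultimately have "(\<lambda>x. if x \<in> S then g x else 0) \<in> borel_measurable lebesgue"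
    by (rule borel_measurable_AE)
  then show ?thesis using S by (simp add: borel_measurable_if)
qed

lemma bounded_measurable_locally_integrable:
  fixes f :: "real^'n::finite \<Rightarrow> real"
  assumes \<Omega>: "open \<Omega>" and f: "f \<in> borel_measurable (lebesgue_on \<Omega>)" and bd: "\<And>x. \<bar>f x\<bar> \<le> B"
  shows "locally_integrable \<Omega> f"
  unfolding locally_integrable_def
proof (intro allI impI)
  fix C :: "(real^'n) set" assume C: "compact C \<and> C \<subseteq> \<Omega>"
  have "(\<lambda>x. if x \<in> \<Omega> then f x else 0) \<in> borel_measurable lebesgue"
    using f \<Omega> by (simp add: borel_measurable_if)
  then have "(\<lambda>x. indicator C x *\<^sub>R (if x \<in> \<Omega> then f x else 0)) \<in> borel_measurable lebesgue"
    using C by (intro borel_measurable_scaleR borel_measurable_indicator) (auto simp: borel_compact)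
  moreover have "(\<lambda>x. indicator C x *\<^sub>R (if x \<in> \<Omega> then f x else 0)) = (\<lambda>x. indicator C x *\<^sub>R f x)"
    using C by (auto simp: indicator_def fun_eq_iff)
  ultimately have meas: "(\<lambda>x. indicator C x *\<^sub>R f x) \<in> borel_measurable lebesgue" by simp
  have "integrable lborel (\<lambda>x. indicator C x *\<^sub>R B)"
    using C by (intro borel_integrable_compact) auto
  then have "integrable lebesgue (\<lambda>x. indicator C x *\<^sub>R B)"
    by (subst integrable_completion) (use C in \<open>auto simp: borel_compact intro!: borel_measurable_scaleR\<close>)
  then have "integrable lebesgue (\<lambda>x. indicator C x *\<^sub>R f x)"
  proof (rule Bochner_Integration.integrable_bound[OF _ meas])
    show "AE x in lebesgue. norm (indicator C x *\<^sub>R f x) \<le> norm (indicator C x *\<^sub>R B)"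
      using bd by (intro AE_I2) (auto simp: indicator_def intro: order_trans[OF bd])
  qed
  then show "set_integrable lebesgue C f" by (simp add: set_integrable_def)
qed

lemma locally_integrable_diff:
  assumes "locally_integrable \<Omega> f" "locally_integrable \<Omega> g"
  shows "locally_integrable \<Omega> (\<lambda>x. f x - g x)"
  using assms by (auto simp: locally_integrable_def intro!: set_integral_diff)

lemma locally_integrable_times_test:
  fixes g :: "real^'n::finite \<Rightarrow> real"
  assumes \<Omega>: "open \<Omega>" and g: "locally_integrable \<Omega> g" and \<phi>: "\<phi> \<in> test_functions \<Omega>"
  shows "integrable (lebesgue_on \<Omega>) (\<lambda>x. g x * \<phi> x)"
proof -
  define C where "C = closure {x. \<phi> x \<noteq> 0}"
  have C: "compact C" "C \<subseteq> \<Omega>" using \<phi> by (auto simp: test_functions_def C_def)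
  have cont: "continuous_on UNIV \<phi>" using test_function_continuous[OF \<phi>] .
  then have "bounded (\<phi> ` C)"
    using C by (intro compact_imp_bounded compact_continuous_image) (auto intro: continuous_on_subset)
  then obtain B where B: "\<And>x. x \<in> C \<Longrightarrow> \<bar>\<phi> x\<bar> \<le> B" by (auto simp: bounded_iff)
  have gC: "integrable lebesgue (\<lambda>x. indicator C x * g x)"
    using g C by (auto simp: locally_integrable_def set_integrable_def)
  have "integrable lebesgue (\<lambda>x. indicator C x * g x * \<phi> x)"
  proof (rule Bochner_Integration.integrable_bound[where f="\<lambda>x. B * (indicator C x * g x)"])
    show "integrable lebesgue (\<lambda>x. B * (indicator C x * g x))" using gC by (rule integrable_mult_right)
    show "(\<lambda>x. indicator C x * g x * \<phi> x) \<in> borel_measurable lebesgue"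
      using cont by (intro borel_measurable_times[OF borel_measurable_integrable[OF gC]] measurable_completion)
        (simp add: borel_measurable_continuous_onI)
    show "AE x in lebesgue. norm (indicator C x * g x * \<phi> x) \<le> norm (B * (indicator C x * g x))"
    proof (intro AE_I2)
      fix x
      show "norm (indicator C x * g x * \<phi> x) \<le> norm (B * (indicator C x * g x))"
      proof (cases "x \<in> C")
        case True
        then have "\<bar>g x\<bar> * \<bar>\<phi> x\<bar> \<le> \<bar>g x\<bar> * \<bar>B\<bar>" using B[OF True] by (intro mult_left_mono) auto
        then show ?thesis using True by (simp add: abs_mult mult.commute)
      qed simp
    qed
  qed
  moreover have "(\<lambda>x. indicator C x * g x * \<phi> x) = (\<lambda>x. indicator \<Omega> x *\<^sub>R (g x * \<phi> x))"
  proof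
    fix x
    have "\<phi> x = 0" if "x \<notin> C" using that closure_subset[of "{x. \<phi> x \<noteq> 0}"] by (auto simp: C_def)
    then show "indicator C x * g x * \<phi> x = indicator \<Omega> x *\<^sub>R (g x * \<phi> x)"
      using C by (auto simp: indicator_def)
  qed
  ultimately show ?thesis using \<Omega> by (simp add: integrable_restrict_space)
qed

text \<open>Both candidates have the same integral against each test function, so the fundamental
  lemma applies to their difference. This pins down the choice in
  \<open>weak_partial\<close>.\<close>

theorem weak_partial_unique:
  fixes g h :: "real^'n::finite \<Rightarrow> real"
  assumes \<Omega>: "open \<Omega>" and g: "has_weak_partial \<Omega> i f g" and h: "has_weak_partial \<Omega> i f h"
  shows "AE x in lebesgue_on \<Omega>. g x = h x"
proof -
  have "AE x in lebesgue_on \<Omega>. g x - h x = 0"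
  proof (rule fundamental_lemma_calculus_of_variations[OF \<Omega>])
    show "locally_integrable \<Omega> (\<lambda>x. g x - h x)"
      using g h by (intro locally_integrable_diff) (auto simp: has_weak_partial_def)
    fix \<phi> assume \<phi>: "\<phi> \<in> test_functions \<Omega>"
    have "integrable (lebesgue_on \<Omega>) (\<lambda>x. g x * \<phi> x)" "integrable (lebesgue_on \<Omega>) (\<lambda>x. h x * \<phi> x)"
      using g h \<phi> \<Omega> by (auto simp: has_weak_partial_def intro!: locally_integrable_times_test)
    moreover have "(\<integral>x. g x * \<phi> x \<partial>lebesgue_on \<Omega>) = (\<integral>x. h x * \<phi> x \<partial>lebesgue_on \<Omega>)"
      using g h \<phi> by (force simp: has_weak_partial_def)
    ultimately show "(\<integral>x. (g x - h x) * \<phi> x \<partial>lebesgue_on \<Omega>) = 0"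
      by (simp add: left_diff_distrib)
  qed
  then show ?thesis by simp
qed

section \<open>Geometry of simplicial meshes\<close>

lemma simplex_compact_convex: "n simplex K \<Longrightarrow> compact K" "n simplex K \<Longrightarrow> convex K"
  using simplex_imp_polytope polytope_imp_compact polytope_imp_convex by blast+

locale mesh =
  fixes \<Omega> :: "(real^'n::finite) set" and \<T> :: "(real^'n) set set"
  assumes open_dom: "open \<Omega>" and bounded_dom: "bounded \<Omega>" and simplicial: "simplicial_mesh \<Omega> \<T>"
begin

lemma finite_mesh: "finite \<T>"
  using simplicial by (auto simp: simplicial_mesh_def triangulation_def)

lemma mesh_compact: "K \<in> \<T> \<Longrightarrow> compact K" and mesh_convex: "K \<in> \<T> \<Longrightarrow> convex K"
  using simplicial simplex_compact_convex[of "int CARD('n)"] by (auto simp: simplicial_mesh_def)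

lemma mesh_closed: "K \<in> \<T> \<Longrightarrow> closed K"
  by (simp add: compact_imp_closed mesh_compact)

lemma mesh_interior: "K \<in> \<T> \<Longrightarrow> interior K \<subseteq> \<Omega>"
  using simplicial by (auto simp: simplicial_mesh_def)

lemma mesh_Union: "\<Union>\<T> = closure \<Omega>"
  using simplicial by (auto simp: simplicial_mesh_def)

lemma compact_closure_dom: "compact (closure \<Omega>)"
  using bounded_dom by (simp add: compact_closure)

lemma dom_lebesgue: "\<Omega> \<in> sets lebesgue"
  using open_dom by simp

lemma mesh_lebesgue: "K \<in> \<T> \<Longrightarrow> K \<in> sets lebesgue"
  using mesh_closed by simp

text \<open>The intersection of two elements is a face of each, and a face that meets the interior
  of a convex set is the whole set; this is used once for \<open>K\<close> and once for
  \<open>K'\<close>.\<close>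

lemma mesh_interior_unique:
  assumes "K \<in> \<T>" "K' \<in> \<T>" "x \<in> interior K" "x \<in> K'"
  shows "K = K'"
proof -
  have face: "K \<inter> K' face_of K" "K' \<inter> K face_of K'"
    using simplicial assms by (auto simp: simplicial_mesh_def triangulation_def)
  have x: "x \<in> K" using assms(3) interior_subset by blast
  have "K \<inter> K' = K"
    using face_of_disjoint_interior[OF face(1)] assms x by blast
  then have sub: "K \<subseteq> K'" by blast
  then have "x \<in> interior K'" using assms(3) interior_mono by blast
  then have "K' \<inter> K = K'"
    using face_of_disjoint_interior[OF face(2)] x assms by blast
  then show ?thesis using sub by blast
qed

text \<open>Frontiers of convex sets are negligible and there are finitely many elements, so the
  skeleton of the mesh is a null set.\<close>

lemma AE_mesh_interior: "AE x in lebesgue. x \<in> closure \<Omega> \<longrightarrow> (\<exists>K\<in>\<T>. x \<in> interior K)"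
proof -
  have "AE x in lebesgue. \<forall>K\<in>\<T>. x \<notin> frontier K"
    using finite_mesh mesh_convex
    by (intro AE_ball_countable' AE_not_in)
      (auto simp: negligible_iff_null_sets[symmetric] negligible_convex_frontier countable_finite)
  then show ?thesis
  proof eventually_elim
    case (elim x)
    show ?case
    proof
      assume "x \<in> closure \<Omega>"
      then obtain K where "K \<in> \<T>" "x \<in> K" using mesh_Union by blast
      then show "\<exists>K\<in>\<T>. x \<in> interior K"
        using elim mesh_closed by (auto simp: frontier_def closure_closed)
    qed
  qed
qed

lemma AE_dom_interior: "AE x in lebesgue_on \<Omega>. \<exists>K\<in>\<T>. x \<in> interior K"
  using AE_mesh_interior closure_subset[of \<Omega>] dom_lebesgue
  by (auto simp: AE_restrict_space_iff elim!: eventually_mono)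

section \<open>Continuous piecewise polynomials and their derivatives\<close>

lemma X_space_gradients:
  assumes "f \<in> X_space \<Omega> \<T> p"
  obtains P G where "\<And>K. K \<in> \<T> \<Longrightarrow> has_cont_grad (P K) (G K)" "\<And>K x. K \<in> \<T> \<Longrightarrow> x \<in> K \<Longrightarrow> f x = P K x"
proof -
  define Q where "Q K P G \<longleftrightarrow> has_cont_grad P G \<and> (\<forall>x\<in>K. f x = P x)" for K P G
  have "\<forall>K\<in>\<T>. \<exists>P. \<exists>G. Q K P G"
  proof
    fix K assume "K \<in> \<T>"
    then obtain P where P: "P \<in> poly_upto p" "\<forall>x\<in>K. f x = P x"
      using assms by (auto simp: X_space_def)
    obtain G where "has_cont_grad P G" using poly_upto_cont_grad[OF P(1)] by (rule exE)
    then show "\<exists>P. \<exists>G. Q K P G" unfolding Q_def using P(2) by (intro exI conjI)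
  qed
  from bchoice[OF this] obtain P where "\<forall>K\<in>\<T>. \<exists>G. Q K (P K) G" by (rule exE)
  from bchoice[OF this] obtain G where PG: "\<forall>K\<in>\<T>. Q K (P K) (G K)" by (rule exE)
  show thesis
  proof (rule that)
    show "has_cont_grad (P K) (G K)" if "K \<in> \<T>" for K
      using bspec[OF PG that] by (simp add: Q_def)
    show "f x = P K x" if "K \<in> \<T>" "x \<in> K" for K x
      using bspec[OF PG that(1)] that(2) by (simp add: Q_def)
  qed
qed

lemma X_space_has_derivative:
  assumes "K \<in> \<T>" "x \<in> interior K" "has_cont_grad P G" "\<And>x. x \<in> K \<Longrightarrow> f x = P x"
  shows "(f has_derivative (\<lambda>h. G x \<bullet> h)) (at x)"
proof (rule has_derivative_transform_within_open[where f=P and s="interior K"])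
  show "(P has_derivative (\<lambda>h. G x \<bullet> h)) (at x)" using assms(3) by (simp add: has_cont_grad_def)
  show "P y = f y" if "y \<in> interior K" for y
  proof -
    have "y \<in> K" using that interior_subset by (rule subsetD[rotated])
    then show ?thesis by (simp add: assms(4))
  qed
  show "x \<in> interior K" by (rule assms(2))
qed simp

lemma X_space_differentiable:
  assumes "f \<in> X_space \<Omega> \<T> p" "K \<in> \<T>" "x \<in> interior K"
  shows "f differentiable (at x)"
proof (rule X_space_gradients[OF assms(1)])
  fix P G
  assume PG: "\<And>K. K \<in> \<T> \<Longrightarrow> has_cont_grad (P K) (G K)" "\<And>K x. K \<in> \<T> \<Longrightarrow> x \<in> K \<Longrightarrow> f x = P K x"
  have "(f has_derivative (\<lambda>h. G K x \<bullet> h)) (at x)"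
    by (rule X_space_has_derivative[OF assms(2,3)]) (rule PG(1)[OF assms(2)], rule PG(2)[OF assms(2)])
  then show ?thesis by (rule differentiableI)
qed

lemma AE_X_space_differentiable:
  assumes "f \<in> X_space \<Omega> \<T> p"
  shows "AE x in lebesgue_on \<Omega>. f differentiable (at x)"
  using AE_dom_interior by eventually_elim (use X_space_differentiable[OF assms] in blast)

lemma X_space_bounded:
  assumes "f \<in> X_space \<Omega> \<T> p"
  shows "\<exists>B. \<forall>x. \<bar>f x\<bar> \<le> B"
proof -
  have "bounded (f ` closure \<Omega>)"
    using assms compact_closure_dom by (intro compact_imp_bounded compact_continuous_image) (auto simp: X_space_def)
  then obtain B where B: "\<And>x. x \<in> closure \<Omega> \<Longrightarrow> \<bar>f x\<bar> \<le> B" by (auto simp: bounded_iff)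
  have "\<bar>f x\<bar> \<le> max B 0" for x
    using B[of x] assms by (cases "x \<in> closure \<Omega>") (auto simp: X_space_def)
  then show ?thesis by blast
qed

lemma X_space_measurable:
  assumes "f \<in> X_space \<Omega> \<T> p"
  shows "f \<in> borel_measurable (lebesgue_on \<Omega>)"
  using assms closure_subset[of \<Omega>] dom_lebesgue
  by (intro continuous_imp_measurable_on_sets_lebesgue) (auto simp: X_space_def intro: continuous_on_subset)

text \<open>For a test function \<phi> the product \<open>f * \<phi>\<close> is continuous,
  compactly supported and Lipschitz along coordinate lines, so the integral of its classical
  derivative is zero; expanding that derivative gives the weak identity. Continuity of
  \<open>f\<close> across faces enters here in place of cancelling face integrals.\<close>

lemma X_space_has_weak_partial:
  assumes f: "f \<in> X_space \<Omega> \<T> p"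
  obtains g B where "has_weak_partial \<Omega> i f g" "g \<in> borel_measurable borel" "\<And>x. \<bar>g x\<bar> \<le> B"
    "\<And>K x. K \<in> \<T> \<Longrightarrow> x \<in> interior K \<Longrightarrow> g x = partial_deriv i f x"
proof -
  obtain P G where PG: "\<And>K. K \<in> \<T> \<Longrightarrow> has_cont_grad (P K) (G K)"
    and fP: "\<And>K x. K \<in> \<T> \<Longrightarrow> x \<in> K \<Longrightarrow> f x = P K x"
    using X_space_gradients[OF f] by blast
  \<comment> \<open>Interiors of distinct elements are disjoint, so at most one term is nonzero. The
    sum is defined everywhere and is Borel and bounded, unlike \<open>weak_partial\<close>
    itself.\<close>
  define g where "g x = (\<Sum>K\<in>\<T>. indicator (interior K) x * G K x $ i)" for x
  have gK: "g x = G K x $ i" if "K \<in> \<T>" "x \<in> interior K" for K x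
  proof -
    have "indicator (interior K') x * G K' x $ i = (if K' = K then G K x $ i else 0)" if "K' \<in> \<T>" for K'
      using that \<open>K \<in> \<T>\<close> \<open>x \<in> interior K\<close> mesh_interior_unique[of K K' x] interior_subset[of K']
      by (auto simp: indicator_def)
    then have "g x = (\<Sum>K'\<in>\<T>. if K' = K then G K x $ i else 0)"
      unfolding g_def by (intro sum.cong) auto
    then show ?thesis using that finite_mesh by simp
  qed
  have der: "(f has_derivative (\<lambda>h. G K x \<bullet> h)) (at x)" if "K \<in> \<T>" "x \<in> interior K" for K x
    using X_space_has_derivative[OF that PG[OF that(1)]] fP that by blast
  have g_partial: "g x = partial_deriv i f x" if "K \<in> \<T>" "x \<in> interior K" for K x
    using partial_deriv_eq[OF der[OF that]] gK[OF that] by (simp add: inner_axis)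
  have contG: "continuous_on UNIV (G K)" if "K \<in> \<T>" for K
    using PG[OF that] by (simp add: has_cont_grad_def)
  have gmeas: "g \<in> borel_measurable borel"
  proof -
    have "(\<lambda>x. G K x $ i) \<in> borel_measurable borel" if "K \<in> \<T>" for K
      using contG[OF that] by (intro borel_measurable_continuous_onI continuous_intros)
    then show ?thesis unfolding g_def
      by (intro borel_measurable_sum borel_measurable_times borel_measurable_indicator) auto
  qed
  have "\<exists>B\<ge>0. \<forall>x\<in>K. \<bar>G K x $ i\<bar> \<le> B" if K: "K \<in> \<T>" for K
  proof -
    have "bounded ((\<lambda>x. G K x $ i) ` K)"
      using contG[OF K] mesh_compact[OF K]
      by (intro compact_imp_bounded compact_continuous_image continuous_intros) (auto intro: continuous_on_subset)
    then obtain B where "\<And>x. x \<in> K \<Longrightarrow> \<bar>G K x $ i\<bar> \<le> B" by (auto simp: bounded_iff)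
    then show ?thesis by (intro exI[of _ "max B 0"]) (auto intro: order_trans max.cobounded1)
  qed
  then obtain B where B: "\<And>K. K \<in> \<T> \<Longrightarrow> B K \<ge> 0" "\<And>K x. K \<in> \<T> \<Longrightarrow> x \<in> K \<Longrightarrow> \<bar>G K x $ i\<bar> \<le> B K"
    by metis
  have gbd: "\<bar>g x\<bar> \<le> (\<Sum>K\<in>\<T>. B K)" for x
  proof -
    have "\<bar>indicator (interior K) x * G K x $ i\<bar> \<le> B K" if "K \<in> \<T>" for K
      using B[OF that] interior_subset[of K] by (auto simp: indicator_def)
    then show ?thesis unfolding g_def by (intro order_trans[OF sum_abs] sum_mono)
  qed
  obtain Bf where Bf: "\<And>x. \<bar>f x\<bar> \<le> Bf" using X_space_bounded[OF f] by blast
  have contf: "continuous_on (closure \<Omega>) f" using f by (simp add: X_space_def)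
  have "has_weak_partial \<Omega> i f g"
    unfolding has_weak_partial_def
  proof (intro conjI ballI)
    show "locally_integrable \<Omega> f"
      using bounded_measurable_locally_integrable[OF open_dom X_space_measurable[OF f] Bf] .
    have "g \<in> borel_measurable (lebesgue_on \<Omega>)"
      by (intro measurable_restrict_space1 measurable_completion) (simp add: gmeas)
    from bounded_measurable_locally_integrable[OF open_dom this gbd]
    show "locally_integrable \<Omega> g" .
    fix \<phi> assume \<phi>: "\<phi> \<in> test_functions \<Omega>"
    define \<psi> where "\<psi> x = (\<chi> i. partial_deriv i \<phi> x)" for x
    have grad\<phi>: "has_cont_grad \<phi> \<psi>" using test_function_cont_grad[OF \<phi>] by (simp add: \<psi>_def[abs_def])
    have cont\<phi>: "continuous_on S \<phi>" for S using has_cont_grad_continuous[OF grad\<phi>] .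
    define C where "C = closure {x. \<phi> x \<noteq> 0}"
    have C: "compact C" "C \<subseteq> \<Omega>" using \<phi> by (auto simp: test_functions_def C_def)
    have \<phi>0: "\<phi> x = 0" if "x \<notin> C" for x using that closure_subset[of "{x. \<phi> x \<noteq> 0}"] by (auto simp: C_def)
    have d\<phi>0: "\<psi> x $ i = 0" if "x \<notin> C" for x
    proof -
      have "(\<phi> has_derivative (\<lambda>h. 0)) (at x)"
        by (rule has_derivative_transform_within_open[where f="\<lambda>x. 0" and s="- C"])
          (use that \<phi>0 C in \<open>auto simp: compact_imp_closed\<close>)
      then show ?thesis using partial_deriv_eq[of \<phi> "\<lambda>h. 0" x i] by (simp add: \<psi>_def)
    qed
    define F where "F x = f x * \<phi> x" for x
    define D where "D x = f x * \<psi> x $ i + g x * \<phi> x" for x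
    obtain R where R: "\<And>x. x \<in> C \<Longrightarrow> norm x \<le> R"
      using compact_imp_bounded[OF C(1)] by (auto simp: bounded_iff)
    have contF: "continuous_on UNIV F"
    proof -
      have "continuous_on \<Omega> F" unfolding F_def
        using contf cont\<phi> closure_subset by (intro continuous_intros) (auto intro: continuous_on_subset)
      moreover have "continuous_on (- C) F"
        by (rule continuous_on_cong[THEN iffD2, OF refl _ continuous_on_const[of _ 0]]) (simp add: F_def \<phi>0)
      ultimately have "continuous_on (\<Omega> \<union> - C) F"
        using open_dom C by (intro continuous_on_open_Un) (auto simp: compact_imp_closed)
      moreover have "\<Omega> \<union> - C = UNIV" using C by blast
      ultimately show ?thesis by simp
    qed
    \<comment> \<open>The complement of the domain is added as a further piece, on which
      \<open>F\<close> vanishes; with it finitely many closed sets cover the whole space.\<close>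
    have "\<exists>L\<ge>0. L-lipschitz_on S F" if S: "S \<in> insert (- \<Omega>) \<T>" for S
    proof (cases "S = - \<Omega>")
      case True
      have "F x = 0" if "x \<in> S" for x using that C True \<phi>0 by (auto simp: F_def)
      then have "0-lipschitz_on S F" by (intro lipschitz_onI) auto
      then show ?thesis by blast
    next
      case False
      then have K: "S \<in> \<T>" using S by blast
      obtain L where L: "L \<ge> 0" "L-lipschitz_on S (\<lambda>x. P S x * \<phi> x)"
        using has_cont_grad_lipschitz[OF has_cont_grad_mult[OF PG[OF K] grad\<phi>] mesh_compact[OF K] mesh_convex[OF K]]
        by blast
      have "L-lipschitz_on S F"
        using L(2) by (rule lipschitz_on_transform) (simp add: F_def fP[OF K])
      then show ?thesis using L(1) by blast
    qed
    then obtain L where L: "\<And>S. S \<in> insert (- \<Omega>) \<T> \<Longrightarrow> L S \<ge> 0 \<and> (L S)-lipschitz_on S F"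
      by metis
    \<comment> \<open>The sum serves as a Lipschitz constant common to all pieces.\<close>
    define M where "M = (\<Sum>S\<in>insert (- \<Omega>) \<T>. L S)"
    have M0: "M \<ge> 0" unfolding M_def using L by (intro sum_nonneg) blast
    have M_lip: "M-lipschitz_on S F" if "S \<in> insert (- \<Omega>) \<T>" for S
    proof -
      have "L S \<le> M" unfolding M_def using L finite_mesh that by (intro member_le_sum) auto
      then show ?thesis using L[OF that] lipschitz_on_le by blast
    qed
    let ?e = "axis i 1 :: real^'n"
    \<comment> \<open>A segment may cross many elements. Pulled back to the parameter line, the
      closed pieces cover the parameter interval, and Lipschitz bounds with a common constant on
      finitely many closed sets glue together there.\<close>
    have lip: "\<bar>F (x + h *\<^sub>R ?e) - F x\<bar> \<le> M * \<bar>h\<bar>" for x h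
    proof -
      define U where "U S = (\<lambda>t. x + t *\<^sub>R ?e) -` S" for S
      have "M-lipschitz_on {min 0 h..max 0 h} (\<lambda>t. F (x + t *\<^sub>R ?e))"
      proof (rule lipschitz_on_closed_Union[where U=U and I="insert (- \<Omega>) \<T>"])
        fix S assume S: "S \<in> insert (- \<Omega>) \<T>"
        show "M-lipschitz_on (U S) (\<lambda>t. F (x + t *\<^sub>R ?e))"
        proof (rule lipschitz_onI[OF _ M0])
          fix s t assume "s \<in> U S" "t \<in> U S"
          then show "dist (F (x + s *\<^sub>R ?e)) (F (x + t *\<^sub>R ?e)) \<le> M * dist s t"
            using lipschitz_onD[OF M_lip[OF S], of "x + s *\<^sub>R ?e" "x + t *\<^sub>R ?e"]
            by (simp add: U_def dist_norm scaleR_diff_left[symmetric])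
        qed
        have "closed S" using S open_dom mesh_closed by auto
        then show "closed (U S)" unfolding U_def
          by (intro continuous_closed_vimage) (auto intro!: continuous_intros)
      next
        show "{min 0 h..max 0 h} \<subseteq> (\<Union>S\<in>insert (- \<Omega>) \<T>. U S)"
        proof
          fix t
          have "x + t *\<^sub>R ?e \<in> - \<Omega> \<union> \<Union>\<T>" using mesh_Union closure_subset[of \<Omega>] by blast
          then show "t \<in> (\<Union>S\<in>insert (- \<Omega>) \<T>. U S)" by (auto simp: U_def)
        qed
        show "finite (insert (- \<Omega>) \<T>)" using finite_mesh by simp
      qed (rule M0)
      from lipschitz_onD[OF this, of h 0] show ?thesis by (auto simp: dist_norm)
    qed
    \<comment> \<open>Measurability of \<open>f\<close> is known on the domain only. The indicator
      of \<open>C\<close> may be inserted since the gradient of \<phi> vanishes off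
      \<open>C\<close>.\<close>
    have Dmeas: "D \<in> borel_measurable lebesgue"
    proof -
      have a: "(\<lambda>x. indicator C x * f x) \<in> borel_measurable lebesgue"
      proof -
        have "(\<lambda>x. if x \<in> \<Omega> then f x else 0) \<in> borel_measurable lebesgue"
          using X_space_measurable[OF f] dom_lebesgue by (simp add: borel_measurable_if)
        then have "(\<lambda>x. indicator C x * (if x \<in> \<Omega> then f x else 0)) \<in> borel_measurable lebesgue"
          using C by (intro borel_measurable_times borel_measurable_indicator) (auto simp: borel_compact)
        moreover have "(\<lambda>x. indicator C x * (if x \<in> \<Omega> then f x else 0)) = (\<lambda>x. indicator C x * f x)"
          using C by (auto simp: indicator_def fun_eq_iff)
        ultimately show ?thesis by simp
      qed
      have b: "(\<lambda>x. \<psi> x $ i) \<in> borel_measurable lebesgue"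
        using grad\<phi> by (intro measurable_completion) (simp add: has_cont_grad_def borel_measurable_continuous_onI continuous_on_component)
      have c: "\<phi> \<in> borel_measurable lebesgue"
        using cont\<phi>[of UNIV] by (intro measurable_completion) (simp add: borel_measurable_continuous_onI)
      have d: "g \<in> borel_measurable lebesgue"
        using gmeas by (intro measurable_completion) simp
      have "(\<lambda>x. indicator C x * f x * \<psi> x $ i + g x * \<phi> x) \<in> borel_measurable lebesgue"
        by (rule borel_measurable_add[OF borel_measurable_times[OF a b] borel_measurable_times[OF d c]])
      moreover have "(\<lambda>x. indicator C x * f x * \<psi> x $ i + g x * \<phi> x) = D"
      proof
        show "indicator C x * f x * \<psi> x $ i + g x * \<phi> x = D x" for x
          using d\<phi>0[of x] by (cases "x \<in> C") (simp_all add: D_def)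
      qed
      ultimately show ?thesis by simp
    qed
    have "AE x in lebesgue. ((\<lambda>t. F (x + t *\<^sub>R ?e)) has_real_derivative D x) (at 0)"
      using AE_mesh_interior
    proof eventually_elim
      case (elim x)
      have line: "((\<lambda>t. x + t *\<^sub>R ?e) has_derivative (\<lambda>t. t *\<^sub>R ?e)) (at 0)"
        by (auto intro!: derivative_eq_intros)
      show ?case
      proof (cases "x \<in> closure \<Omega>")
        case True
        then obtain K where K: "K \<in> \<T>" "x \<in> interior K" using elim by blast
        have "(\<phi> has_derivative (\<lambda>h. \<psi> x \<bullet> h)) (at x)" using grad\<phi> by (simp add: has_cont_grad_def)
        from has_derivative_mult[OF der[OF K] this]
        have "(F has_derivative (\<lambda>h. f x * (\<psi> x \<bullet> h) + G K x \<bullet> h * \<phi> x)) (at (x + 0 *\<^sub>R ?e))"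
          by (simp add: F_def[abs_def])
        from has_derivative_compose[OF line this]
        have "((\<lambda>t. F (x + t *\<^sub>R ?e)) has_derivative
            (\<lambda>t. f x * (\<psi> x \<bullet> (t *\<^sub>R ?e)) + G K x \<bullet> (t *\<^sub>R ?e) * \<phi> x)) (at 0)" .
        moreover have "(\<lambda>t. f x * (\<psi> x \<bullet> (t *\<^sub>R ?e)) + G K x \<bullet> (t *\<^sub>R ?e) * \<phi> x) = (*) (D x)"
          using gK[OF K] by (auto simp: fun_eq_iff D_def inner_axis algebra_simps)
        ultimately show ?thesis by (simp only: has_field_derivative_def)
      next
        case False
        then have "x \<notin> C" using C closure_subset by blast
        have "(F has_derivative (\<lambda>h. 0)) (at (x + 0 *\<^sub>R ?e))"
          by (rule has_derivative_transform_within_open[where f="\<lambda>x. 0" and s="- C"])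
            (use \<open>x \<notin> C\<close> \<phi>0 C in \<open>auto simp: compact_imp_closed F_def\<close>)
        from has_derivative_compose[OF line this]
        have "((\<lambda>t. F (x + t *\<^sub>R ?e)) has_real_derivative 0) (at 0)"
          by (simp add: has_derivative_imp_has_field_derivative)
        then show ?thesis using d\<phi>0[OF \<open>x \<notin> C\<close>] \<phi>0[OF \<open>x \<notin> C\<close>] by (simp add: D_def)
      qed
    qed
    moreover have "F x = 0" if "norm x > R" for x
    proof -
      have "x \<notin> C" using R[of x] that by auto
      then show ?thesis by (simp add: F_def \<phi>0)
    qed
    moreover have "norm ?e = 1" by simp
    ultimately have D0: "(\<integral>x. D x \<partial>lebesgue) = 0"
      using integral_directional_derivative_zero[OF contF _ lip _ Dmeas, of R] by blast
    have D_ind: "(\<lambda>x. indicator \<Omega> x * D x) = D"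
    proof
      fix x
      show "indicator \<Omega> x * D x = D x"
      proof (cases "x \<in> C")
        case True
        then have "x \<in> \<Omega>" using C(2) by blast
        then show ?thesis by simp
      next
        case False
        then have "D x = 0" by (simp add: D_def \<phi>0 d\<phi>0)
        then show ?thesis by simp
      qed
    qed
    have "(\<integral>x. D x \<partial>lebesgue_on \<Omega>) = 0"
      unfolding lebesgue_on_integral[OF dom_lebesgue] D_ind by (rule D0)
    moreover have "integrable (lebesgue_on \<Omega>) (\<lambda>x. f x * \<psi> x $ i)"
    proof -
      \<comment> \<open>A partial derivative of a test function is a test function, which gives
        integrability of the first summand of \<open>D\<close>; it is needed to split the
        integral.\<close>
      have "partial_deriv i \<phi> \<in> test_functions \<Omega>"
      proof -
        have "Ck k (partial_deriv i \<phi>)" for k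
        proof -
          have "Ck (Suc k) \<phi>" using \<phi> by (simp add: test_functions_def del: Ck.simps)
          then show ?thesis by simp
        qed
        moreover have sub: "closure {x. partial_deriv i \<phi> x \<noteq> 0} \<subseteq> C"
        proof (rule closure_minimal)
          show "{x. partial_deriv i \<phi> x \<noteq> 0} \<subseteq> C" using d\<phi>0 by (auto simp: \<psi>_def)
        qed (rule compact_imp_closed[OF C(1)])
        moreover have "compact (closure {x. partial_deriv i \<phi> x \<noteq> 0})"
          using bounded_subset[OF compact_imp_bounded[OF C(1)] sub] by (simp add: compact_eq_bounded_closed)
        ultimately show ?thesis using C(2) by (simp add: test_functions_def)
      qed
      from locally_integrable_times_test[OF open_dom \<open>locally_integrable \<Omega> f\<close> this]
      show ?thesis by (simp add: \<psi>_def)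
    qed
    moreover have "integrable (lebesgue_on \<Omega>) (\<lambda>x. g x * \<phi> x)"
      using locally_integrable_times_test[OF open_dom \<open>locally_integrable \<Omega> g\<close> \<phi>] .
    ultimately show "(\<integral>x. f x * partial_deriv i \<phi> x \<partial>lebesgue_on \<Omega>) = - (\<integral>x. g x * \<phi> x \<partial>lebesgue_on \<Omega>)"
      by (simp add: D_def \<psi>_def)
  qed
  then show thesis using that gmeas gbd g_partial by blast
qed

lemma AE_weak_partial:
  assumes f: "f \<in> X_space \<Omega> \<T> p"
  shows "AE x in lebesgue_on \<Omega>. weak_partial \<Omega> i f x = partial_deriv i f x"
proof -
  obtain g B where g: "has_weak_partial \<Omega> i f g"
    "\<And>K x. K \<in> \<T> \<Longrightarrow> x \<in> interior K \<Longrightarrow> g x = partial_deriv i f x"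
    using X_space_has_weak_partial[OF f] by metis
  have "has_weak_partial \<Omega> i f (weak_partial \<Omega> i f)"
    unfolding weak_partial_def using g(1) by (rule someI[where P="has_weak_partial \<Omega> i f"])
  from weak_partial_unique[OF open_dom this g(1)] AE_dom_interior
  show ?thesis by eventually_elim (use g(2) in auto)
qed

end

section \<open>Surface measure of polyhedral boundaries\<close>

lemma hausdorff_content_le_of_finite_cover:
  assumes s: "s > 0" and \<delta>: "\<delta> \<ge> 0" and E: "finite E" and cov: "A \<subseteq> (\<Union>m\<in>E. c m)"
    and bd: "\<And>m. m \<in> E \<Longrightarrow> bounded (c m)" and diam: "\<And>m. m \<in> E \<Longrightarrow> diameter (c m) \<le> \<delta>"
  shows "hausdorff_content s \<delta> A \<le> ennreal (real (card E) * (unit_ball_vol (real s) * (\<delta> / 2) ^ s))"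
proof -
  let ?w = "\<lambda>B. unit_ball_vol (real s) * (diameter B / 2) ^ s"
  obtain h where h: "bij_betw h {..<card E} E"
    using ex_bij_betw_nat_finite[OF E] by (auto simp: atLeast0LessThan)
  \<comment> \<open>Covers are sequences, so the finite cover is padded with empty sets. These have
    diameter 0 and weigh nothing because \<open>s > 0\<close>.\<close>
  define C where "C k = (if k < card E then c (h k) else {})" for k
  have hE: "h k \<in> E" if "k < card E" for k using h that by (auto simp: bij_betw_def)
  have "A \<subseteq> (\<Union>k. C k)"
  proof
    fix x assume "x \<in> A"
    then obtain m where m: "m \<in> E" "x \<in> c m" using cov by blast
    then have "m \<in> h ` {..<card E}" using h by (simp add: bij_betw_def)
    then obtain k where "k < card E" "h k = m" by blast
    then show "x \<in> (\<Union>k. C k)" using m by (auto simp: C_def intro!: exI[of _ k])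
  qed
  moreover have "bounded (C k) \<and> diameter (C k) \<le> \<delta>" for k
    using bd diam hE \<delta> by (simp add: C_def)
  ultimately have "hausdorff_content s \<delta> A \<le> (\<Sum>k. ennreal (?w (C k)))"
    unfolding hausdorff_content_def by (intro INF_lower) auto
  also have "\<dots> = (\<Sum>k<card E. ennreal (?w (C k)))"
    using s by (intro suminf_finite) (auto simp: C_def)
  also have "\<dots> \<le> (\<Sum>k<card E. ennreal (unit_ball_vol (real s) * (\<delta> / 2) ^ s))"
  proof (intro sum_mono ennreal_leI mult_left_mono power_mono)
    fix k assume "k \<in> {..<card E}"
    then show "diameter (C k) / 2 \<le> \<delta> / 2" "0 \<le> diameter (C k) / 2"
      using diam bd hE by (auto simp: C_def diameter_ge_0)
  qed simp
  also have "\<dots> = ennreal (real (card E) * (unit_ball_vol (real s) * (\<delta> / 2) ^ s))"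
    using \<delta> by (simp add: ennreal_mult ennreal_of_nat_eq_real_of_nat)
  finally show ?thesis .
qed

text \<open>A bounded piece of a hyperplane is a Lipschitz graph over a coordinate hyperplane, on which a
  grid of mesh size \<open>1 / N\<close> has at most \<open>(N + 1) ^ (d - 1)\<close> cells.\<close>

lemma hausdorff_outer_hyperplane_finite:
  fixes A :: "(real^'n::finite) set"
  assumes d: "CARD('n) \<ge> 2" and A: "bounded A" "A \<subseteq> {x. a \<bullet> x = b}" and a: "a \<noteq> 0"
  shows "hausdorff_outer (CARD('n) - 1) A < \<infinity>"
proof -
  let ?s = "CARD('n) - 1"
  \<comment> \<open>Solving for the coordinate with the largest coefficient makes all ratios of
    coefficients at most 1 in absolute value, so the hyperplane is a graph with Lipschitz constant 1
    in the sum norm.\<close>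
  obtain i where i: "\<And>j. \<bar>a $ j\<bar> \<le> \<bar>a $ i\<bar>"
  proof -
    have "Max (range (\<lambda>j. \<bar>a $ j\<bar>)) \<in> range (\<lambda>j. \<bar>a $ j\<bar>)" by (intro Max_in) auto
    then obtain i where "Max (range (\<lambda>j. \<bar>a $ j\<bar>)) = \<bar>a $ i\<bar>" by (rule rangeE)
    then have "\<bar>a $ j\<bar> \<le> \<bar>a $ i\<bar>" for j by (metis Max_ge finite finite_imageI rangeI)
    then show thesis by (rule that)
  qed
  have ai: "\<bar>a $ i\<bar> > 0"
  proof (rule ccontr)
    assume "\<not> \<bar>a $ i\<bar> > 0"
    then have "a $ j = 0" for j using i[of j] by simp
    then show False using a by (simp add: vec_eq_iff)
  qed
  let ?J = "UNIV - {i}"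
  have cardJ: "card ?J = ?s" by simp
  \<comment> \<open>The factor 2 counts the sum over the remaining coordinates once for themselves
    and once as a bound for coordinate \<open>i\<close>.\<close>
  have norm_le: "norm (x - y) \<le> 2 * (\<Sum>j\<in>?J. \<bar>x $ j - y $ j\<bar>)" if "x \<in> A" "y \<in> A" for x y
  proof -
    have "a \<bullet> (x - y) = 0" using that A(2) by (auto simp: inner_diff_right)
    then have "a $ i * (x $ i - y $ i) + (\<Sum>j\<in>?J. a $ j * (x $ j - y $ j)) = 0"
      by (simp add: inner_vec_def sum.remove[of UNIV i])
    then have "\<bar>a $ i\<bar> * \<bar>x $ i - y $ i\<bar> = \<bar>\<Sum>j\<in>?J. a $ j * (x $ j - y $ j)\<bar>"
      unfolding abs_mult[symmetric] by linarith
    also have "\<dots> \<le> (\<Sum>j\<in>?J. \<bar>a $ i\<bar> * \<bar>x $ j - y $ j\<bar>)"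
      by (intro order_trans[OF sum_abs] sum_mono) (auto simp: abs_mult intro!: mult_right_mono i)
    also have "\<dots> = \<bar>a $ i\<bar> * (\<Sum>j\<in>?J. \<bar>x $ j - y $ j\<bar>)" by (simp add: sum_distrib_left)
    finally have "\<bar>x $ i - y $ i\<bar> \<le> (\<Sum>j\<in>?J. \<bar>x $ j - y $ j\<bar>)" using ai by simp
    moreover have "norm (x - y) \<le> (\<Sum>j\<in>UNIV. \<bar>(x - y) $ j\<bar>)" by (rule norm_le_l1_cart)
    ultimately show ?thesis by (simp add: sum.remove[of UNIV i])
  qed
  obtain R where R: "R > 0" "\<And>x j. x \<in> A \<Longrightarrow> \<bar>x $ j\<bar> \<le> R"
  proof -
    obtain R where "R > 0" "\<And>x. x \<in> A \<Longrightarrow> norm x \<le> R" using A(1) bounded_pos by blast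
    then show thesis using that component_le_norm_cart order_trans by blast
  qed
  \<comment> \<open>Independent of \<delta>: the content is at most the volume constant times
    \<open>((N + 1) * \<eta> / 2) ^ s\<close>, and \<open>(N + 1) * \<eta> / 2\<close> is at most
    \<open>N * \<eta> = 4 * s * R\<close>, where \<open>s\<close> is the dimension minus
    one.\<close>
  define B where "B = unit_ball_vol (real ?s) * (4 * real ?s * R) ^ ?s"
  have content: "hausdorff_content ?s \<delta> A \<le> ennreal B" if \<delta>: "\<delta> > 0" for \<delta>
  proof -
    obtain N0 :: nat where N0: "real N0 > 4 * real ?s * R / \<delta>" using reals_Archimedean2 by blast
    define N where "N = Suc N0"
    have N: "N \<ge> 1" "real N > 4 * real ?s * R / \<delta>" using N0 by (auto simp: N_def)
    \<comment> \<open>Grid cells have side \<open>2 * R / N\<close>; \<open>norm_le\<close> over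
      \<open>s\<close> coordinates turns this into diameter \<open>2 * s * (2 * R / N)\<close>. The
      choice of \<open>N\<close> makes it at most \<delta>.\<close>
    define \<eta> where "\<eta> = 4 * real ?s * R / real N"
    have \<eta>: "\<eta> \<le> \<delta>" "\<eta> \<ge> 0" using N \<delta> R by (auto simp: \<eta>_def field_simps)
    \<comment> \<open>The grid index of coordinate \<open>j\<close>, shifted so that it starts at 0.
      The right end of the range has index \<open>N\<close>, hence \<open>N + 1\<close> values per
      coordinate.\<close>
    define k where "k x j = nat \<lfloor>(x $ j + R) * real N / (2 * R)\<rfloor>" for x :: "real^'n" and j
    define E where "E = ?J \<rightarrow>\<^sub>E {..N}"
    define c where "c m = {x \<in> A. \<forall>j\<in>?J. k x j = m j}" for m
    have finE: "finite E" unfolding E_def by (intro finite_PiE) auto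
    have cardE: "card E = (N + 1) ^ ?s" unfolding E_def by (subst card_PiE) (simp_all add: cardJ)
    have "k x j \<le> N" if "x \<in> A" for x j
    proof -
      have "(x $ j + R) * real N \<le> (2 * R) * real N"
        using R(2)[OF that, of j] by (intro mult_right_mono) auto
      then have "(x $ j + R) * real N / (2 * R) \<le> real N" using R(1) by (simp add: field_simps)
      then show ?thesis unfolding k_def by linarith
    qed
    then have "restrict (k x) ?J \<in> E \<and> x \<in> c (restrict (k x) ?J)" if "x \<in> A" for x
      using that by (auto simp: E_def c_def)
    then have cov: "A \<subseteq> (\<Union>m\<in>E. c m)" by blast
    have diam: "diameter (c m) \<le> \<eta>" for m
    proof (rule diameter_le)
      show "c m \<noteq> {} \<or> 0 \<le> \<eta>" using \<eta> by simp
      fix x y assume xy: "x \<in> c m" "y \<in> c m"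
      have "\<bar>x $ j - y $ j\<bar> \<le> 2 * R / real N" if j: "j \<in> ?J" for j
      proof -
        have ge: "(x $ j + R) * real N / (2 * R) \<ge> 0" "(y $ j + R) * real N / (2 * R) \<ge> 0"
          using R(2)[of x j] R(2)[of y j] xy R(1) by (auto simp: c_def abs_le_iff)
        have "k x j = k y j" using xy j by (auto simp: c_def)
        then have "\<lfloor>(x $ j + R) * real N / (2 * R)\<rfloor> = \<lfloor>(y $ j + R) * real N / (2 * R)\<rfloor>"
          using ge unfolding k_def by (simp add: eq_nat_nat_iff)
        then have "\<bar>(x $ j + R) * real N / (2 * R) - (y $ j + R) * real N / (2 * R)\<bar> \<le> 1" by linarith
        moreover have "(x $ j + R) * real N / (2 * R) - (y $ j + R) * real N / (2 * R)
            = (x $ j - y $ j) * (real N / (2 * R))" 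
          by (simp only: diff_divide_distrib[symmetric] left_diff_distrib[symmetric]) simp
        ultimately have "\<bar>x $ j - y $ j\<bar> * (real N / (2 * R)) \<le> 1"
          using R(1) by (simp add: abs_mult)
        then show ?thesis using R(1) N(1) by (simp add: field_simps)
      qed
      then have "(\<Sum>j\<in>?J. \<bar>x $ j - y $ j\<bar>) \<le> (\<Sum>j\<in>?J. 2 * R / real N)" by (intro sum_mono)
      also have "\<dots> = real ?s * (2 * R / real N)" by (simp only: sum_constant cardJ)
      finally have "norm (x - y) \<le> 2 * (real ?s * (2 * R / real N))"
        using norm_le[of x y] xy by (auto simp: c_def)
      also have "\<dots> = \<eta>" by (simp add: \<eta>_def)
      finally show "norm (x - y) \<le> \<eta>" .
    qed
    \<comment> \<open>A smaller mesh bound admits fewer covers, which can only raise the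
      infimum.\<close>
    have "hausdorff_content ?s \<delta> A \<le> hausdorff_content ?s \<eta> A"
      unfolding hausdorff_content_def using \<eta>(1) by (intro INF_superset_mono) (auto intro: order_trans)
    also have "\<dots> \<le> ennreal (real (card E) * (unit_ball_vol (real ?s) * (\<eta> / 2) ^ ?s))"
      using d \<eta>(2) finE cov diam A(1)
      by (intro hausdorff_content_le_of_finite_cover[where c=c])
        (auto simp: c_def intro: bounded_subset)
    also have "\<dots> \<le> ennreal B"
    proof (rule ennreal_leI)
      have "real (N + 1) * (\<eta> / 2) \<le> 4 * real ?s * R"
      proof -
        have "real (N + 1) * (\<eta> / 2) \<le> (2 * real N) * (\<eta> / 2)"
          using N(1) \<eta>(2) by (intro mult_right_mono) auto
        also have "\<dots> = 4 * real ?s * R" using N(1) by (simp add: \<eta>_def)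
        finally show ?thesis .
      qed
      then have "(real (N + 1) * (\<eta> / 2)) ^ ?s \<le> (4 * real ?s * R) ^ ?s"
        using \<eta>(2) by (intro power_mono) auto
      then have "unit_ball_vol (real ?s) * (real (N + 1) * (\<eta> / 2)) ^ ?s \<le> B"
        unfolding B_def by (intro mult_left_mono) auto
      then show "real (card E) * (unit_ball_vol (real ?s) * (\<eta> / 2) ^ ?s) \<le> B"
        unfolding cardE power_mult_distrib of_nat_power by (simp only: mult.left_commute mult.assoc)
    qed
    finally show ?thesis .
  qed
  have "hausdorff_outer ?s A \<le> ennreal B"
    unfolding hausdorff_outer_def by (rule SUP_least) (use content in auto)
  then show ?thesis by (simp add: order_le_less_trans)
qed

lemma sets_surface_measure [simp]: "sets surface_measure = sets borel"
  unfolding surface_measure_def using sets.sigma_sets_eq[of "borel :: (real^'n) measure"] by simp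

lemma space_surface_measure [simp]: "space surface_measure = UNIV"
  by (simp add: surface_measure_def space_measure_of_conv)

text \<open>\<open>measure_of\<close> yields the given set function on its sigma-algebra if that is
  a measure, and 0 otherwise. The inequality holds in either case and suffices for
  finiteness.\<close>

lemma emeasure_surface_measure_le:
  "emeasure surface_measure (A :: (real^'n::finite) set) \<le> hausdorff_outer (CARD('n) - 1) A"
  by (simp add: surface_measure_def emeasure_measure_of_conv)

text \<open>Each facet is bounded and, having codimension one, lies in a hyperplane; finite
  subadditivity does the rest.\<close>

lemma polyhedral_frontier_finite_measure:
  fixes \<Omega> :: "(real^'n::finite) set"
  assumes d: "CARD('n) \<ge> 2" and dom: "polyhedral_domain \<Omega>"
  shows "emeasure surface_measure (frontier \<Omega>) < \<infinity>"
proof -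
  obtain \<F> where F: "finite \<F>" "\<And>P. P \<in> \<F> \<Longrightarrow> polytope P"
    "\<And>P. P \<in> \<F> \<Longrightarrow> aff_dim P = int CARD('n) - 1" "frontier \<Omega> = \<Union>\<F>"
    using dom unfolding polyhedral_domain_def by blast
  have fin: "emeasure surface_measure P < \<infinity>" if P: "P \<in> \<F>" for P
  proof -
    obtain a b where ab: "a \<noteq> 0" "affine hull P = {x. a \<bullet> x = b}"
      using F(3)[OF P] aff_dim_eq_hyperplane[of P] by auto
    have "P \<subseteq> {x. a \<bullet> x = b}" using hull_subset[of P affine] ab(2) by simp
    from hausdorff_outer_hyperplane_finite[OF d polytope_imp_bounded[OF F(2)[OF P]] this ab(1)]
    show ?thesis using emeasure_surface_measure_le order_le_less_trans by blast
  qed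
  have "emeasure surface_measure (\<Union>P\<in>\<F>. P) \<le> (\<Sum>P\<in>\<F>. emeasure surface_measure P)"
    using F(1,2) by (intro emeasure_subadditive_finite) (auto intro: borel_closed polytope_imp_closed)
  also have "\<dots> < \<infinity>" using fin F(1) by simp
  finally show ?thesis using F(4) by simp
qed

section \<open>Saddle point problems on finite-dimensional function spaces\<close>

definition fun_subspace :: "('a \<Rightarrow> 'b::real_vector) set \<Rightarrow> bool" where
  "fun_subspace W \<longleftrightarrow> (\<lambda>x. 0) \<in> W \<and> (\<forall>u\<in>W. \<forall>v\<in>W. (\<lambda>x. u x + v x) \<in> W) \<and>
     (\<forall>c. \<forall>u\<in>W. (\<lambda>x. c *\<^sub>R u x) \<in> W)"

definition fun_linear :: "('a \<Rightarrow> 'b::real_vector) set \<Rightarrow> (('a \<Rightarrow> 'b) \<Rightarrow> real) \<Rightarrow> bool" where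
  "fun_linear W l \<longleftrightarrow> (\<forall>u\<in>W. \<forall>v\<in>W. l (\<lambda>x. u x + v x) = l u + l v) \<and>
     (\<forall>c. \<forall>u\<in>W. l (\<lambda>x. c *\<^sub>R u x) = c * l u)"

definition fun_span :: "nat \<Rightarrow> (nat \<Rightarrow> 'a \<Rightarrow> 'b::real_vector) \<Rightarrow> ('a \<Rightarrow> 'b) set" where
  "fun_span n e = {\<lambda>x. \<Sum>j<n. c j *\<^sub>R e j x | c. True}"

lemma fun_subspace_axpy:
  assumes "fun_subspace W" "u \<in> W" "v \<in> W"
  shows "(\<lambda>x. u x + c *\<^sub>R v x) \<in> W"
proof -
  have "(\<lambda>x. c *\<^sub>R v x) \<in> W" using assms by (simp add: fun_subspace_def)
  then show ?thesis using assms by (simp add: fun_subspace_def)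
qed

lemma fun_subspaceI:
  assumes "(\<lambda>x. 0) \<in> W" and axpy: "\<And>u v c. u \<in> W \<Longrightarrow> v \<in> W \<Longrightarrow> (\<lambda>x. u x + c *\<^sub>R v x) \<in> W"
  shows "fun_subspace W"
  unfolding fun_subspace_def
proof (intro conjI ballI allI)
  show "(\<lambda>x. u x + v x) \<in> W" if "u \<in> W" "v \<in> W" for u v
    using axpy[OF that, of 1] by simp
  show "(\<lambda>x. c *\<^sub>R u x) \<in> W" if "u \<in> W" for c u
    using axpy[OF assms(1) that, of c] by simp
qed (rule assms(1))

lemma fun_subspace_sum:
  assumes "fun_subspace W" "\<And>K. K \<in> A \<Longrightarrow> w K \<in> W"
  shows "(\<lambda>x. \<Sum>K\<in>A. w K x) \<in> W"
  using assms(2)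
proof (induction A rule: infinite_finite_induct)
  case (insert K A)
  then have "w K \<in> W" "(\<lambda>x. \<Sum>K\<in>A. w K x) \<in> W" by simp_all
  then have "(\<lambda>x. w K x + (\<Sum>K\<in>A. w K x)) \<in> W" using assms(1) by (simp add: fun_subspace_def)
  then show ?case using insert.hyps by simp
qed (use assms(1) in \<open>simp_all add: fun_subspace_def\<close>)

lemma fun_subspace_add: "fun_subspace W \<Longrightarrow> u \<in> W \<Longrightarrow> v \<in> W \<Longrightarrow> (\<lambda>x. u x + v x) \<in> W"
  by (simp add: fun_subspace_def)

lemma fun_subspace_zero: "fun_subspace W \<Longrightarrow> (\<lambda>x. 0) \<in> W"
  by (simp add: fun_subspace_def)

lemma fun_subspace_diff:
  assumes "fun_subspace W" "u \<in> W" "v \<in> W"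
  shows "(\<lambda>x. u x - v x) \<in> W"
  using fun_subspace_axpy[OF assms, of "-1"] by simp

lemma fun_linear_axpy:
  assumes "fun_linear W l" "fun_subspace W" "u \<in> W" "v \<in> W"
  shows "l (\<lambda>x. u x + c *\<^sub>R v x) = l u + c * l v"
proof -
  have "(\<lambda>x. c *\<^sub>R v x) \<in> W" using assms by (simp add: fun_subspace_def)
  then show ?thesis using assms by (simp add: fun_linear_def)
qed

lemma fun_linear_add: "fun_linear W l \<Longrightarrow> u \<in> W \<Longrightarrow> v \<in> W \<Longrightarrow> l (\<lambda>x. u x + v x) = l u + l v"
  by (simp add: fun_linear_def)

lemma fun_linear_diff:
  assumes "fun_linear W l" "fun_subspace W" "u \<in> W" "v \<in> W"
  shows "l (\<lambda>x. u x - v x) = l u - l v"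
  using fun_linear_axpy[OF assms, of "-1"] by simp

lemma fun_linear_zero:
  assumes "fun_linear W l" "fun_subspace W"
  shows "l (\<lambda>x. 0) = 0"
  using fun_linear_diff[OF assms fun_subspace_zero fun_subspace_zero] assms(2) by simp

lemma fun_linear_mono: "fun_linear V l \<Longrightarrow> W \<subseteq> V \<Longrightarrow> fun_linear W l"
  unfolding fun_linear_def by blast

lemma fun_linear_combine: "fun_linear W l \<Longrightarrow> fun_linear W k \<Longrightarrow> fun_linear W (\<lambda>v. l v - k v)"
  by (simp add: fun_linear_def algebra_simps)

lemma fun_sum:
  fixes n :: nat
  assumes "fun_subspace W" "fun_linear W l" "\<And>j. j < n \<Longrightarrow> d j \<in> W"
  shows "(\<lambda>x. \<Sum>j<n. c j *\<^sub>R d j x) \<in> W \<and> l (\<lambda>x. \<Sum>j<n. c j *\<^sub>R d j x) = (\<Sum>j<n. c j * l (d j))"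
  using assms(3)
proof (induction n)
  case 0
  then show ?case using assms fun_subspace_zero fun_linear_zero by auto
next
  case (Suc n)
  let ?s = "\<lambda>x. \<Sum>j<n. c j *\<^sub>R d j x"
  have s: "?s \<in> W" "l ?s = (\<Sum>j<n. c j * l (d j))" and d: "d n \<in> W" using Suc by simp_all
  show ?case
    using fun_subspace_axpy[OF assms(1) s(1) d, of "c n"] fun_linear_axpy[OF assms(2,1) s(1) d, of "c n"] s(2)
    by simp
qed

lemma fun_spanI: "(\<lambda>x. \<Sum>j<n. c j *\<^sub>R e j x) \<in> fun_span n e"
  by (auto simp: fun_span_def)

lemma fun_spanE:
  assumes "u \<in> fun_span n e"
  obtains c where "u = (\<lambda>x. \<Sum>j<n. c j *\<^sub>R e j x)"
  using assms by (auto simp: fun_span_def)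

lemma fun_span_subset:
  assumes "fun_subspace W" "\<And>j. j < n \<Longrightarrow> d j \<in> W"
  shows "fun_span n d \<subseteq> W"
proof -
  have "fun_linear W (\<lambda>_. 0)" by (simp add: fun_linear_def)
  from fun_sum[OF assms(1) this assms(2)] show ?thesis by (auto simp: fun_span_def)
qed

lemma fun_span_subspace: "fun_subspace (fun_span n e)"
proof -
  have "(\<lambda>x. 0) \<in> fun_span n e" unfolding fun_span_def by (auto intro!: exI[of _ "\<lambda>_. 0"])
  moreover have "(\<lambda>x. u x + v x) \<in> fun_span n e" if uv: "u \<in> fun_span n e" "v \<in> fun_span n e" for u v
  proof -
    obtain c d where "u = (\<lambda>x. \<Sum>j<n. c j *\<^sub>R e j x)" "v = (\<lambda>x. \<Sum>j<n. d j *\<^sub>R e j x)"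
      using uv by (auto simp: fun_span_def)
    then show ?thesis unfolding fun_span_def
      by (auto intro!: exI[of _ "\<lambda>j. c j + d j"] simp: scaleR_left_distrib sum.distrib)
  qed
  moreover have "(\<lambda>x. k *\<^sub>R u x) \<in> fun_span n e" if u: "u \<in> fun_span n e" for k u
  proof -
    obtain c where "u = (\<lambda>x. \<Sum>j<n. c j *\<^sub>R e j x)" using u by (auto simp: fun_span_def)
    then show ?thesis unfolding fun_span_def
      by (auto intro!: exI[of _ "\<lambda>j. k * c j"] simp: scaleR_sum_right)
  qed
  ultimately show ?thesis unfolding fun_subspace_def by blast
qed

text \<open>Induction on the number of ambient generators. The part of \<open>W\<close> inside the
  span of the first \<open>n\<close> is handled by the hypothesis; if \<open>W\<close> is larger,
  one further vector \<open>w\<close> with nonzero last coefficient is enough.\<close>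

lemma subspace_of_fun_span:
  assumes "fun_subspace W" "W \<subseteq> fun_span n e"
  shows "\<exists>m d. (\<forall>j<m. d j \<in> W) \<and> W = fun_span m d"
  using assms
proof (induction n arbitrary: W)
  case 0
  then have "W = {\<lambda>x. 0}" using fun_subspace_zero by (auto simp: fun_span_def)
  then show ?case by (intro exI[of _ 0]) (auto simp: fun_span_def)
next
  case (Suc n)
  let ?W = "W \<inter> fun_span n e"
  have sub: "fun_subspace ?W"
    using Suc.prems(1) fun_span_subspace[of n e] by (auto simp: fun_subspace_def)
  obtain m d where d: "\<And>j. j < m \<Longrightarrow> d j \<in> ?W" "?W = fun_span m d"
    using Suc.IH[OF sub] by auto
  show ?case
  proof (cases "W \<subseteq> fun_span n e")
    case True
    then have "?W = W" by blast
    then show ?thesis using d by (intro exI[of _ m] exI[of _ d]) auto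
  next
    case False
    then obtain w where w: "w \<in> W" "w \<notin> fun_span n e" by blast
    have "w \<in> fun_span (Suc n) e" using w(1) Suc.prems(2) by blast
    then obtain c where c: "w = (\<lambda>x. \<Sum>j<Suc n. c j *\<^sub>R e j x)" by (rule fun_spanE)
    have cn: "c n \<noteq> 0"
    proof
      assume "c n = 0"
      then have "w = (\<lambda>x. \<Sum>j<n. c j *\<^sub>R e j x)" unfolding c by simp
      then show False using w(2) fun_spanI[where n=n and c=c and e=e] by simp
    qed
    let ?d = "d(m := w)"
    have dW: "?d j \<in> W" if "j < Suc m" for j using that d(1)[of j] w by (auto simp: less_Suc_eq)
    have "v \<in> fun_span (Suc m) ?d" if v: "v \<in> W" for v
    proof -
      have "v \<in> fun_span (Suc n) e" using v Suc.prems(2) by blast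
      then obtain k where k: "v = (\<lambda>x. \<Sum>j<Suc n. k j *\<^sub>R e j x)" by (rule fun_spanE)
      \<comment> \<open>Subtracting this multiple of \<open>w\<close> cancels the coefficient of
        \<open>e n\<close>.\<close>
      let ?t = "k n / c n"
      let ?v = "\<lambda>x. v x + (- ?t) *\<^sub>R w x"
      have "?v = (\<lambda>x. \<Sum>j<n. (k j - ?t * c j) *\<^sub>R e j x)"
        using cn by (simp add: k c fun_eq_iff scaleR_left_diff_distrib sum_subtractf scaleR_sum_right
            scaleR_right_distrib sum_negf)
      then have "?v \<in> fun_span n e" using fun_spanI[where n=n and c="\<lambda>j. k j - ?t * c j" and e=e] by simp
      moreover have "?v \<in> W" by (rule fun_subspace_axpy[OF Suc.prems(1) v w(1)])
      ultimately have "?v \<in> fun_span m d" unfolding d(2)[symmetric] by (rule IntI[rotated])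
      then obtain b where b: "?v = (\<lambda>x. \<Sum>j<m. b j *\<^sub>R d j x)" by (rule fun_spanE)
      have "v = (\<lambda>x. \<Sum>j<Suc m. (b(m := ?t)) j *\<^sub>R ?d j x)"
      proof
        fix x
        have "v x = ?v x + ?t *\<^sub>R w x" by simp
        also have "?v x = (\<Sum>j<m. b j *\<^sub>R d j x)" by (rule fun_cong[OF b])
        finally show "v x = (\<Sum>j<Suc m. (b(m := ?t)) j *\<^sub>R ?d j x)" by simp
      qed
      then show ?thesis using fun_spanI[where n="Suc m" and c="b(m := ?t)" and e="?d"] by simp
    qed
    then have "W = fun_span (Suc m) ?d"
      using fun_span_subset[OF Suc.prems(1), of "Suc m" ?d] dW by blast
    moreover have "\<forall>j<Suc m. ?d j \<in> W" using dW by blast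
    ultimately show ?thesis by (intro exI conjI)
  qed
qed

text \<open>Finite-dimensional duality. The induction restricts everything to the kernel of the last
  functional, which leaves the hypothesis on common zeros intact.\<close>

lemma linear_functional_combination:
  fixes n :: nat
  assumes "fun_subspace W" "\<And>j. j < n \<Longrightarrow> fun_linear W (f j)" "fun_linear W l"
    and "\<And>v. v \<in> W \<Longrightarrow> (\<And>j. j < n \<Longrightarrow> f j v = 0) \<Longrightarrow> l v = 0"
  shows "\<exists>c. \<forall>v\<in>W. l v = (\<Sum>j<n. c j * f j v)"
  using assms
proof (induction n arbitrary: W)
  case 0
  then show ?case by simp
next
  case (Suc n)
  let ?W = "{v \<in> W. f n v = 0}"
  have fn: "fun_linear W (f n)" using Suc.prems(2) by simp
  have "(\<lambda>x. 0) \<in> ?W"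
    using fun_subspace_zero[OF Suc.prems(1)] fun_linear_zero[OF fn Suc.prems(1)] by simp
  then have sub: "fun_subspace ?W"
    using Suc.prems(1) fn by (auto simp: fun_subspace_def fun_linear_def)
  have "\<exists>c. \<forall>v\<in>?W. l v = (\<Sum>j<n. c j * f j v)"
  proof (rule Suc.IH[OF sub])
    show "fun_linear ?W (f j)" if "j < n" for j
      using Suc.prems(2)[of j] that by (auto intro: fun_linear_mono)
    show "fun_linear ?W l" using Suc.prems(3) by (auto intro: fun_linear_mono)
    show "l v = 0" if "v \<in> ?W" "\<And>j. j < n \<Longrightarrow> f j v = 0" for v
      using Suc.prems(4)[of v] that by (auto simp: less_Suc_eq)
  qed
  then obtain c where c: "\<And>v. v \<in> ?W \<Longrightarrow> l v = (\<Sum>j<n. c j * f j v)" by auto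
  show ?case
  proof (cases "\<forall>v\<in>W. f n v = 0")
    case True
    then show ?thesis using c by (intro exI[of _ "c(n := 0)"]) auto
  next
    case False
    then obtain w where w: "w \<in> W" "f n w \<noteq> 0" by blast
    \<comment> \<open>The remainder vanishes on the kernel of \<open>f n\<close>, hence is a
      multiple of \<open>f n\<close>; its value at \<open>w\<close> fixes the factor.\<close>
    define k where "k v = l v - (\<Sum>j<n. c j * f j v)" for v
    have k_axpy: "k (\<lambda>x. u x + t *\<^sub>R v x) = k u + t * k v" if "u \<in> W" "v \<in> W" for u v t
    proof -
      have "f j (\<lambda>x. u x + t *\<^sub>R v x) = f j u + t * f j v" if "j < n" for j
        using fun_linear_axpy[OF Suc.prems(2)[of j] Suc.prems(1) \<open>u \<in> W\<close> \<open>v \<in> W\<close>] that by simp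
      then have "(\<Sum>j<n. c j * f j (\<lambda>x. u x + t *\<^sub>R v x)) = (\<Sum>j<n. c j * (f j u + t * f j v))" by simp
      then show ?thesis
        using fun_linear_axpy[OF Suc.prems(3,1) that]
        by (simp add: k_def sum.distrib sum_distrib_left algebra_simps)
    qed
    have "l v = (\<Sum>j<Suc n. (c(n := k w / f n w)) j * f j v)" if v: "v \<in> W" for v
    proof -
      let ?v = "\<lambda>x. v x + (- (f n v / f n w)) *\<^sub>R w x"
      have "?v \<in> W" by (rule fun_subspace_axpy[OF Suc.prems(1) v w(1)])
      moreover have "f n ?v = 0"
        using fun_linear_axpy[OF fn Suc.prems(1) v w(1), of "- (f n v / f n w)"] w(2) by simp
      ultimately have "k ?v = 0" using c by (simp add: k_def)
      then have "k v = (f n v / f n w) * k w" using k_axpy[OF v w(1), of "- (f n v / f n w)"] by simp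
      also have "(f n v / f n w) * k w = k w / f n w * f n v" by simp
      finally have "l v = (\<Sum>j<n. c j * f j v) + k w / f n w * f n v" unfolding k_def by linarith
      then show ?thesis by simp
    qed
    then show ?thesis by (intro exI[of _ "c(n := k w / f n w)"]) simp
  qed
qed

text \<open>A Fredholm alternative: a functional that vanishes on the right kernel of
  \<open>B\<close> is a combination of the functionals \<open>B (d j)\<close>, and the same
  coefficients combine the \<open>d j\<close> to the solution.\<close>

lemma bilinear_representation:
  assumes W: "fun_subspace W" "W \<subseteq> fun_span n e"
    and B: "\<And>u. u \<in> W \<Longrightarrow> fun_linear W (B u)" "\<And>v. v \<in> W \<Longrightarrow> fun_linear W (\<lambda>u. B u v)"
    and l: "fun_linear W l" "\<And>v. v \<in> W \<Longrightarrow> (\<And>u. u \<in> W \<Longrightarrow> B u v = 0) \<Longrightarrow> l v = 0"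
  shows "\<exists>u\<in>W. \<forall>v\<in>W. B u v = l v"
proof -
  obtain m d where d: "\<And>j. j < m \<Longrightarrow> d j \<in> W" "W = fun_span m d"
    using subspace_of_fun_span[OF W] by blast
  have B_sum: "B (\<lambda>x. \<Sum>j<m. c j *\<^sub>R d j x) v = (\<Sum>j<m. c j * B (d j) v)" if "v \<in> W" for c v
    using fun_sum[OF W(1) B(2)[OF that], where n=m and d=d and c=c] d(1) by simp
  have l0: "l v = 0" if v: "v \<in> W" "\<And>j. j < m \<Longrightarrow> B (d j) v = 0" for v
  proof (rule l(2)[OF v(1)])
    fix u assume "u \<in> W"
    then obtain c where "u = (\<lambda>x. \<Sum>j<m. c j *\<^sub>R d j x)" unfolding d(2) by (rule fun_spanE)
    then show "B u v = 0" using B_sum[OF v(1)] v(2) by simp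
  qed
  have "\<exists>c. \<forall>v\<in>W. l v = (\<Sum>j<m. c j * B (d j) v)"
    by (rule linear_functional_combination[OF W(1) B(1)[OF d(1)] l(1) l0])
  then obtain c where c: "\<And>v. v \<in> W \<Longrightarrow> l v = (\<Sum>j<m. c j * B (d j) v)" by (elim exE) simp
  have "(\<lambda>x. \<Sum>j<m. c j *\<^sub>R d j x) \<in> W" unfolding d(2) by (rule fun_spanI)
  moreover have "\<forall>v\<in>W. B (\<lambda>x. \<Sum>j<m. c j *\<^sub>R d j x) v = l v" using B_sum c by simp
  ultimately show ?thesis by (intro bexI[of _ "\<lambda>x. \<Sum>j<m. c j *\<^sub>R d j x"])
qed

text \<open>
  The form \<open>b\<close> plays the role of \<open>(div u, div v)\<close>. A pressure in \<open>div W\<close> is represented by some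
  \<open>w \<in> W\<close> of which it is the divergence, so that only the kernel of \<open>b\<close> matters for uniqueness and no
  quotient by almost-everywhere equality is needed.
\<close>

locale saddle_point =
  fixes V :: "('a \<Rightarrow> 'b::real_vector) set"
    and a b :: "('a \<Rightarrow> 'b) \<Rightarrow> ('a \<Rightarrow> 'b) \<Rightarrow> real"
  assumes V_subspace: "fun_subspace V" and V_fin: "\<exists>n e. V \<subseteq> fun_span n e"
    and a_right: "u \<in> V \<Longrightarrow> fun_linear V (a u)" and a_left: "v \<in> V \<Longrightarrow> fun_linear V (\<lambda>u. a u v)"
    and b_right: "u \<in> V \<Longrightarrow> fun_linear V (b u)"
    and b_sym: "b u v = b v u"
    and a_pos: "u \<in> V \<Longrightarrow> u \<noteq> (\<lambda>x. 0) \<Longrightarrow> a u u > 0"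
    and b_null: "u \<in> V \<Longrightarrow> v \<in> V \<Longrightarrow> b u u = 0 \<Longrightarrow> b u v = 0"
begin

lemma b_left: "v \<in> V \<Longrightarrow> fun_linear V (\<lambda>u. b u v)"
  by (subst b_sym) (rule b_right)

text \<open>Positivity refers to the diagonal and \<open>b\<close> is symmetric, so exchanging the
  arguments of \<open>a\<close> preserves every assumption. Results for the trial side thus carry
  over to the test side.\<close>

lemma transpose: "saddle_point V (\<lambda>u v. a v u) b"
proof
  show "fun_subspace V" "\<exists>n e. V \<subseteq> fun_span n e" by (rule V_subspace V_fin)+
  show "fun_linear V (\<lambda>v. a v u)" "fun_linear V (\<lambda>v. a u v)" "fun_linear V (b u)" if "u \<in> V" for u
    by (rule a_left[OF that], rule a_right[OF that], rule b_right[OF that])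
  show "b u v = b v u" for u v by (rule b_sym)
  show "a u u > 0" if "u \<in> V" "u \<noteq> (\<lambda>x. 0)" for u by (rule a_pos[OF that])
  show "b u v = 0" if "u \<in> V" "v \<in> V" "b u u = 0" for u v by (rule b_null[OF that])
qed

text \<open>A quadratic condition defines a subspace here because \<open>b_null\<close> turns it
  into the linear condition that \<open>b z\<close> vanishes on all of \<open>V\<close>.\<close>

lemma kernel_subspace:
  assumes "fun_subspace W" "W \<subseteq> V"
  shows "fun_subspace {z \<in> W. b z z = 0}"
proof -
  let ?N = "{z \<in> W. b z z = 0}"
  have zero: "(\<lambda>x. 0) \<in> W" by (rule fun_subspace_zero[OF assms(1)])
  moreover have "b (\<lambda>x. 0) (\<lambda>x. 0) = 0"
    by (rule fun_linear_zero[OF b_right[OF subsetD[OF assms(2) zero]] V_subspace])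
  ultimately have "(\<lambda>x. 0) \<in> ?N" by simp
  moreover have "(\<lambda>x. u x + c *\<^sub>R v x) \<in> ?N" if uv: "u \<in> ?N" "v \<in> ?N" for u v c
  proof -
    let ?s = "\<lambda>x. u x + c *\<^sub>R v x"
    have V: "u \<in> V" "v \<in> V" using uv assms(2) by auto
    have s: "?s \<in> W" using uv by (intro fun_subspace_axpy[OF assms(1)]) simp_all
    have sV: "?s \<in> V" by (rule subsetD[OF assms(2) s])
    have "b ?s ?s = b ?s u + c * b ?s v" by (rule fun_linear_axpy[OF b_right[OF sV] V_subspace V])
    also have "b ?s u = b u ?s" by (rule b_sym)
    also have "b u ?s = 0" using uv by (intro b_null[OF V(1) sV]) simp
    also have "b ?s v = b v ?s" by (rule b_sym)
    also have "b v ?s = 0" using uv by (intro b_null[OF V(2) sV]) simp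
    finally show ?thesis using s by simp
  qed
  ultimately show ?thesis by (rule fun_subspaceI)
qed

lemma solve_a:
  assumes W: "fun_subspace W" "W \<subseteq> V" and l: "fun_linear W l"
  shows "\<exists>u\<in>W. \<forall>v\<in>W. a u v = l v"
proof -
  obtain n e where "W \<subseteq> fun_span n e" using V_fin W(2) by blast
  from W(1) this show ?thesis
  proof (rule bilinear_representation)
    show "fun_linear W (a u)" if "u \<in> W" for u
      using that W(2) by (intro fun_linear_mono[OF a_right W(2)]) auto
    show "fun_linear W (\<lambda>u. a u v)" if "v \<in> W" for v
      using that W(2) by (intro fun_linear_mono[OF a_left W(2)]) auto
    show "l v = 0" if "v \<in> W" "\<And>u. u \<in> W \<Longrightarrow> a u v = 0" for v
    proof -
      have "a v v = 0" using that by simp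
      then have "v = (\<lambda>x. 0)" using a_pos[of v] that(1) W(2) by (metis less_irrefl subsetD)
      then show ?thesis using fun_linear_zero[OF l W(1)] by simp
    qed
  qed (rule l)
qed

lemma solve_b:
  assumes W: "fun_subspace W" "W \<subseteq> V" and l: "fun_linear W l"
    and null: "\<And>v. v \<in> W \<Longrightarrow> b v v = 0 \<Longrightarrow> l v = 0"
  shows "\<exists>u\<in>W. \<forall>v\<in>W. b u v = l v"
proof -
  obtain n e where "W \<subseteq> fun_span n e" using V_fin W(2) by blast
  from W(1) this show ?thesis
  proof (rule bilinear_representation)
    show "fun_linear W (b u)" if "u \<in> W" for u
      using that W(2) by (intro fun_linear_mono[OF b_right W(2)]) auto
    show "fun_linear W (\<lambda>u. b u v)" if "v \<in> W" for v
      using that W(2) by (intro fun_linear_mono[OF b_left W(2)]) auto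
    show "l v = 0" if "v \<in> W" "\<And>u. u \<in> W \<Longrightarrow> b u v = 0" for v
      using null that by blast
  qed (rule l)
qed

text \<open>The velocity is determined on the kernel of \<open>b\<close> by positivity of
  \<open>a\<close>. The residual \<open>a u - l\<close> then vanishes on that kernel, which is
  precisely the condition for representing it by \<open>b w\<close>.\<close>

lemma mixed_exists:
  assumes W: "fun_subspace W" "W \<subseteq> V" and l: "fun_linear W l"
  shows "\<exists>u\<in>W. \<exists>w\<in>W. b u u = 0 \<and> (\<forall>v\<in>W. a u v - b w v = l v)"
proof -
  let ?N = "{z \<in> W. b z z = 0}"
  have N: "fun_subspace ?N" "?N \<subseteq> V" using kernel_subspace[OF W] W by auto
  have "fun_linear ?N l" using l by (rule fun_linear_mono) blast
  from solve_a[OF N this] obtain u where u: "u \<in> ?N" "\<And>v. v \<in> ?N \<Longrightarrow> a u v = l v" by blast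
  have "fun_linear W (\<lambda>v. a u v - l v)"
    using u(1) W(2) l by (intro fun_linear_combine fun_linear_mono[OF a_right]) auto
  from solve_b[OF W this] u obtain w where w: "w \<in> W" "\<And>v. v \<in> W \<Longrightarrow> b w v = a u v - l v" by auto
  show ?thesis using u(1) w by (intro bexI[of _ u] bexI[of _ w]) auto
qed

text \<open>For the pressure representatives only \<open>b\<close> of their difference can be shown
  to vanish, that is, equality of their divergences; \<open>w\<close> itself is determined modulo
  the kernel of \<open>b\<close>.\<close>

lemma mixed_unique:
  assumes W: "fun_subspace W" "W \<subseteq> V" and mem: "u \<in> W" "u' \<in> W" "w \<in> W" "w' \<in> W"
    and div: "\<And>v. v \<in> W \<Longrightarrow> b v u = 0" "\<And>v. v \<in> W \<Longrightarrow> b v u' = 0"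
    and eq: "\<And>v. v \<in> W \<Longrightarrow> a u v - b w v = l v" "\<And>v. v \<in> W \<Longrightarrow> a u' v - b w' v = l v"
  shows "u = u' \<and> b (\<lambda>x. w x - w' x) (\<lambda>x. w x - w' x) = 0"
proof -
  let ?u = "\<lambda>x. u x - u' x" and ?w = "\<lambda>x. w x - w' x"
  have mem': "?u \<in> W" "?w \<in> W"
    by (rule fun_subspace_diff[OF W(1) mem(1,2)], rule fun_subspace_diff[OF W(1) mem(3,4)])
  note memV = mem[THEN subsetD[OF W(2)]]
  have a_diff: "a ?u v = a u v - a u' v" if "v \<in> W" for v
    by (rule fun_linear_diff[OF a_left[OF subsetD[OF W(2) that]] V_subspace memV(1,2)])
  have b_diff: "b ?w v = b w v - b w' v" if "v \<in> W" for v
    by (rule fun_linear_diff[OF b_left[OF subsetD[OF W(2) that]] V_subspace memV(3,4)])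
  have b_diff': "b v ?u = b v u - b v u'" if "v \<in> W" for v
    by (rule fun_linear_diff[OF b_right[OF subsetD[OF W(2) that]] V_subspace memV(1,2)])
  have eq0: "a ?u v = b ?w v" if "v \<in> W" for v
    using eq[OF that] a_diff[OF that] b_diff[OF that] by simp
  have "a ?u ?u = 0" using eq0[OF mem'(1)] b_diff'[OF mem'(2)] div[OF mem'(2)] by simp
  then have u0: "?u = (\<lambda>x. 0)" using a_pos[OF subsetD[OF W(2) mem'(1)]] by (metis less_irrefl)
  then have "u = u'" by (auto simp: fun_eq_iff)
  moreover have "b ?w ?w = 0"
    using eq0[OF mem'(2)] fun_linear_zero[OF a_left[OF subsetD[OF W(2) mem'(2)]] V_subspace]
    unfolding u0 by simp
  ultimately show ?thesis by blast
qed

end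

section \<open>Abstract static condensation\<close>

locale condensation = saddle_point V a b
  for V :: "('a \<Rightarrow> 'b::real_vector) set" and a b +
  fixes I :: "('a \<Rightarrow> 'b) set"
  assumes I: "fun_subspace I" "I \<subseteq> V"
begin

definition N where "N = {z \<in> I. b z z = 0}"

definition B where "B = {v \<in> V. (\<forall>z\<in>N. a v z = 0) \<and> (\<forall>r\<in>I. b v r = 0)}"

definition B' where "B' = {v \<in> V. (\<forall>z\<in>N. a z v = 0) \<and> (\<forall>r\<in>I. b v r = 0)}"

lemma N_subset: "N \<subseteq> I" "N \<subseteq> V" and N_subspace: "fun_subspace N"
  using I kernel_subspace[OF I] by (auto simp: N_def)

lemma B_subspace: "fun_subspace B"
proof (rule fun_subspaceI)
  have zero: "(\<lambda>x. 0) \<in> V" by (rule fun_subspace_zero[OF V_subspace])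
  have "a (\<lambda>x. 0) z = 0" if "z \<in> N" for z
    using that N_subset by (intro fun_linear_zero[OF a_left V_subspace]) auto
  moreover have "b (\<lambda>x. 0) r = 0" if "r \<in> I" for r
    using that I by (intro fun_linear_zero[OF b_left V_subspace]) auto
  ultimately show "(\<lambda>x. 0) \<in> B" using zero by (simp add: B_def)
  fix u v c assume uv: "u \<in> B" "v \<in> B"
  then have V: "u \<in> V" "v \<in> V" by (simp_all add: B_def)
  have "a (\<lambda>x. u x + c *\<^sub>R v x) z = 0" if "z \<in> N" for z
    using fun_linear_axpy[OF a_left V_subspace V, of z c] that N_subset uv by (auto simp: B_def)
  moreover have "b (\<lambda>x. u x + c *\<^sub>R v x) r = 0" if "r \<in> I" for r
    using fun_linear_axpy[OF b_left V_subspace V, of r c] that I uv by (auto simp: B_def)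
  ultimately show "(\<lambda>x. u x + c *\<^sub>R v x) \<in> B"
    using fun_subspace_axpy[OF V_subspace V] by (simp add: B_def)
qed

text \<open>The order of the two corrections matters: \<open>w1\<close> lies in the kernel of
  \<open>b\<close>, so it repairs the condition on \<open>a\<close> without disturbing the condition
  on \<open>b\<close> achieved by \<open>w0\<close>.\<close>

lemma split_B:
  assumes v: "v \<in> V"
  shows "\<exists>w\<in>I. (\<lambda>x. v x - w x) \<in> B"
proof -
  have "fun_linear I (b v)" using b_right[OF v] I(2) by (rule fun_linear_mono)
  moreover have "b v z = 0" if "z \<in> I" "b z z = 0" for z
    using b_null[of z v] that I v b_sym by auto
  ultimately obtain w0 where w0: "w0 \<in> I" "\<And>r. r \<in> I \<Longrightarrow> b w0 r = b v r"
    using solve_b[OF I] by blast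
  have w0V: "w0 \<in> V" using w0 I by blast
  have "fun_linear N (\<lambda>z. a v z - a w0 z)"
    by (intro fun_linear_combine fun_linear_mono[OF a_right] v w0V N_subset(2))
  then obtain w1 where w1: "w1 \<in> N" "\<And>z. z \<in> N \<Longrightarrow> a w1 z = a v z - a w0 z"
    using solve_a[OF N_subspace N_subset(2)] by blast
  have w1I: "w1 \<in> I" "w1 \<in> V" using w1 N_subset by auto
  let ?w = "\<lambda>x. w0 x + w1 x"
  have w: "?w \<in> I" "?w \<in> V" using fun_subspace_add[OF I(1) w0(1) w1I(1)] I by auto
  have "a (\<lambda>x. v x - ?w x) z = 0" if "z \<in> N" for z
  proof -
    have z: "z \<in> V" using that N_subset by blast
    have "a (\<lambda>x. v x - ?w x) z = a v z - a ?w z"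
      by (rule fun_linear_diff[OF a_left[OF z] V_subspace v w(2)])
    also have "a ?w z = a w0 z + a w1 z" by (rule fun_linear_add[OF a_left[OF z] w0V w1I(2)])
    finally show ?thesis using w1(2)[OF that] by simp
  qed
  moreover have "b (\<lambda>x. v x - ?w x) r = 0" if "r \<in> I" for r
  proof -
    have r: "r \<in> V" using that I by blast
    have "b (\<lambda>x. v x - ?w x) r = b v r - b ?w r"
      by (rule fun_linear_diff[OF b_left[OF r] V_subspace v w(2)])
    also have "b ?w r = b w0 r + b w1 r" by (rule fun_linear_add[OF b_left[OF r] w0V w1I(2)])
    also have "b w1 r = 0" using b_null[OF w1I(2) r] w1(1) by (simp add: N_def)
    finally show ?thesis using w0(2)[OF that] by simp
  qed
  moreover have "(\<lambda>x. v x - ?w x) \<in> V" by (rule fun_subspace_diff[OF V_subspace v w(2)])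
  ultimately have "(\<lambda>x. v x - ?w x) \<in> B" by (simp add: B_def)
  then show ?thesis using w(1) by (intro bexI[of _ ?w])
qed

lemma split_B':
  assumes v: "v \<in> V"
  shows "\<exists>w\<in>I. (\<lambda>x. v x - w x) \<in> B'"
proof -
  interpret t: condensation V "\<lambda>u v. a v u" b I
    using transpose I by (simp add: condensation_def condensation_axioms_def)
  \<comment> \<open>\<open>N\<close> is defined by \<open>b\<close> alone, so transposing
    \<open>a\<close> exchanges \<open>B\<close> and \<open>B'\<close> over the same
    \<open>N\<close>.\<close>
  have "t.B = B'" by (simp add: t.B_def t.N_def B'_def N_def)
  then show ?thesis using t.split_B[OF v] by simp
qed

lemma global_split:
  assumes u: "u \<in> V" and w: "w \<in> V" and div: "\<forall>v\<in>V. b v u = 0"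
    and eq: "\<forall>v\<in>V. a u v - b w v = l v"
  shows "\<exists>ut\<in>B. \<exists>wt\<in>B. \<exists>uI\<in>N. \<exists>wI\<in>I. u = (\<lambda>x. ut x + uI x) \<and> w = (\<lambda>x. wt x + wI x) \<and>
     b ut ut = 0 \<and> (\<forall>v\<in>B'. a ut v - b wt v = l v)"
proof -
  obtain uI where uI: "uI \<in> I" "(\<lambda>x. u x - uI x) \<in> B" using split_B[OF u] by (rule bexE)
  obtain wI where wI: "wI \<in> I" "(\<lambda>x. w x - wI x) \<in> B" using split_B[OF w] by (rule bexE)
  let ?u = "\<lambda>x. u x - uI x" and ?w = "\<lambda>x. w x - wI x"
  have V: "uI \<in> V" "wI \<in> V" "?u \<in> V" "?w \<in> V" using uI wI I by (auto simp: B_def)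
  \<comment> \<open>\<open>b\<close> of the boundary part against \<open>uI\<close> vanishes because
    \<open>uI\<close> is interior, and \<open>b u uI\<close> vanishes by the constraint; what
    remains is \<open>b uI uI = 0\<close>.\<close>
  have "b ?u uI = b u uI - b uI uI" by (rule fun_linear_diff[OF b_left[OF V(1)] V_subspace u V(1)])
  moreover have "b ?u uI = 0" using uI by (auto simp: B_def)
  moreover have "b u uI = 0" using bspec[OF div V(1)] b_sym by simp
  ultimately have uI0: "b uI uI = 0" by simp
  then have uIN: "uI \<in> N" using uI by (simp add: N_def)
  have "b ?u ?u = b u ?u - b uI ?u" by (rule fun_linear_diff[OF b_left[OF V(3)] V_subspace u V(1)])
  also have "\<dots> = 0" using bspec[OF div V(3)] b_null[OF V(1) V(3) uI0] b_sym by simp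
  finally have "b ?u ?u = 0" .
  moreover have "a ?u v - b ?w v = l v" if v: "v \<in> B'" for v
  proof -
    have vV: "v \<in> V" using v by (simp add: B'_def)
    have "a ?u v = a u v - a uI v" by (rule fun_linear_diff[OF a_left[OF vV] V_subspace u V(1)])
    moreover have "a uI v = 0" using v uIN by (simp add: B'_def)
    moreover have "b ?w v = b w v - b wI v" by (rule fun_linear_diff[OF b_left[OF vV] V_subspace w V(2)])
    moreover have "b wI v = 0" using v wI(1) b_sym[of wI v] by (simp add: B'_def)
    ultimately show ?thesis using bspec[OF eq vV] by simp
  qed
  ultimately show ?thesis
    using uI wI uIN by (intro bexI[of _ ?u] bexI[of _ ?w] bexI[of _ uI] bexI[of _ wI]) auto
qed

lemma boundary_unique:
  assumes u: "u \<in> B" and w: "w \<in> B" and div: "\<And>v. v \<in> B' \<Longrightarrow> b v u = 0"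
    and eq: "\<And>v. v \<in> B' \<Longrightarrow> a u v = b w v"
  shows "u = (\<lambda>x. 0) \<and> b w w = 0"
proof -
  have uV: "u \<in> V" and wV: "w \<in> V" using u w by (auto simp: B_def)
  have split: "\<exists>w\<in>I. \<exists>v'\<in>B'. v = (\<lambda>x. v' x + w x)" if v: "v \<in> V" for v
  proof -
    obtain w where "w \<in> I" "(\<lambda>x. v x - w x) \<in> B'" using split_B'[OF v] by (rule bexE)
    then show ?thesis by (intro bexI[of _ w] bexI[of _ "\<lambda>x. v x - w x"]) auto
  qed
  have B'V: "v \<in> V" if "v \<in> B'" for v using that by (simp add: B'_def)
  \<comment> \<open>The constraint is given on \<open>B'\<close> only. It extends to all of
    \<open>V\<close>, since \<open>u\<close> lies in \<open>B\<close> and is therefore orthogonal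
    under \<open>b\<close> to the interior parts.\<close>
  have div_all: "b v u = 0" if v: "v \<in> V" for v
  proof -
    obtain z v' where z: "z \<in> I" "v' \<in> B'" "v = (\<lambda>x. v' x + z x)" using split[OF v] by blast
    have "b v u = b v' u + b z u" unfolding z(3)
      using z I B'V by (intro fun_linear_add[OF b_left[OF uV]]) auto
    then show ?thesis using div[OF z(2)] u z(1) b_sym[of z u] by (simp add: B_def)
  qed
  \<comment> \<open>The test function is the part \<open>v\<close> of \<open>u\<close> in
    \<open>B'\<close>. The interior remainder \<open>z\<close> lies in \<open>N\<close>, so
    \<open>a u z = 0\<close> and testing with \<open>v\<close> amounts to testing with
    \<open>u\<close>.\<close>
  obtain z v where z: "z \<in> I" "v \<in> B'" "u = (\<lambda>x. v x + z x)" using split[OF uV] by blast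
  have zV: "z \<in> V" and vV: "v \<in> V" using z I B'V by auto
  have "b u z = b v z + b z z" unfolding z(3) by (rule fun_linear_add[OF b_left[OF zV] vV zV])
  moreover have "b u z = 0" using div_all[OF zV] b_sym by simp
  moreover have "b v z = 0" using z by (simp add: B'_def)
  ultimately have z0: "b z z = 0" by simp
  then have zN: "z \<in> N" using z by (simp add: N_def)
  have "a u (\<lambda>x. v x + z x) = a u v + a u z" by (rule fun_linear_add[OF a_right[OF uV] vV zV])
  then have "a u u = a u v + a u z" using z(3) by simp
  also have "a u z = 0" using u zN by (simp add: B_def)
  also have "a u v = b w v" by (rule eq[OF z(2)])
  also have "b w v = b w u - b w z"
  proof -
    have "b w (\<lambda>x. v x + z x) = b w v + b w z" by (rule fun_linear_add[OF b_right[OF wV] vV zV])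
    then show ?thesis using z(3) by simp
  qed
  also have "\<dots> = 0" using div_all[OF wV] w z(1) by (simp add: B_def)
  finally have "a u u = 0" by simp
  then have u0: "u = (\<lambda>x. 0)" using a_pos[OF uV] by force
  \<comment> \<open>The same device for the pressure: \<open>b w\<close> vanishes on
    \<open>I\<close> because \<open>w\<close> is in \<open>B\<close>, and on \<open>B'\<close> by
    the equation, now that \<open>u\<close> is zero.\<close>
  obtain r v where r: "r \<in> I" "v \<in> B'" "w = (\<lambda>x. v x + r x)" using split[OF wV] by blast
  have rV: "r \<in> V" and vV: "v \<in> V" using r I B'V by auto
  have "b w (\<lambda>x. v x + r x) = b w v + b w r" by (rule fun_linear_add[OF b_right[OF wV] vV rV])
  then have "b w w = b w v + b w r" using r(3) by simp
  also have "b w r = 0" using w r(1) by (simp add: B_def)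
  also have "b w v = a u v" using eq[OF r(2)] by simp
  also have "a u v = 0" unfolding u0 by (rule fun_linear_zero[OF a_left[OF vV] V_subspace])
  finally show ?thesis using u0 by simp
qed

end

section \<open>Divergences of finite element functions\<close>

lemma partial_deriv_axpy:
  assumes "f differentiable (at x)" "g differentiable (at x)"
  shows "partial_deriv i (\<lambda>y. f y + c * g y) x = partial_deriv i f x + c * partial_deriv i g x"
proof -
  have "((\<lambda>y. f y + c * g y) has_derivative
      (\<lambda>h. frechet_derivative f (at x) h + c * frechet_derivative g (at x) h)) (at x)"
    using assms unfolding frechet_derivative_works by (intro has_derivative_add has_derivative_mult_right)
  from partial_deriv_eq[OF this] show ?thesis by (simp add: partial_deriv_def)
qed

lemma partial_deriv_zero_on_open:
  assumes "open U" "x \<in> U" "\<And>y. y \<in> U \<Longrightarrow> f y = 0"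
  shows "partial_deriv i f x = 0"
proof -
  have "(f has_derivative (\<lambda>h. 0)) (at x)"
    by (rule has_derivative_transform_within_open[where f="\<lambda>x. 0" and s=U]) (use assms in auto)
  from partial_deriv_eq[OF this] show ?thesis .
qed

lemma poly_upto_axpy:
  fixes P Q :: "real^'n::finite \<Rightarrow> real"
  assumes "P \<in> poly_upto p" "Q \<in> poly_upto p"
  shows "(\<lambda>x. P x + k * Q x) \<in> poly_upto p"
proof -
  obtain c where c: "\<And>x. P x = (\<Sum>\<alpha>\<in>{\<alpha>. (\<Sum>i\<in>UNIV. \<alpha> i) \<le> p}. c \<alpha> * (\<Prod>i\<in>UNIV. (x $ i) ^ \<alpha> i))"
    using assms(1) by (auto simp: poly_upto_def)
  obtain d where d: "\<And>x. Q x = (\<Sum>\<alpha>\<in>{\<alpha>. (\<Sum>i\<in>UNIV. \<alpha> i) \<le> p}. d \<alpha> * (\<Prod>i\<in>UNIV. (x $ i) ^ \<alpha> i))"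
    using assms(2) by (auto simp: poly_upto_def)
  have "P x + k * Q x = (\<Sum>\<alpha>\<in>{\<alpha>. (\<Sum>i\<in>UNIV. \<alpha> i) \<le> p}. (c \<alpha> + k * d \<alpha>) * (\<Prod>i\<in>UNIV. (x $ i) ^ \<alpha> i))" for x
    by (simp add: c d sum.distrib sum_distrib_left algebra_simps)
  then show ?thesis unfolding poly_upto_def by (intro CollectI exI[of _ "\<lambda>\<alpha>. c \<alpha> + k * d \<alpha>"]) simp
qed

lemma poly_upto_zero: "(\<lambda>x. 0) \<in> poly_upto p"
  unfolding poly_upto_def by (intro CollectI exI[of _ "\<lambda>\<alpha>. 0"]) simp

lemma X_space_zero: "(\<lambda>x. 0) \<in> X_space \<Omega> \<T> p"
  unfolding X_space_def by (auto intro!: bexI[OF _ poly_upto_zero])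

lemma X_space_axpy:
  assumes "f \<in> X_space \<Omega> \<T> p" "g \<in> X_space \<Omega> \<T> p"
  shows "(\<lambda>x. f x + c * g x) \<in> X_space \<Omega> \<T> p"
proof -
  have "\<exists>R\<in>poly_upto p. \<forall>x\<in>K. f x + c * g x = R x" if K: "K \<in> \<T>" for K
  proof -
    obtain P where P: "P \<in> poly_upto p" "\<forall>x\<in>K. f x = P x" using assms(1) K by (auto simp: X_space_def)
    obtain Q where Q: "Q \<in> poly_upto p" "\<forall>x\<in>K. g x = Q x" using assms(2) K by (auto simp: X_space_def)
    show ?thesis using P(2) Q(2) by (intro bexI[OF _ poly_upto_axpy[OF P(1) Q(1), of c]]) simp
  qed
  moreover have "continuous_on (closure \<Omega>) (\<lambda>x. f x + c * g x)"
    using assms by (intro continuous_intros) (simp_all add: X_space_def)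
  ultimately show ?thesis using assms by (simp add: X_space_def)
qed

lemma XD_component: "v \<in> XD \<Omega> \<T> p \<Gamma> \<Longrightarrow> (\<lambda>x. v x $ i) \<in> X_space \<Omega> \<T> p"
  by (simp add: XD_def)

lemma XD_boundary: "v \<in> XD \<Omega> \<T> p \<Gamma> \<Longrightarrow> x \<in> \<Gamma> \<Longrightarrow> v x = 0"
  by (simp add: XD_def vec_eq_iff)

lemma XD_subspace: "fun_subspace (XD \<Omega> \<T> p \<Gamma>)"
proof (rule fun_subspaceI)
  show "(\<lambda>x. 0) \<in> XD \<Omega> \<T> p \<Gamma>" by (simp add: XD_def X_space_zero)
  show "(\<lambda>x. u x + c *\<^sub>R v x) \<in> XD \<Omega> \<T> p \<Gamma>" if "u \<in> XD \<Omega> \<T> p \<Gamma>" "v \<in> XD \<Omega> \<T> p \<Gamma>" for u v c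
    using that X_space_axpy[of "\<lambda>x. u x $ i" \<Omega> \<T> p "\<lambda>x. v x $ i" c for i] by (simp add: XD_def)
qed

lemma fun_span_finite_index:
  assumes "finite J"
  shows "\<exists>n d. \<forall>c. (\<lambda>x. \<Sum>j\<in>J. c j *\<^sub>R e j x) \<in> fun_span n d"
proof -
  obtain h where h: "bij_betw h {..<card J} J"
    using ex_bij_betw_nat_finite[OF assms] by (auto simp: atLeast0LessThan)
  have "(\<lambda>x. \<Sum>j\<in>J. c j *\<^sub>R e j x) = (\<lambda>x. \<Sum>k<card J. c (h k) *\<^sub>R e (h k) x)" for c
    by (rule ext) (rule sum.reindex_bij_betw[OF h, symmetric])
  then have "(\<lambda>x. \<Sum>j\<in>J. c j *\<^sub>R e j x) \<in> fun_span (card J) (\<lambda>k. e (h k))" for c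
    using fun_spanI[where n="card J" and c="\<lambda>k. c (h k)" and e="\<lambda>k. e (h k)"] by simp
  then show ?thesis by (intro exI allI)
qed

text \<open>On a finite measure space square integrability suffices through
  \<open>t \<le> 1 + t^2\<close>, so no Hoelder inequality is invoked.\<close>

lemma L2_times_bounded_integrable:
  fixes f v :: "'a \<Rightarrow> 'b::euclidean_space"
  assumes M: "finite_measure M" and f: "f \<in> L2 M" and v: "v \<in> borel_measurable M"
    and bd: "\<And>x. norm (v x) \<le> B"
  shows "integrable M (\<lambda>x. v x \<bullet> f x)"
proof (rule Bochner_Integration.integrable_bound[where f="\<lambda>x. B * (1 + (norm (f x))\<^sup>2)"])
  have "integrable M (\<lambda>x. 1 :: real)" by (rule finite_measure.integrable_const[OF M])
  then show "integrable M (\<lambda>x. B * (1 + (norm (f x))\<^sup>2))"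
    using f by (intro integrable_mult_right integrable_add) (simp_all add: L2_def)
  show "(\<lambda>x. v x \<bullet> f x) \<in> borel_measurable M"
    using f v by (intro borel_measurable_inner) (simp_all add: L2_def)
  show "AE x in M. norm (v x \<bullet> f x) \<le> norm (B * (1 + (norm (f x))\<^sup>2))"
  proof (intro AE_I2)
    fix x
    have B: "0 \<le> B" using bd[of x] norm_ge_zero[of "v x"] by linarith
    have "norm (f x) \<le> 1 + (norm (f x))\<^sup>2"
    proof -
      have "2 * norm (f x) \<le> (norm (f x))\<^sup>2 + 1"
        using zero_le_power2[of "norm (f x) - 1"] by (simp add: power2_diff)
      then show ?thesis using norm_ge_zero[of "f x"] by linarith
    qed
    then have "norm (v x) * norm (f x) \<le> B * (1 + (norm (f x))\<^sup>2)"
      using bd[of x] B by (intro mult_mono) auto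
    moreover have "norm (v x \<bullet> f x) \<le> norm (v x) * norm (f x)"
      using Cauchy_Schwarz_ineq2 by simp
    ultimately show "norm (v x \<bullet> f x) \<le> norm (B * (1 + (norm (f x))\<^sup>2))"
      by (simp only: real_norm_def)
  qed
qed

context mesh
begin

lemma dom_finite_measure: "finite_measure (lebesgue_on \<Omega>)"
  using open_dom bounded_dom by (intro finite_measure_lebesgue_on lmeasurable_open)

text \<open>The generators are discontinuous: one for each element, monomial and component, extended
  by zero. Assigning to every point a single element \<kappa> that contains it avoids counting
  points on shared faces several times.\<close>

lemma XD_finite_dim: "\<exists>n e. XD \<Omega> \<T> p \<Gamma> \<subseteq> fun_span n e"
proof -
  define A where "A = {\<alpha> :: 'n \<Rightarrow> nat. (\<Sum>i\<in>UNIV. \<alpha> i) \<le> p}"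
  define \<kappa> where "\<kappa> x = (SOME K. K \<in> \<T> \<and> x \<in> K)" for x
  have \<kappa>: "\<kappa> x \<in> \<T> \<and> x \<in> \<kappa> x" if "x \<in> closure \<Omega>" for x
    unfolding \<kappa>_def using that mesh_Union by (intro someI_ex[of "\<lambda>K. K \<in> \<T> \<and> x \<in> K"]) blast
  define m where "m \<alpha> x = (\<Prod>i\<in>UNIV. (x $ i) ^ \<alpha> i)" for \<alpha> and x :: "real^'n"
  define e where "e j x = (if x \<in> closure \<Omega> \<and> \<kappa> x = fst j
    then m (fst (snd j)) x *\<^sub>R axis (snd (snd j)) 1 else 0 :: real^'n)"
    for j :: "(real^'n) set \<times> ('n \<Rightarrow> nat) \<times> 'n" and x
  define J where "J = \<T> \<times> A \<times> (UNIV :: 'n set)"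
  have finA: "finite A" unfolding A_def by (rule finite_multi_indices)
  then have finJ: "finite J" unfolding J_def using finite_mesh by simp
  obtain n d where nd: "\<forall>c. (\<lambda>x. \<Sum>j\<in>J. c j *\<^sub>R e j x) \<in> fun_span n d"
    using fun_span_finite_index[OF finJ, of e] by (elim exE)
  have "v \<in> fun_span n d" if v: "v \<in> XD \<Omega> \<T> p \<Gamma>" for v
  proof -
    have "\<forall>q. \<exists>c. fst q \<in> \<T> \<longrightarrow> (\<forall>x\<in>fst q. v x $ snd q = (\<Sum>\<alpha>\<in>A. c \<alpha> * m \<alpha> x))"
    proof
      fix q :: "(real^'n) set \<times> 'n"
      show "\<exists>c. fst q \<in> \<T> \<longrightarrow> (\<forall>x\<in>fst q. v x $ snd q = (\<Sum>\<alpha>\<in>A. c \<alpha> * m \<alpha> x))"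
      proof (cases "fst q \<in> \<T>")
        case True
        then obtain P where P: "P \<in> poly_upto p" "\<forall>x\<in>fst q. v x $ snd q = P x"
          using XD_component[OF v, of "snd q"] by (auto simp: X_space_def)
        obtain c where "\<And>x. P x = (\<Sum>\<alpha>\<in>A. c \<alpha> * m \<alpha> x)"
          using P(1) by (auto simp: poly_upto_def A_def m_def)
        then show ?thesis using P(2) by (intro exI[of _ c]) simp
      qed simp
    qed
    from choice[OF this] obtain c1 where c1: "\<forall>q. fst q \<in> \<T> \<longrightarrow>
        (\<forall>x\<in>fst q. v x $ snd q = (\<Sum>\<alpha>\<in>A. c1 q \<alpha> * m \<alpha> x))" by (rule exE)
    define c0 where "c0 K i = c1 (K, i)" for K i
    have c0: "v x $ i = (\<Sum>\<alpha>\<in>A. c0 K i \<alpha> * m \<alpha> x)" if "K \<in> \<T>" "x \<in> K" for K x i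
      using spec[OF c1, of "(K, i)"] that by (simp add: c0_def)
    define c where "c j = c0 (fst j) (snd (snd j)) (fst (snd j))" for j
    have "v x $ k = (\<Sum>j\<in>J. c j *\<^sub>R e j x) $ k" for x k
    proof (cases "x \<in> closure \<Omega>")
      case True
      have "(\<Sum>j\<in>J. c j *\<^sub>R e j x) $ k = (\<Sum>K\<in>\<T>. \<Sum>\<alpha>\<in>A. \<Sum>i\<in>UNIV. (c (K, \<alpha>, i) *\<^sub>R e (K, \<alpha>, i) x) $ k)"
        unfolding J_def sum_component by (simp add: sum.cartesian_product case_prod_beta)
      also have "\<dots> = (\<Sum>K\<in>\<T>. \<Sum>\<alpha>\<in>A. if \<kappa> x = K then c0 K k \<alpha> * m \<alpha> x else 0)"
      proof (intro sum.cong refl)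
        fix K \<alpha>
        have "(\<Sum>i\<in>UNIV. (c (K, \<alpha>, i) *\<^sub>R e (K, \<alpha>, i) x) $ k)
            = (\<Sum>i\<in>UNIV. if i = k then (if \<kappa> x = K then c0 K k \<alpha> * m \<alpha> x else 0) else 0)"
          using True by (intro sum.cong) (auto simp: c_def e_def axis_def)
        then show "(\<Sum>i\<in>UNIV. (c (K, \<alpha>, i) *\<^sub>R e (K, \<alpha>, i) x) $ k) = (if \<kappa> x = K then c0 K k \<alpha> * m \<alpha> x else 0)"
          by simp
      qed
      also have "\<dots> = (\<Sum>K\<in>\<T>. if \<kappa> x = K then (\<Sum>\<alpha>\<in>A. c0 K k \<alpha> * m \<alpha> x) else 0)"
        by (intro sum.cong) auto
      also have "\<dots> = (\<Sum>\<alpha>\<in>A. c0 (\<kappa> x) k \<alpha> * m \<alpha> x)"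
        using \<kappa>[OF True] finite_mesh by simp
      also have "\<dots> = v x $ k" using c0[of "\<kappa> x" x k] \<kappa>[OF True] by simp
      finally show ?thesis by simp
    next
      case False
      then have "v x $ k = 0" using XD_component[OF v, of k] by (simp add: X_space_def)
      then show ?thesis using False by (simp add: e_def)
    qed
    then have "v = (\<lambda>x. \<Sum>j\<in>J. c j *\<^sub>R e j x)" by (simp add: fun_eq_iff vec_eq_iff)
    then show ?thesis using spec[OF nd, of c] by simp
  qed
  then show ?thesis by (intro exI subsetI)
qed

lemma AE_weak_div:
  assumes v: "v \<in> XD \<Omega> \<T> p \<Gamma>"
  shows "AE x in lebesgue_on \<Omega>. (\<forall>i. (\<lambda>y. v y $ i) differentiable (at x)) \<and>
     weak_div \<Omega> v x = (\<Sum>i\<in>UNIV. partial_deriv i (\<lambda>y. v y $ i) x)"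
proof -
  have "AE x in lebesgue_on \<Omega>. \<forall>i\<in>UNIV. (\<lambda>y. v y $ i) differentiable (at x) \<and>
      weak_partial \<Omega> i (\<lambda>y. v y $ i) x = partial_deriv i (\<lambda>y. v y $ i) x"
    by (rule AE_ball_countable')
      (use AE_X_space_differentiable[OF XD_component[OF v]] AE_weak_partial[OF XD_component[OF v]] in
        \<open>auto simp: countable_finite\<close>)
  then show ?thesis by eventually_elim (simp add: weak_div_def)
qed

text \<open>The three divergences involve unrelated choices of weak derivatives, so they are
  compared through the classical derivatives and only almost everywhere.\<close>

lemma AE_weak_div_axpy:
  assumes u: "u \<in> XD \<Omega> \<T> p \<Gamma>" and v: "v \<in> XD \<Omega> \<T> p \<Gamma>"
  shows "AE x in lebesgue_on \<Omega>. weak_div \<Omega> (\<lambda>x. u x + c *\<^sub>R v x) x = weak_div \<Omega> u x + c * weak_div \<Omega> v x"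
  using AE_weak_div[OF u] AE_weak_div[OF v] AE_weak_div[OF fun_subspace_axpy[OF XD_subspace u v, of c]]
proof eventually_elim
  case (elim x)
  then show ?case
    by (simp add: partial_deriv_axpy sum.distrib sum_distrib_left)
qed

lemma AE_weak_div_zero_on_open:
  assumes v: "v \<in> XD \<Omega> \<T> p \<Gamma>" and "open U" "\<And>y. y \<in> U \<Longrightarrow> v y = 0"
  shows "AE x in lebesgue_on \<Omega>. x \<in> U \<longrightarrow> weak_div \<Omega> v x = 0"
  using AE_weak_div[OF v]
proof eventually_elim
  case (elim x)
  show ?case
  proof
    assume "x \<in> U"
    then have "partial_deriv i (\<lambda>y. v y $ i) x = 0" for i
      using assms by (intro partial_deriv_zero_on_open[of U]) simp_all
    then show "weak_div \<Omega> v x = 0" using elim by simp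
  qed
qed

lemma AE_weak_div_eq_on_open:
  assumes u: "u \<in> XD \<Omega> \<T> p \<Gamma>" and v: "v \<in> XD \<Omega> \<T> p \<Gamma>" and "open U" "\<And>y. y \<in> U \<Longrightarrow> u y = v y"
  shows "AE x in lebesgue_on \<Omega>. x \<in> U \<longrightarrow> weak_div \<Omega> u x = weak_div \<Omega> v x"
  using AE_weak_div_axpy[OF u v, of "-1"]
    AE_weak_div_zero_on_open[OF fun_subspace_axpy[OF XD_subspace u v, of "-1"] \<open>open U\<close>] assms(4)
  by (auto elim!: eventually_elim2)

text \<open>Both properties are transferred from the explicit Borel representative; as the chosen
  function may differ from it on a null set, the bound is an almost-everywhere one.\<close>

lemma weak_partial_measurable_bounded:
  assumes f: "f \<in> X_space \<Omega> \<T> p"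
  shows "weak_partial \<Omega> i f \<in> borel_measurable (lebesgue_on \<Omega>)"
    and "\<exists>B. AE x in lebesgue_on \<Omega>. \<bar>weak_partial \<Omega> i f x\<bar> \<le> B"
proof -
  obtain g B where g: "has_weak_partial \<Omega> i f g" "g \<in> borel_measurable borel" "\<And>x. \<bar>g x\<bar> \<le> B"
    "\<And>K x. K \<in> \<T> \<Longrightarrow> x \<in> interior K \<Longrightarrow> g x = partial_deriv i f x"
    using X_space_has_weak_partial[OF f, of i] by metis
  have ae: "AE x in lebesgue_on \<Omega>. g x = weak_partial \<Omega> i f x"
    using AE_weak_partial[OF f, of i] AE_dom_interior
    by eventually_elim (use g(4) in auto)
  have "g \<in> borel_measurable (lebesgue_on \<Omega>)"
    using g(2) by (intro measurable_restrict_space1 measurable_completion) simp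
  then show "weak_partial \<Omega> i f \<in> borel_measurable (lebesgue_on \<Omega>)"
    using lebesgue_on_measurable_AE[OF dom_lebesgue _ ae] by blast
  show "\<exists>B. AE x in lebesgue_on \<Omega>. \<bar>weak_partial \<Omega> i f x\<bar> \<le> B"
    using ae by (intro exI[of _ B]) (auto elim!: eventually_mono simp: g(3) dest: sym)
qed

lemma weak_div_measurable:
  assumes "v \<in> XD \<Omega> \<T> p \<Gamma>"
  shows "weak_div \<Omega> v \<in> borel_measurable (lebesgue_on \<Omega>)"
  unfolding weak_div_def[abs_def]
  by (intro borel_measurable_sum weak_partial_measurable_bounded(1)[OF XD_component[OF assms]])

lemma weak_div_bounded:
  assumes "v \<in> XD \<Omega> \<T> p \<Gamma>"
  shows "\<exists>B. AE x in lebesgue_on \<Omega>. \<bar>weak_div \<Omega> v x\<bar> \<le> B"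
proof -
  have "\<forall>i. \<exists>B. AE x in lebesgue_on \<Omega>. \<bar>weak_partial \<Omega> i (\<lambda>y. v y $ i) x\<bar> \<le> B"
    using weak_partial_measurable_bounded(2)[OF XD_component[OF assms]] by (intro allI)
  from choice[OF this] obtain B
    where B: "\<forall>i. AE x in lebesgue_on \<Omega>. \<bar>weak_partial \<Omega> i (\<lambda>y. v y $ i) x\<bar> \<le> B i" by (rule exE)
  have "AE x in lebesgue_on \<Omega>. \<forall>i\<in>UNIV. \<bar>weak_partial \<Omega> i (\<lambda>y. v y $ i) x\<bar> \<le> B i"
    by (rule AE_ball_countable'[OF spec[OF B]]) (simp add: countable_finite)
  then have "AE x in lebesgue_on \<Omega>. \<bar>weak_div \<Omega> v x\<bar> \<le> (\<Sum>i\<in>UNIV. B i)"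
  proof eventually_elim
    case (elim x)
    then show ?case unfolding weak_div_def by (intro order_trans[OF sum_abs] sum_mono) simp
  qed
  then show ?thesis by (rule exI)
qed

lemma weak_div_product_integrable:
  assumes u: "u \<in> XD \<Omega> \<T> p \<Gamma>" and v: "v \<in> XD \<Omega> \<T> p \<Gamma>"
  shows "integrable (lebesgue_on \<Omega>) (\<lambda>x. weak_div \<Omega> u x * weak_div \<Omega> v x)"
proof -
  obtain A where A: "AE x in lebesgue_on \<Omega>. \<bar>weak_div \<Omega> u x\<bar> \<le> A" using weak_div_bounded[OF u] by (elim exE)
  obtain B where B: "AE x in lebesgue_on \<Omega>. \<bar>weak_div \<Omega> v x\<bar> \<le> B" using weak_div_bounded[OF v] by (elim exE)
  show ?thesis
  proof (rule finite_measure.integrable_const_bound[OF dom_finite_measure])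
    show "AE x in lebesgue_on \<Omega>. norm (weak_div \<Omega> u x * weak_div \<Omega> v x) \<le> A * B"
      using A B by eventually_elim (simp add: abs_mult mult_mono)
    show "(\<lambda>x. weak_div \<Omega> u x * weak_div \<Omega> v x) \<in> borel_measurable (lebesgue_on \<Omega>)"
      by (intro borel_measurable_times weak_div_measurable[OF u] weak_div_measurable[OF v])
  qed
qed

section \<open>The divergence form\<close>

definition div_form :: "(real^'n \<Rightarrow> real^'n) \<Rightarrow> (real^'n \<Rightarrow> real^'n) \<Rightarrow> real" where
  "div_form u v = inner_L2 (lebesgue_on \<Omega>) (weak_div \<Omega> u) (weak_div \<Omega> v)"

lemma div_form_sym: "div_form u v = div_form v u"
  by (simp add: div_form_def inner_L2_def mult.commute)

lemma div_form_linear: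
  assumes u: "u \<in> XD \<Omega> \<T> p \<Gamma>"
  shows "fun_linear (XD \<Omega> \<T> p \<Gamma>) (div_form u)"
proof -
  have axpy: "div_form u (\<lambda>x. v x + c *\<^sub>R w x) = div_form u v + c * div_form u w"
    if v: "v \<in> XD \<Omega> \<T> p \<Gamma>" and w: "w \<in> XD \<Omega> \<T> p \<Gamma>" for v w c
  proof -
    note s = fun_subspace_axpy[OF XD_subspace v w, of c]
    have "div_form u (\<lambda>x. v x + c *\<^sub>R w x) =
        (\<integral>x. weak_div \<Omega> u x * weak_div \<Omega> v x + c * (weak_div \<Omega> u x * weak_div \<Omega> w x) \<partial>lebesgue_on \<Omega>)"
      unfolding div_form_def inner_L2_def inner_real_def
    proof (rule integral_cong_AE)
      show "AE x in lebesgue_on \<Omega>. weak_div \<Omega> u x * weak_div \<Omega> (\<lambda>x. v x + c *\<^sub>R w x) x =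
          weak_div \<Omega> u x * weak_div \<Omega> v x + c * (weak_div \<Omega> u x * weak_div \<Omega> w x)"
        using AE_weak_div_axpy[OF v w, of c] by eventually_elim (simp add: algebra_simps)
    qed (intro borel_measurable_add borel_measurable_times borel_measurable_const
        weak_div_measurable[OF u] weak_div_measurable[OF v] weak_div_measurable[OF w] weak_div_measurable[OF s])+
    then show ?thesis
      using weak_div_product_integrable[OF u v] weak_div_product_integrable[OF u w]
      by (simp add: div_form_def inner_L2_def)
  qed
  \<comment> \<open>The chosen divergence of the zero function need not vanish pointwise;
    \<open>axpy\<close> with both arguments zero and factor -1 gives \<open>d = d - d\<close> for
    this value \<open>d\<close>.\<close>
  have zero: "div_form u (\<lambda>x. 0) = 0"
    using axpy[OF fun_subspace_zero[OF XD_subspace] fun_subspace_zero[OF XD_subspace], of "-1"] by simp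
  show ?thesis unfolding fun_linear_def
  proof (intro conjI ballI allI)
    show "div_form u (\<lambda>x. v x + w x) = div_form u v + div_form u w"
      if "v \<in> XD \<Omega> \<T> p \<Gamma>" "w \<in> XD \<Omega> \<T> p \<Gamma>" for v w
      using axpy[OF that, of 1] by simp
    show "div_form u (\<lambda>x. c *\<^sub>R v x) = c * div_form u v" if "v \<in> XD \<Omega> \<T> p \<Gamma>" for v c
      using axpy[OF fun_subspace_zero[OF XD_subspace] that, of c] zero by simp
  qed
qed

lemma div_form_zero_iff:
  assumes u: "u \<in> XD \<Omega> \<T> p \<Gamma>"
  shows "div_form u u = 0 \<longleftrightarrow> (AE x in lebesgue_on \<Omega>. weak_div \<Omega> u x = 0)"
  using integral_nonneg_eq_0_iff_AE[OF weak_div_product_integrable[OF u u]]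
  by (simp add: div_form_def inner_L2_def)

lemma div_form_AE_zero:
  assumes "AE x in lebesgue_on \<Omega>. weak_div \<Omega> u x = 0"
  shows "div_form u v = 0"
  unfolding div_form_def inner_L2_def
  by (rule integral_eq_zero_AE) (use assms in \<open>eventually_elim, simp\<close>)

end

section \<open>Interior spaces, Sobolev regularity and traces\<close>

context mesh
begin

lemma XI_loc_iff:
  assumes K: "K \<in> \<T>"
  shows "v \<in> XI_loc \<Omega> \<T> p \<Gamma> K \<longleftrightarrow>
     v \<in> XD \<Omega> \<T> p \<Gamma> \<and> (\<forall>x. x \<notin> K \<longrightarrow> v x = 0) \<and> (\<forall>x\<in>frontier K. v x = 0)"
proof -
  have "closure {x. v x \<noteq> 0} \<subseteq> K \<longleftrightarrow> {x. v x \<noteq> 0} \<subseteq> K"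
    using closure_subset closure_minimal[OF _ mesh_closed[OF K]] by (meson order_trans)
  then show ?thesis by (auto simp: XI_loc_def)
qed

lemma XI_loc_subspace:
  assumes K: "K \<in> \<T>"
  shows "fun_subspace (XI_loc \<Omega> \<T> p \<Gamma> K)"
proof (rule fun_subspaceI)
  show "(\<lambda>x. 0) \<in> XI_loc \<Omega> \<T> p \<Gamma> K"
    unfolding XI_loc_iff[OF K] using fun_subspace_zero[OF XD_subspace] by simp
  show "(\<lambda>x. u x + c *\<^sub>R v x) \<in> XI_loc \<Omega> \<T> p \<Gamma> K"
    if "u \<in> XI_loc \<Omega> \<T> p \<Gamma> K" "v \<in> XI_loc \<Omega> \<T> p \<Gamma> K" for u v c
    using that fun_subspace_axpy[OF XD_subspace, of u \<Omega> \<T> p \<Gamma> v c] unfolding XI_loc_iff[OF K] by simp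
qed

lemma XI_loc_subset: "XI_loc \<Omega> \<T> p \<Gamma> K \<subseteq> XD \<Omega> \<T> p \<Gamma>"
  by (auto simp: XI_loc_def)

lemma XI_loc_zero:
  assumes "K \<in> \<T>" "v \<in> XI_loc \<Omega> \<T> p \<Gamma> K" "x \<notin> interior K"
  shows "v x = 0"
proof (cases "x \<in> K")
  case True
  then have "x \<in> frontier K" using assms(3) closure_subset[of K] by (auto simp: frontier_def)
  then show ?thesis using assms(2) unfolding XI_loc_iff[OF assms(1)] by simp
next
  case False
  then show ?thesis using assms(2) unfolding XI_loc_iff[OF assms(1)] by simp
qed

lemma XI_loc_zero_other:
  assumes "K \<in> \<T>" "K' \<in> \<T>" "v \<in> XI_loc \<Omega> \<T> p \<Gamma> K" "x \<in> K'" "K \<noteq> K'"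
  shows "v x = 0"
  using XI_loc_zero[OF assms(1,3)] mesh_interior_unique[OF assms(1,2) _ assms(4)] assms(5) by blast

lemma mesh_sum_on:
  assumes w: "\<forall>K\<in>\<T>. w K \<in> XI_loc \<Omega> \<T> p \<Gamma> K" and K: "K \<in> \<T>" "x \<in> K"
  shows "(\<Sum>K\<in>\<T>. w K x) = w K x"
proof -
  have "w K' x = 0" if "K' \<in> \<T> - {K}" for K'
    using XI_loc_zero_other[OF _ K(1) bspec[OF w] K(2)] that by blast
  then show ?thesis using K(1) finite_mesh by (simp add: sum.remove[of \<T> K])
qed

lemma XI_memI:
  assumes "\<forall>K\<in>\<T>. w K \<in> XI_loc \<Omega> \<T> p \<Gamma> K"
  shows "(\<lambda>x. \<Sum>K\<in>\<T>. w K x) \<in> XI \<Omega> \<T> p \<Gamma>"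
  unfolding XI_def mesh_sum_def using assms by (intro CollectI exI[of _ w]) simp

lemma XI_memE:
  assumes "v \<in> XI \<Omega> \<T> p \<Gamma>"
  obtains w where "\<forall>K\<in>\<T>. w K \<in> XI_loc \<Omega> \<T> p \<Gamma> K" "v = (\<lambda>x. \<Sum>K\<in>\<T>. w K x)"
proof -
  obtain w where w: "\<forall>K\<in>\<T>. w K \<in> XI_loc \<Omega> \<T> p \<Gamma> K" "v = (\<lambda>x. \<Sum>K\<in>\<T>. w K x)"
    using assms unfolding XI_def mesh_sum_def by (elim CollectE exE conjE)
  show thesis by (rule that[OF w])
qed

lemma XI_subset: "XI \<Omega> \<T> p \<Gamma> \<subseteq> XD \<Omega> \<T> p \<Gamma>"
proof
  fix v assume "v \<in> XI \<Omega> \<T> p \<Gamma>"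
  then obtain w where w: "\<forall>K\<in>\<T>. w K \<in> XI_loc \<Omega> \<T> p \<Gamma> K" and v: "v = (\<lambda>x. \<Sum>K\<in>\<T>. w K x)"
    by (rule XI_memE)
  show "v \<in> XD \<Omega> \<T> p \<Gamma>"
    unfolding v by (rule fun_subspace_sum[OF XD_subspace subsetD[OF XI_loc_subset bspec[OF w]]])
qed

lemma XI_subspace: "fun_subspace (XI \<Omega> \<T> p \<Gamma>)"
proof (rule fun_subspaceI)
  show "(\<lambda>x. 0) \<in> XI \<Omega> \<T> p \<Gamma>"
    using XI_memI[of "\<lambda>K x. 0"] fun_subspace_zero[OF XI_loc_subspace] by simp
  fix u v c assume uv: "u \<in> XI \<Omega> \<T> p \<Gamma>" "v \<in> XI \<Omega> \<T> p \<Gamma>"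
  obtain w where w: "\<forall>K\<in>\<T>. w K \<in> XI_loc \<Omega> \<T> p \<Gamma> K" "u = (\<lambda>x. \<Sum>K\<in>\<T>. w K x)"
    using uv(1) by (rule XI_memE)
  obtain z where z: "\<forall>K\<in>\<T>. z K \<in> XI_loc \<Omega> \<T> p \<Gamma> K" "v = (\<lambda>x. \<Sum>K\<in>\<T>. z K x)"
    using uv(2) by (rule XI_memE)
  have "(\<lambda>x. \<Sum>K\<in>\<T>. w K x + c *\<^sub>R z K x) \<in> XI \<Omega> \<T> p \<Gamma>"
    by (rule XI_memI) (intro ballI fun_subspace_axpy[OF XI_loc_subspace] bspec[OF w(1)] bspec[OF z(1)])
  then show "(\<lambda>x. u x + c *\<^sub>R v x) \<in> XI \<Omega> \<T> p \<Gamma>"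
    by (simp add: w(2) z(2) sum.distrib scaleR_sum_right)
qed

lemma XI_loc_subset_XI:
  assumes K: "K \<in> \<T>"
  shows "XI_loc \<Omega> \<T> p \<Gamma> K \<subseteq> XI \<Omega> \<T> p \<Gamma>"
proof
  fix v assume v: "v \<in> XI_loc \<Omega> \<T> p \<Gamma> K"
  define w where "w K' = (if K' = K then v else (\<lambda>x. 0))" for K'
  have "(\<lambda>x. \<Sum>K'\<in>\<T>. w K' x) \<in> XI \<Omega> \<T> p \<Gamma>"
    by (rule XI_memI) (simp add: w_def v fun_subspace_zero[OF XI_loc_subspace])
  moreover have "(\<Sum>K'\<in>\<T>. w K' x) = v x" for x
  proof -
    have "(\<Sum>K'\<in>\<T>. w K' x) = (\<Sum>K'\<in>\<T>. if K' = K then v x else 0)"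
      by (intro sum.cong) (simp_all add: w_def)
    then show ?thesis using K finite_mesh by simp
  qed
  ultimately show "v \<in> XI \<Omega> \<T> p \<Gamma>" by simp
qed

lemma AE_weak_div_XI_loc_outside:
  assumes K: "K \<in> \<T>" and v: "v \<in> XI_loc \<Omega> \<T> p \<Gamma> K"
  shows "AE x in lebesgue_on \<Omega>. x \<notin> K \<longrightarrow> weak_div \<Omega> v x = 0"
proof -
  have "AE x in lebesgue_on \<Omega>. x \<in> - K \<longrightarrow> weak_div \<Omega> v x = 0"
  proof (rule AE_weak_div_zero_on_open[OF subsetD[OF XI_loc_subset v]])
    show "open (- K)" by (rule open_Compl[OF mesh_closed[OF K]])
    show "v y = 0" if "y \<in> - K" for y using v that unfolding XI_loc_iff[OF K] by simp
  qed
  then show ?thesis by simp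
qed

lemma AE_weak_div_mesh_sum_on:
  assumes w: "\<forall>K\<in>\<T>. w K \<in> XI_loc \<Omega> \<T> p \<Gamma> K" and K: "K \<in> \<T>"
  shows "AE x in lebesgue_on \<Omega>. x \<in> K \<longrightarrow> weak_div \<Omega> (\<lambda>x. \<Sum>K\<in>\<T>. w K x) x = weak_div \<Omega> (w K) x"
proof -
  have "AE x in lebesgue_on \<Omega>. x \<in> interior K \<longrightarrow>
      weak_div \<Omega> (\<lambda>x. \<Sum>K\<in>\<T>. w K x) x = weak_div \<Omega> (w K) x"
  proof (rule AE_weak_div_eq_on_open)
    show "(\<lambda>x. \<Sum>K\<in>\<T>. w K x) \<in> XD \<Omega> \<T> p \<Gamma>" by (rule subsetD[OF XI_subset XI_memI[OF w]])
    show "w K \<in> XD \<Omega> \<T> p \<Gamma>" by (rule subsetD[OF XI_loc_subset bspec[OF w K]])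
    show "(\<Sum>K\<in>\<T>. w K y) = w K y" if "y \<in> interior K" for y
      using that interior_subset by (intro mesh_sum_on[OF w K]) auto
  qed simp
  \<comment> \<open>Almost every point lies in the interior of some element, and if it also lies in
    \<open>K\<close> that element is \<open>K\<close>.\<close>
  then show ?thesis using AE_dom_interior
  proof eventually_elim
    case (elim x)
    then show ?case using mesh_interior_unique[OF _ K, of _ x] by blast
  qed
qed

lemma AE_weak_div_mesh_sum:
  assumes w: "\<forall>K\<in>\<T>. w K \<in> XI_loc \<Omega> \<T> p \<Gamma> K"
  shows "AE x in lebesgue_on \<Omega>. weak_div \<Omega> (\<lambda>x. \<Sum>K\<in>\<T>. w K x) x = (\<Sum>K\<in>\<T>. weak_div \<Omega> (w K) x)"
proof -
  have "AE x in lebesgue_on \<Omega>. \<forall>K\<in>\<T>. x \<in> K \<longrightarrow> weak_div \<Omega> (\<lambda>x. \<Sum>K\<in>\<T>. w K x) x = weak_div \<Omega> (w K) x"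
    by (rule AE_ball_countable'[OF AE_weak_div_mesh_sum_on[OF w]]) (simp_all add: countable_finite finite_mesh)
  moreover have "AE x in lebesgue_on \<Omega>. \<forall>K\<in>\<T>. x \<notin> K \<longrightarrow> weak_div \<Omega> (w K) x = 0"
    by (rule AE_ball_countable'[OF AE_weak_div_XI_loc_outside[OF _ bspec[OF w]]]) (simp_all add: countable_finite finite_mesh)
  ultimately show ?thesis using AE_dom_interior
  proof eventually_elim
    case (elim x)
    then obtain K where K: "K \<in> \<T>" "x \<in> interior K" by blast
    then have x: "x \<in> K" using interior_subset by blast
    have "weak_div \<Omega> (w K') x = 0" if "K' \<in> \<T> - {K}" for K'
    proof -
      have "x \<notin> K'" using mesh_interior_unique[OF K(1) _ K(2)] that by blast
      then show ?thesis using elim(2) that by blast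
    qed
    then have "(\<Sum>K\<in>\<T>. weak_div \<Omega> (w K) x) = weak_div \<Omega> (w K) x"
      using K(1) finite_mesh by (simp add: sum.remove[of \<T> K])
    then show ?case using elim(1) K(1) x by simp
  qed
qed

text \<open>Divergences from different elements have disjoint supports up to null sets, so the
  divergence of the sum vanishes iff each one does. This identifies the elementwise definition with
  the kernel in the abstract setting.\<close>

lemma NI_eq: "NI \<Omega> \<T> p \<Gamma> = {z \<in> XI \<Omega> \<T> p \<Gamma>. div_form z z = 0}"
proof (intro equalityI subsetI)
  fix z assume "z \<in> NI \<Omega> \<T> p \<Gamma>"
  then obtain w where w: "\<forall>K\<in>\<T>. w K \<in> NI_loc \<Omega> \<T> p \<Gamma> K" and z: "z = (\<lambda>x. \<Sum>K\<in>\<T>. w K x)"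
    unfolding NI_def mesh_sum_def by (elim CollectE exE conjE)
  have wX: "\<forall>K\<in>\<T>. w K \<in> XI_loc \<Omega> \<T> p \<Gamma> K" using w by (simp add: NI_loc_def)
  have "AE x in lebesgue_on \<Omega>. \<forall>K\<in>\<T>. weak_div \<Omega> (w K) x = 0"
  proof (rule AE_ball_countable')
    show "AE x in lebesgue_on \<Omega>. weak_div \<Omega> (w K) x = 0" if "K \<in> \<T>" for K
      using bspec[OF w that] by (simp add: NI_loc_def)
  qed (simp add: countable_finite finite_mesh)
  with AE_weak_div_mesh_sum[OF wX] have "AE x in lebesgue_on \<Omega>. weak_div \<Omega> z x = 0"
    unfolding z by eventually_elim simp
  then have "div_form z z = 0" by (rule div_form_AE_zero)
  moreover have "z \<in> XI \<Omega> \<T> p \<Gamma>" unfolding z by (rule XI_memI[OF wX])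
  ultimately show "z \<in> {z \<in> XI \<Omega> \<T> p \<Gamma>. div_form z z = 0}" by simp
next
  fix z assume z: "z \<in> {z \<in> XI \<Omega> \<T> p \<Gamma>. div_form z z = 0}"
  then have zX: "z \<in> XI \<Omega> \<T> p \<Gamma>" by simp
  then obtain w where w: "\<forall>K\<in>\<T>. w K \<in> XI_loc \<Omega> \<T> p \<Gamma> K" and zw: "z = (\<lambda>x. \<Sum>K\<in>\<T>. w K x)"
    by (rule XI_memE)
  have z0: "AE x in lebesgue_on \<Omega>. weak_div \<Omega> z x = 0"
    using z div_form_zero_iff[OF subsetD[OF XI_subset zX]] by simp
  have "w K \<in> NI_loc \<Omega> \<T> p \<Gamma> K" if K: "K \<in> \<T>" for K
  proof -
    have "AE x in lebesgue_on \<Omega>. weak_div \<Omega> (w K) x = 0"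
      using AE_weak_div_mesh_sum_on[OF w K] AE_weak_div_XI_loc_outside[OF K bspec[OF w K]] z0
      unfolding zw by eventually_elim auto
    then show ?thesis using bspec[OF w K] by (simp add: NI_loc_def)
  qed
  then show "z \<in> NI \<Omega> \<T> p \<Gamma>" unfolding NI_def mesh_sum_def zw by (intro CollectI exI[of _ w]) simp
qed

text \<open>An element is closed and may touch the boundary of the open domain, hence need not be
  contained in it; the part outside lies in the frontier of \<open>K\<close>, which is null.\<close>

lemma integral_supported_on_element:
  fixes F :: "real^'n \<Rightarrow> real"
  assumes K: "K \<in> \<T>" and F: "F \<in> borel_measurable (lebesgue_on \<Omega>)"
    and zero: "AE x in lebesgue_on \<Omega>. x \<notin> K \<longrightarrow> F x = 0"
  shows "(\<integral>x. F x \<partial>lebesgue_on \<Omega>) = (\<integral>x. F x \<partial>lebesgue_on K)"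
proof -
  let ?f = "\<lambda>x. if x \<in> \<Omega> then F x else 0" and ?g = "\<lambda>x. if x \<in> K then F x else 0"
  have f: "?f \<in> borel_measurable lebesgue" using F dom_lebesgue by (simp add: borel_measurable_if)
  have null: "AE x in lebesgue. x \<notin> frontier K"
    using mesh_convex[OF K] by (intro AE_not_in) (simp add: negligible_iff_null_sets[symmetric] negligible_convex_frontier)
  have "AE x in lebesgue. x \<in> \<Omega> \<longrightarrow> x \<notin> K \<longrightarrow> F x = 0"
    using zero dom_lebesgue by (simp add: AE_restrict_space_iff)
  then have ae: "AE x in lebesgue. ?f x = ?g x"
    using null
  proof eventually_elim
    case (elim x)
    have "x \<in> \<Omega>" if "x \<in> K"
    proof -
      have "x \<in> interior K" using elim(2) that closure_subset[of K] by (auto simp: frontier_def)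
      then show ?thesis using mesh_interior[OF K] by blast
    qed
    then show ?case using elim(1) by auto
  qed
  have g: "?g \<in> borel_measurable lebesgue" by (rule borel_measurable_AE[OF f ae])
  have "(\<integral>x. F x \<partial>lebesgue_on \<Omega>) = (\<integral>x. ?f x \<partial>lebesgue)"
    unfolding lebesgue_on_integral[OF dom_lebesgue] by (intro Bochner_Integration.integral_cong) (auto simp: indicator_def)
  also have "\<dots> = (\<integral>x. ?g x \<partial>lebesgue)" by (rule integral_cong_AE[OF f g ae])
  also have "\<dots> = (\<integral>x. F x \<partial>lebesgue_on K)"
    unfolding lebesgue_on_integral[OF mesh_lebesgue[OF K]] by (intro Bochner_Integration.integral_cong) (auto simp: indicator_def)
  finally show ?thesis .
qed

lemma div_form_local:
  assumes K: "K \<in> \<T>" and u: "u \<in> XD \<Omega> \<T> p \<Gamma>" and v: "v \<in> XI_loc \<Omega> \<T> p \<Gamma> K"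
  shows "inner_L2 (lebesgue_on K) (weak_div \<Omega> u) (weak_div \<Omega> v) = div_form u v"
proof -
  have "(\<integral>x. weak_div \<Omega> u x * weak_div \<Omega> v x \<partial>lebesgue_on \<Omega>)
      = (\<integral>x. weak_div \<Omega> u x * weak_div \<Omega> v x \<partial>lebesgue_on K)"
  proof (rule integral_supported_on_element[OF K])
    show "(\<lambda>x. weak_div \<Omega> u x * weak_div \<Omega> v x) \<in> borel_measurable (lebesgue_on \<Omega>)"
      by (intro borel_measurable_times weak_div_measurable[OF u] weak_div_measurable[OF subsetD[OF XI_loc_subset v]])
    show "AE x in lebesgue_on \<Omega>. x \<notin> K \<longrightarrow> weak_div \<Omega> u x * weak_div \<Omega> v x = 0"
      using AE_weak_div_XI_loc_outside[OF K v] by eventually_elim simp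
  qed
  then show ?thesis by (simp add: inner_L2_def div_form_def)
qed

section \<open>Regularity of finite element functions and definiteness of the Sobolev norm\<close>

lemma XD_continuous:
  assumes "v \<in> XD \<Omega> \<T> p \<Gamma>"
  shows "continuous_on (closure \<Omega>) v"
proof -
  have "continuous_on (closure \<Omega>) (\<lambda>x. \<chi> i. v x $ i)"
    using XD_component[OF assms] by (intro continuous_on_vec_lambda) (simp add: X_space_def)
  then show ?thesis by simp
qed

lemma XD_outside: "v \<in> XD \<Omega> \<T> p \<Gamma> \<Longrightarrow> x \<notin> closure \<Omega> \<Longrightarrow> v x = 0"
  by (simp add: XD_def X_space_def vec_eq_iff)

lemma XD_borel:
  assumes v: "v \<in> XD \<Omega> \<T> p \<Gamma>"
  shows "v \<in> borel_measurable borel"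
proof -
  have "(\<lambda>x. indicator (closure \<Omega>) x *\<^sub>R v x) \<in> borel_measurable borel"
    by (rule borel_measurable_continuous_on_indicator[OF _ XD_continuous[OF v]]) simp
  moreover have "(\<lambda>x. indicator (closure \<Omega>) x *\<^sub>R v x) = v"
  proof
    show "indicator (closure \<Omega>) x *\<^sub>R v x = v x" for x
      using XD_outside[OF v] by (cases "x \<in> closure \<Omega>") simp_all
  qed
  ultimately show ?thesis by simp
qed

lemma XD_bounded:
  assumes v: "v \<in> XD \<Omega> \<T> p \<Gamma>"
  shows "\<exists>B. \<forall>x. norm (v x) \<le> B"
proof -
  have "bounded (v ` closure \<Omega>)"
    by (intro compact_imp_bounded compact_continuous_image XD_continuous[OF v] compact_closure_dom)
  then obtain B where B: "\<And>x. x \<in> closure \<Omega> \<Longrightarrow> norm (v x) \<le> B" by (auto simp: bounded_iff)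
  have "norm (v x) \<le> max B 0" for x
    using B[of x] XD_outside[OF v] by (cases "x \<in> closure \<Omega>") auto
  then show ?thesis by blast
qed

lemma bounded_measurable_L2:
  fixes f :: "real^'n \<Rightarrow> real"
  assumes f: "f \<in> borel_measurable (lebesgue_on \<Omega>)" and bd: "\<And>x. \<bar>f x\<bar> \<le> B"
  shows "f \<in> L2 (lebesgue_on \<Omega>)"
proof -
  have "integrable (lebesgue_on \<Omega>) (\<lambda>x. (norm (f x))\<^sup>2)"
  proof (rule finite_measure.integrable_const_bound[OF dom_finite_measure])
    show "AE x in lebesgue_on \<Omega>. norm ((norm (f x))\<^sup>2) \<le> B\<^sup>2"
      using bd by (intro AE_I2) (simp add: abs_le_square_iff[symmetric] order_trans[OF bd abs_ge_self])
  qed (use f in measurable)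
  then show ?thesis using f by (simp add: L2_def)
qed

lemma X_space_H1:
  assumes f: "f \<in> X_space \<Omega> \<T> p"
  shows "f \<in> H1 \<Omega>"
proof -
  obtain B where "\<And>x. \<bar>f x\<bar> \<le> B" using X_space_bounded[OF f] by blast
  then have "f \<in> L2 (lebesgue_on \<Omega>)" by (rule bounded_measurable_L2[OF X_space_measurable[OF f]])
  moreover have "\<exists>g\<in>L2 (lebesgue_on \<Omega>). has_weak_partial \<Omega> i f g" for i
  proof -
    obtain g B where g: "has_weak_partial \<Omega> i f g" "g \<in> borel_measurable borel" "\<And>x. \<bar>g x\<bar> \<le> B"
      using X_space_has_weak_partial[OF f, of i] by metis
    have "g \<in> borel_measurable (lebesgue_on \<Omega>)"
      using g(2) by (intro measurable_restrict_space1 measurable_completion) simp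
    then have "g \<in> L2 (lebesgue_on \<Omega>)" using g(3) by (rule bounded_measurable_L2)
    then show ?thesis using g(1) by (intro bexI[of _ g])
  qed
  ultimately show ?thesis by (simp add: H1_def)
qed

lemma XD_H1v: "v \<in> XD \<Omega> \<T> p \<Gamma> \<Longrightarrow> v \<in> H1v \<Omega>"
  unfolding H1v_def by (intro CollectI allI X_space_H1 XD_component)

lemma H1_norm_zero: "H1_norm \<Omega> (\<lambda>x. 0) = 0"
proof -
  have "(\<integral>x. (weak_partial \<Omega> j (\<lambda>y. 0) x)\<^sup>2 \<partial>lebesgue_on \<Omega>) = 0" for j
  proof (rule integral_eq_zero_AE)
    show "AE x in lebesgue_on \<Omega>. (weak_partial \<Omega> j (\<lambda>y. 0) x)\<^sup>2 = 0"
      using AE_weak_partial[OF X_space_zero, of j]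
      by eventually_elim (simp add: partial_deriv_zero_on_open[of UNIV])
  qed
  then show ?thesis by (simp add: H1_norm_def)
qed

text \<open>A vanishing norm makes each component zero almost everywhere in the domain. Its nonzero
  set there is open by continuity and negligible, hence empty; the closure follows by continuity,
  and the outside by the zero extension.\<close>

lemma H1_norm_pos:
  assumes v: "v \<in> XD \<Omega> \<T> p \<Gamma>" and nz: "v \<noteq> (\<lambda>x. 0)"
  shows "H1_norm \<Omega> v > 0"
proof (rule ccontr)
  let ?a = "\<lambda>i. \<integral>x. (v x $ i)\<^sup>2 \<partial>lebesgue_on \<Omega>"
  let ?b = "\<lambda>i. \<Sum>j\<in>UNIV. \<integral>x. (weak_partial \<Omega> j (\<lambda>y. v y $ i) x)\<^sup>2 \<partial>lebesgue_on \<Omega>"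
  have nonneg: "?a i \<ge> 0" "?b i \<ge> 0" for i by (simp_all add: sum_nonneg)
  assume "\<not> H1_norm \<Omega> v > 0"
  then have le: "(\<Sum>i\<in>UNIV. ?a i + ?b i) \<le> 0" by (simp add: H1_norm_def)
  have "v x $ i = 0" if x: "x \<in> closure \<Omega>" for x i
  proof -
    have "?a i + ?b i \<le> (\<Sum>i\<in>UNIV. ?a i + ?b i)"
      by (rule member_le_sum) (use nonneg in \<open>auto intro: add_nonneg_nonneg\<close>)
    then have a0: "?a i = 0" using le nonneg[of i] by linarith
    note X = XD_component[OF v, of i]
    obtain B where B: "\<And>x. \<bar>v x $ i\<bar> \<le> B" using X_space_bounded[OF X] by blast
    have "(\<lambda>x. v x $ i) \<in> L2 (lebesgue_on \<Omega>)" by (rule bounded_measurable_L2[OF X_space_measurable[OF X] B])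
    then have "integrable (lebesgue_on \<Omega>) (\<lambda>x. (v x $ i)\<^sup>2)" by (simp add: L2_def)
    from integral_nonneg_eq_0_iff_AE[OF this] a0 have "AE x in lebesgue_on \<Omega>. v x $ i = 0" by simp
    then have ae: "AE x in lebesgue. \<not> (x \<in> \<Omega> \<and> v x $ i \<noteq> 0)"
      using dom_lebesgue by (simp add: AE_restrict_space_iff)
    let ?S = "\<Omega> \<inter> (\<lambda>x. v x $ i) -` (- {0})"
    have "\<exists>N\<in>null_sets lebesgue. ?S \<subseteq> N"
    proof (rule AE_E3[OF ae])
      fix N assume N: "\<And>x. x \<in> space lebesgue - N \<Longrightarrow> \<not> (x \<in> \<Omega> \<and> v x $ i \<noteq> 0)" "N \<in> null_sets lebesgue"
      have "?S \<subseteq> N"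
      proof
        fix x assume "x \<in> ?S"
        then show "x \<in> N" using N(1)[of x] by auto
      qed
      then show ?thesis using N(2) by blast
    qed
    then obtain N where N: "N \<in> null_sets lebesgue" "?S \<subseteq> N" by (rule bexE)
    have neg: "negligible ?S"
      unfolding negligible_iff_null_sets by (rule null_sets_completion_subset[OF N(2,1)])
    have cont: "continuous_on (closure \<Omega>) (\<lambda>x. v x $ i)" using X by (simp add: X_space_def)
    then have "continuous_on \<Omega> (\<lambda>x. v x $ i)" by (rule continuous_on_subset[OF _ closure_subset])
    then have op: "open ?S"
      by (rule continuous_open_preimage[OF _ open_dom open_Compl[OF closed_singleton]])
    have S0: "?S = {}"
    proof (rule ccontr)
      assume "?S \<noteq> {}"
      from open_not_negligible[OF op this] neg show False by (rule notE)
    qed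
    have "v y $ i = 0" if y: "y \<in> \<Omega>" for y
    proof (rule ccontr)
      assume "v y $ i \<noteq> 0"
      then have "y \<in> ?S" using y by simp
      then show False unfolding S0 by simp
    qed
    with cont show ?thesis using x by (rule continuous_constant_on_closure)
  qed
  then have zero: "v x = 0" if "x \<in> closure \<Omega>" for x using that by (simp add: vec_eq_iff)
  have "v x = 0" for x using zero[of x] XD_outside[OF v, of x] by (cases "x \<in> closure \<Omega>") simp_all
  then show False using nz by (simp add: fun_eq_iff)
qed

end

section \<open>Static condensation\<close>

lemma bilinear_form_onD:
  assumes B: "bilinear_form_on W B" and W: "u \<in> W" "v \<in> W" "w \<in> W"
  shows "B (\<lambda>x. u x + v x) w = B u w + B v w" "B w (\<lambda>x. u x + v x) = B w u + B w v"
    "B (\<lambda>x. c *\<^sub>R u x) w = c * B u w" "B w (\<lambda>x. c *\<^sub>R u x) = c * B w u"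
  using spec[OF bspec[OF bspec[OF bspec[OF B[unfolded bilinear_form_on_def] W(1)] W(2)] W(3)], of c]
  by simp_all

locale fem = mesh \<Omega> \<T> for \<Omega> :: "(real^'n::finite) set" and \<T> +
  fixes \<Gamma>\<^sub>D \<Gamma>\<^sub>N :: "(real^'n) set" and p :: nat
    and a :: "(real^'n \<Rightarrow> real^'n) \<Rightarrow> (real^'n \<Rightarrow> real^'n) \<Rightarrow> real"
    and aK :: "(real^'n) set \<Rightarrow> (real^'n \<Rightarrow> real^'n) \<Rightarrow> (real^'n \<Rightarrow> real^'n) \<Rightarrow> real"
    and f g :: "real^'n \<Rightarrow> real^'n" and \<alpha> :: real
  assumes dim: "CARD('n) \<ge> 2" and domain: "polyhedral_domain \<Omega>"
    and boundary: "\<Gamma>\<^sub>D \<union> \<Gamma>\<^sub>N = frontier \<Omega>" "\<Gamma>\<^sub>N \<in> sets borel"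
    and form: "bilinear_form_on (H1v \<Omega>) a"
    and \<alpha>: "\<alpha> > 0"
    and coercive: "\<forall>u\<in>H1D \<Omega> \<Gamma>\<^sub>D. a u u \<ge> \<alpha> * (H1_norm \<Omega> u)\<^sup>2"
    and local_form: "\<forall>K\<in>\<T>. bilinear_form_on (H1v \<Omega>) (aK K)"
      "\<forall>K\<in>\<T>. \<forall>u\<in>H1v \<Omega>. \<forall>u'\<in>H1v \<Omega>. \<forall>v\<in>H1v \<Omega>. \<forall>v'\<in>H1v \<Omega>.
         (AE x in lebesgue_on K. u x = u' x) \<and> (AE x in lebesgue_on K. v x = v' x)
         \<longrightarrow> aK K u v = aK K u' v'"
      "\<forall>u\<in>H1v \<Omega>. \<forall>v\<in>H1v \<Omega>. a u v = (\<Sum>K\<in>\<T>. aK K u v)"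
    and data: "f \<in> L2 (lebesgue_on \<Omega>)" "g \<in> L2 (surface_on \<Gamma>\<^sub>N)"
begin

abbreviation V where "V \<equiv> XD \<Omega> \<T> p \<Gamma>\<^sub>D"
abbreviation VK where "VK \<equiv> XI_loc \<Omega> \<T> p \<Gamma>\<^sub>D"
abbreviation VI where "VI \<equiv> XI \<Omega> \<T> p \<Gamma>\<^sub>D"

lemma bilinear_form_fun_linear:
  assumes B: "bilinear_form_on (H1v \<Omega>) B" and u: "u \<in> V"
  shows "fun_linear V (B u)" "fun_linear V (\<lambda>v. B v u)"
proof -
  have H: "v \<in> H1v \<Omega>" if "v \<in> V" for v by (rule XD_H1v[OF that])
  show "fun_linear V (B u)" unfolding fun_linear_def
  proof (intro conjI ballI allI)
    fix v assume v: "v \<in> V"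
    show "B u (\<lambda>x. v x + w x) = B u v + B u w" if "w \<in> V" for w
      by (rule bilinear_form_onD(2)[OF B H[OF v] H[OF that] H[OF u]])
    show "B u (\<lambda>x. c *\<^sub>R v x) = c * B u v" for c
      by (rule bilinear_form_onD(4)[OF B H[OF v] H[OF v] H[OF u]])
  qed
  show "fun_linear V (\<lambda>v. B v u)" unfolding fun_linear_def
  proof (intro conjI ballI allI)
    fix v assume v: "v \<in> V"
    show "B (\<lambda>x. v x + w x) u = B v u + B w u" if "w \<in> V" for w
      by (rule bilinear_form_onD(1)[OF B H[OF v] H[OF that] H[OF u]])
    show "B (\<lambda>x. c *\<^sub>R v x) u = c * B v u" for c
      by (rule bilinear_form_onD(3)[OF B H[OF v] H[OF v] H[OF u]])
  qed
qed

lemma dirichlet_sub: "\<Gamma>\<^sub>D \<subseteq> closure \<Omega>" "\<Gamma>\<^sub>N \<subseteq> frontier \<Omega>"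
  using boundary(1) by (auto simp: frontier_def)

lemma surface_finite: "finite_measure (surface_on (frontier \<Omega>))" "finite_measure (surface_on \<Gamma>\<^sub>N)"
proof -
  have fin: "emeasure surface_measure (frontier \<Omega>) < \<infinity>"
    by (rule polyhedral_frontier_finite_measure[OF dim domain])
  have "emeasure surface_measure \<Gamma>\<^sub>N \<le> emeasure surface_measure (frontier \<Omega>)"
    using dirichlet_sub(2) by (rule emeasure_mono) simp
  then have fin': "emeasure surface_measure \<Gamma>\<^sub>N < \<infinity>" using fin by (rule le_less_trans)
  show "finite_measure (surface_on (frontier \<Omega>))"
    using fin by (intro finite_measureI) (simp add: emeasure_restrict_space space_restrict_space)
  show "finite_measure (surface_on \<Gamma>\<^sub>N)"
    using fin' boundary(2) by (intro finite_measureI) (simp add: emeasure_restrict_space space_restrict_space)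
qed

lemma XD_surface_measurable:
  assumes "v \<in> V"
  shows "v \<in> borel_measurable (surface_on S)"
proof (rule measurable_restrict_space1)
  show "v \<in> borel_measurable surface_measure"
    unfolding measurable_cong_sets[OF sets_surface_measure refl] by (rule XD_borel[OF assms])
qed

text \<open>A finite element function is its own trace, approximated by the constant sequence.
  Square integrability on the boundary comes from boundedness and the finite surface
  measure.\<close>

lemma XD_H1D:
  assumes v: "v \<in> V"
  shows "v \<in> H1D \<Omega> \<Gamma>\<^sub>D"
proof -
  obtain B where B: "\<And>x. norm (v x) \<le> B" using XD_bounded[OF v] by blast
  have "integrable (surface_on (frontier \<Omega>)) (\<lambda>x. (norm (v x))\<^sup>2)"
  proof (rule finite_measure.integrable_const_bound[OF surface_finite(1)])
    show "AE x in surface_on (frontier \<Omega>). norm ((norm (v x))\<^sup>2) \<le> B\<^sup>2"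
      using B by (intro AE_I2) (simp add: power_mono)
  qed (intro borel_measurable_power measurable_compose[OF XD_surface_measurable[OF v] borel_measurable_norm])
  then have "v \<in> L2 (surface_on (frontier \<Omega>))"
    using XD_surface_measurable[OF v] by (simp add: L2_def)
  then have "has_trace \<Omega> v v"
    unfolding has_trace_def
    by (intro conjI exI[of _ "\<lambda>n. v"]) (simp_all add: XD_H1v[OF v] XD_continuous[OF v] H1_norm_zero)
  moreover have "AE x in surface_on \<Gamma>\<^sub>D. v x = 0"
    by (intro AE_I2) (simp add: space_restrict_space XD_boundary[OF v])
  ultimately show ?thesis
    unfolding H1D_def using XD_H1v[OF v] by (intro CollectI conjI exI[of _ v])
qed

lemma load_linear: "fun_linear V (load \<Omega> \<Gamma>\<^sub>N f g)"
proof -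
  have int: "integrable (lebesgue_on \<Omega>) (\<lambda>x. v x \<bullet> f x)" "integrable (surface_on \<Gamma>\<^sub>N) (\<lambda>x. v x \<bullet> g x)"
    if v: "v \<in> V" for v
  proof -
    obtain B where B: "\<And>x. norm (v x) \<le> B" using XD_bounded[OF v] by blast
    have "v \<in> borel_measurable (lebesgue_on \<Omega>)"
      using XD_borel[OF v] by (intro measurable_restrict_space1 measurable_completion) simp
    then show "integrable (lebesgue_on \<Omega>) (\<lambda>x. v x \<bullet> f x)"
      by (rule L2_times_bounded_integrable[OF dom_finite_measure data(1) _ B])
    show "integrable (surface_on \<Gamma>\<^sub>N) (\<lambda>x. v x \<bullet> g x)"
      by (rule L2_times_bounded_integrable[OF surface_finite(2) data(2) XD_surface_measurable[OF v] B])
  qed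
  show ?thesis unfolding fun_linear_def
  proof (intro conjI ballI allI)
    fix u assume u: "u \<in> V"
    show "load \<Omega> \<Gamma>\<^sub>N f g (\<lambda>x. u x + v x) = load \<Omega> \<Gamma>\<^sub>N f g u + load \<Omega> \<Gamma>\<^sub>N f g v" if "v \<in> V" for v
      using int[OF u] int[OF that] by (simp add: load_def inner_L2_def inner_add_left)
    show "load \<Omega> \<Gamma>\<^sub>N f g (\<lambda>x. c *\<^sub>R u x) = c * load \<Omega> \<Gamma>\<^sub>N f g u" for c
      by (simp add: load_def inner_L2_def algebra_simps)
  qed
qed

text \<open>Strict positivity of \<open>a\<close> is coercivity combined with definiteness of the
  norm on \<open>V\<close>, available because \<open>V\<close> lies in \<open>H1D\<close>.\<close>

sublocale cond: condensation V a div_form VI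
proof
  show "fun_subspace V" by (rule XD_subspace)
  show "\<exists>n e. V \<subseteq> fun_span n e" by (rule XD_finite_dim)
  show "fun_linear V (a u)" "fun_linear V (\<lambda>v. a v u)" if "u \<in> V" for u
    by (rule bilinear_form_fun_linear[OF form that])+
  show "fun_linear V (div_form u)" if "u \<in> V" for u by (rule div_form_linear[OF that])
  show "div_form u v = div_form v u" for u v by (rule div_form_sym)
  show "a u u > 0" if "u \<in> V" "u \<noteq> (\<lambda>x. 0)" for u
  proof -
    have "\<alpha> * (H1_norm \<Omega> u)\<^sup>2 > 0" using \<alpha> H1_norm_pos[OF that] by simp
    moreover have "a u u \<ge> \<alpha> * (H1_norm \<Omega> u)\<^sup>2" using bspec[OF coercive XD_H1D[OF that(1)]] .
    ultimately show ?thesis by linarith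
  qed
  show "div_form u v = 0" if "u \<in> V" "v \<in> V" "div_form u u = 0" for u v
    using that(3) unfolding div_form_zero_iff[OF that(1)] by (rule div_form_AE_zero)
  show "fun_subspace VI" by (rule XI_subspace)
  show "VI \<subseteq> V" by (rule XI_subset)
qed

lemma NI_cond: "NI \<Omega> \<T> p \<Gamma>\<^sub>D = cond.N"
  by (simp add: NI_eq cond.N_def)

lemma XB_cond: "XB \<Omega> \<T> p \<Gamma>\<^sub>D a = cond.B"
  by (auto simp: XB_def cond.B_def NI_cond div_form_def)

lemma XB_dagger_cond: "XB_dagger \<Omega> \<T> p \<Gamma>\<^sub>D a = cond.B'"
  by (auto simp: XB_dagger_def cond.B'_def NI_cond div_form_def)

section \<open>Localisation of the form and the load to one element\<close>

lemma VK_V: "v \<in> VK K \<Longrightarrow> v \<in> V"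
  by (rule subsetD[OF XI_loc_subset])

lemma aK_cong:
  assumes "K \<in> \<T>" "u \<in> V" "u' \<in> V" "v \<in> V" "v' \<in> V"
    and "\<And>x. x \<in> K \<Longrightarrow> u x = u' x" "\<And>x. x \<in> K \<Longrightarrow> v x = v' x"
  shows "aK K u v = aK K u' v'"
proof -
  have "AE x in lebesgue_on K. u x = u' x" "AE x in lebesgue_on K. v x = v' x"
    using assms(6,7) by (auto intro!: AE_I2)
  then show ?thesis
    using bspec[OF bspec[OF bspec[OF bspec[OF bspec[OF local_form(2) assms(1)]
      XD_H1v[OF assms(2)]] XD_H1v[OF assms(3)]] XD_H1v[OF assms(4)]] XD_H1v[OF assms(5)]] by simp
qed

lemma aK_linear:
  assumes "K \<in> \<T>" "u \<in> V"
  shows "fun_linear V (aK K u)" "fun_linear V (\<lambda>v. aK K v u)"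
  using bilinear_form_fun_linear[OF bspec[OF local_form(1) assms(1)] assms(2)] .

text \<open>On every other element the test function coincides with zero, so locality and linearity
  of \<open>aK\<close> remove that summand.\<close>

lemma a_local:
  assumes K: "K \<in> \<T>" and u: "u \<in> V" and v: "v \<in> VK K"
  shows "a u v = aK K u v"
proof -
  note vV = VK_V[OF v]
  have zero: "(\<lambda>x. 0) \<in> V" by (rule fun_subspace_zero[OF XD_subspace])
  have "aK K' u v = 0" if K': "K' \<in> \<T> - {K}" for K'
  proof -
    have "aK K' u v = aK K' u (\<lambda>x. 0)"
      using K' XI_loc_zero_other[OF K _ v] by (intro aK_cong u vV zero) auto
    also have "\<dots> = 0" using K' by (intro fun_linear_zero[OF aK_linear(1) XD_subspace] u) simp
    finally show ?thesis .
  qed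
  then have "(\<Sum>K\<in>\<T>. aK K u v) = aK K u v" using K finite_mesh by (simp add: sum.remove[of \<T> K])
  then show ?thesis using local_form(3) XD_H1v[OF u] XD_H1v[OF vV] by simp
qed

lemma load_local:
  assumes K: "K \<in> \<T>" and v: "v \<in> VK K"
  shows "load \<Omega> \<Gamma>\<^sub>N f g v = inner_L2 (lebesgue_on K) f v"
proof -
  note vV = VK_V[OF v]
  have "(\<integral>x. v x \<bullet> f x \<partial>lebesgue_on \<Omega>) = (\<integral>x. v x \<bullet> f x \<partial>lebesgue_on K)"
  proof (rule integral_supported_on_element[OF K])
    have "v \<in> borel_measurable (lebesgue_on \<Omega>)"
      using XD_borel[OF vV] by (intro measurable_restrict_space1 measurable_completion) simp
    then show "(\<lambda>x. v x \<bullet> f x) \<in> borel_measurable (lebesgue_on \<Omega>)"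
      using data(1) by (intro borel_measurable_inner) (simp_all add: L2_def)
    show "AE x in lebesgue_on \<Omega>. x \<notin> K \<longrightarrow> v x \<bullet> f x = 0"
      using v unfolding XI_loc_iff[OF K] by (intro AE_I2) simp
  qed
  \<comment> \<open>An interior function can be nonzero only in the interior of \<open>K\<close>,
    which lies in the open domain and misses its frontier, so the Neumann term drops out.\<close>
  moreover have "(\<integral>x. v x \<bullet> g x \<partial>surface_on \<Gamma>\<^sub>N) = 0"
  proof (rule integral_eq_zero_AE, rule AE_I2)
    fix x assume "x \<in> space (surface_on \<Gamma>\<^sub>N)"
    then have "x \<in> frontier \<Omega>" using dirichlet_sub(2) by (auto simp: space_restrict_space)
    then have "x \<notin> interior K"
      using mesh_interior[OF K] open_dom by (auto simp: frontier_def interior_open)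
    then show "v x \<bullet> g x = 0" using XI_loc_zero[OF K v] by simp
  qed
  ultimately show ?thesis by (simp add: load_def inner_L2_def inner_commute)
qed

section \<open>Mixed systems in terms of pressure representatives\<close>

lemma div_diff_zero_AE:
  assumes "w \<in> V" "w' \<in> V" "div_form (\<lambda>x. w x - w' x) (\<lambda>x. w x - w' x) = 0"
  shows "AE x in lebesgue_on \<Omega>. weak_div \<Omega> w' x = weak_div \<Omega> w x"
proof -
  have "(\<lambda>x. w x - w' x) \<in> V" by (rule fun_subspace_diff[OF XD_subspace assms(1,2)])
  from div_form_zero_iff[OF this] assms(3)
  have "AE x in lebesgue_on \<Omega>. weak_div \<Omega> (\<lambda>x. w x - w' x) x = 0" by simp
  with AE_weak_div_axpy[OF assms(1,2), of "-1"] show ?thesis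
    by eventually_elim simp
qed

lemma mixed_solution_dom_iff:
  "mixed_solution \<Omega> \<Omega> b l X Y u q \<longleftrightarrow> u \<in> X \<and> (\<exists>w\<in>X. q = weak_div \<Omega> w \<and>
     (\<forall>v\<in>Y. b u v - div_form w v = l v) \<and> (\<forall>v\<in>Y. div_form v u = 0))"
  unfolding mixed_solution_def div_form_def by (auto simp: image_iff)

text \<open>The divergence of a function in \<open>VK K\<close> vanishes outside \<open>K\<close>
  almost everywhere, so the inner products over \<open>K\<close> are values of the global form and
  the local problem lives in the same abstract setting.\<close>

lemma local_system_iff:
  assumes K: "K \<in> \<T>"
  shows "local_system \<Omega> \<T> p \<Gamma>\<^sub>D aK f ut K u q \<longleftrightarrow> u \<in> VK K \<and> (\<exists>w\<in>VK K. q = weak_div \<Omega> w \<and>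
     (\<forall>v\<in>VK K. aK K u v - div_form w v = inner_L2 (lebesgue_on K) f v - aK K ut v) \<and>
     (\<forall>v\<in>VK K. div_form v u = 0))"
proof -
  have "inner_L2 (lebesgue_on K) (weak_div \<Omega> w) (weak_div \<Omega> v) = div_form w v"
    if "w \<in> VK K" "v \<in> VK K" for w v
    by (rule div_form_local[OF K VK_V[OF that(1)] that(2)])
  then show ?thesis
    unfolding local_system_def mixed_solution_def by (auto simp: image_iff)
qed

lemma decomposition:
  assumes "global_system \<Omega> \<T> p \<Gamma>\<^sub>D \<Gamma>\<^sub>N a f g uX qX"
  shows "\<exists>ut qt uK qK. boundary_system \<Omega> \<T> p \<Gamma>\<^sub>D \<Gamma>\<^sub>N a f g ut qt \<and>
     (\<forall>K\<in>\<T>. local_system \<Omega> \<T> p \<Gamma>\<^sub>D aK f ut K (uK K) (qK K)) \<and>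
     uX = (\<lambda>x. ut x + (\<Sum>K\<in>\<T>. uK K x)) \<and>
     (AE x in lebesgue_on \<Omega>. qX x = qt x + (\<Sum>K\<in>\<T>. qK K x))"
proof -
  obtain wX where u: "uX \<in> V" and w: "wX \<in> V" and q: "qX = weak_div \<Omega> wX"
    and eq: "\<forall>v\<in>V. a uX v - div_form wX v = load \<Omega> \<Gamma>\<^sub>N f g v" and div: "\<forall>v\<in>V. div_form v uX = 0"
    using assms unfolding global_system_def mixed_solution_dom_iff by blast
  from cond.global_split[OF u w div eq]
  obtain ut wt uI wI where ut: "ut \<in> cond.B" and wt: "wt \<in> cond.B" and uI: "uI \<in> cond.N" and wI: "wI \<in> VI"
    and split: "uX = (\<lambda>x. ut x + uI x)" "wX = (\<lambda>x. wt x + wI x)"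
    and ut0: "div_form ut ut = 0" and eqB: "\<forall>v\<in>cond.B'. a ut v - div_form wt v = load \<Omega> \<Gamma>\<^sub>N f g v"
    by (elim bexE conjE)
  have V: "ut \<in> V" "wt \<in> V" "uI \<in> V" "wI \<in> V"
    using ut wt uI wI cond.N_subset(2) XI_subset by (auto simp: cond.B_def)
  \<comment> \<open>Since \<open>uI\<close> lies in the kernel, its pieces can be taken divergence
    free on each element, which is the second local equation. The pressure representative
    \<open>wI\<close> splits merely into interior functions.\<close>
  obtain uK where uK: "\<forall>K\<in>\<T>. uK K \<in> NI_loc \<Omega> \<T> p \<Gamma>\<^sub>D K" and uIs: "uI = (\<lambda>x. \<Sum>K\<in>\<T>. uK K x)"
    using uI unfolding NI_cond[symmetric] NI_def mesh_sum_def by (elim CollectE exE conjE)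
  have uKX: "\<forall>K\<in>\<T>. uK K \<in> VK K" using uK by (simp add: NI_loc_def)
  obtain wK where wK: "\<forall>K\<in>\<T>. wK K \<in> VK K" and wIs: "wI = (\<lambda>x. \<Sum>K\<in>\<T>. wK K x)"
    using wI by (rule XI_memE)
  have "boundary_system \<Omega> \<T> p \<Gamma>\<^sub>D \<Gamma>\<^sub>N a f g ut (weak_div \<Omega> wt)"
    unfolding boundary_system_def mixed_solution_dom_iff XB_cond XB_dagger_cond
  proof (intro conjI bexI[of _ wt] ballI)
    show "div_form v ut = 0" if "v \<in> cond.B'" for v
      using cond.b_null[OF V(1) _ ut0, of v] that div_form_sym[of v ut] by (simp add: cond.B'_def)
  qed (use ut wt eqB in auto)
  moreover have "local_system \<Omega> \<T> p \<Gamma>\<^sub>D aK f ut K (uK K) (weak_div \<Omega> (wK K))" if K: "K \<in> \<T>" for K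
    unfolding local_system_iff[OF K]
  proof (intro conjI bexI[of _ "wK K"] ballI)
    fix v assume v: "v \<in> VK K"
    note vV = VK_V[OF v]
    \<comment> \<open>As an element of \<open>VI\<close> the test function is orthogonal under the
      divergence form to \<open>wt\<close>, so the boundary pressure disappears from the local
      equation.\<close>
    have vI: "v \<in> VI" by (rule subsetD[OF XI_loc_subset_XI[OF K] v])
    have "a uX v = a ut v + a uI v" unfolding split(1) by (rule fun_linear_add[OF cond.a_left[OF vV] V(1,3)])
    also have "a ut v = aK K ut v" by (rule a_local[OF K V(1) v])
    also have "a uI v = aK K uI v" by (rule a_local[OF K V(3) v])
    also have "aK K uI v = aK K (uK K) v"
      by (rule aK_cong[OF K V(3) VK_V[OF bspec[OF uKX K]] vV vV])
        (simp_all add: uIs mesh_sum_on[OF uKX K])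
    finally have A: "a uX v = aK K ut v + aK K (uK K) v" .
    have "div_form wX v = div_form wt v + div_form wI v"
      unfolding split(2) by (rule fun_linear_add[OF cond.b_left[OF vV] V(2,4)])
    also have "div_form wt v = 0" using wt vI by (simp add: cond.B_def)
    also have "div_form wI v = div_form (wK K) v"
    proof -
      have "div_form (\<lambda>x. wI x - wK K x) v = div_form wI v - div_form (wK K) v"
        by (rule fun_linear_diff[OF cond.b_left[OF vV] XD_subspace V(4) VK_V[OF bspec[OF wK K]]])
      \<comment> \<open>On \<open>K\<close> the divergences of \<open>wI\<close> and
        \<open>wK K\<close> agree almost everywhere, and off \<open>K\<close> that of
        \<open>v\<close> is zero, so the integrand vanishes.\<close>
      moreover have "div_form (\<lambda>x. wI x - wK K x) v = 0"
        unfolding div_form_def inner_L2_def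
      proof (rule integral_eq_zero_AE)
        show "AE x in lebesgue_on \<Omega>. weak_div \<Omega> (\<lambda>x. wI x - wK K x) x \<bullet> weak_div \<Omega> v x = 0"
          using AE_weak_div_mesh_sum_on[OF wK K] AE_weak_div_XI_loc_outside[OF K v]
            AE_weak_div_axpy[OF V(4) VK_V[OF bspec[OF wK K]], of "-1"]
          unfolding wIs[symmetric] by eventually_elim auto
      qed
      ultimately show ?thesis by simp
    qed
    finally have B: "div_form wX v = div_form (wK K) v" by simp
    show "aK K (uK K) v - div_form (wK K) v = inner_L2 (lebesgue_on K) f v - aK K ut v"
      using bspec[OF eq vV] A B load_local[OF K v] by simp
    have "AE x in lebesgue_on \<Omega>. weak_div \<Omega> (uK K) x = 0" using bspec[OF uK K] by (simp add: NI_loc_def)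
    then show "div_form v (uK K) = 0" using div_form_AE_zero div_form_sym[of v "uK K"] by simp
  qed (use bspec[OF uKX K] bspec[OF wK K] in auto)
  moreover have "uX = (\<lambda>x. ut x + (\<Sum>K\<in>\<T>. uK K x))" using split(1) by (simp add: uIs)
  moreover have "AE x in lebesgue_on \<Omega>. qX x = weak_div \<Omega> wt x + (\<Sum>K\<in>\<T>. weak_div \<Omega> (wK K) x)"
    using AE_weak_div_axpy[OF V(2,4), of 1] AE_weak_div_mesh_sum[OF wK]
    unfolding q split(2) wIs[symmetric] by eventually_elim simp
  ultimately show ?thesis
    by (intro exI[of _ ut] exI[of _ "weak_div \<Omega> wt"] exI[of _ uK] exI[of _ "\<lambda>K. weak_div \<Omega> (wK K)"]) simp
qed

text \<open>Existence comes from solving the global problem by \<open>mixed_exists\<close> and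
  taking the boundary part of its decomposition; the difference of two solutions is then a
  homogeneous solution in \<open>XB\<close>.\<close>

lemma boundary_uniquely_solvable:
  "uniquely_solvable \<Omega> (boundary_system \<Omega> \<T> p \<Gamma>\<^sub>D \<Gamma>\<^sub>N a f g)"
proof -
  obtain u w where uw: "u \<in> V" "w \<in> V" "div_form u u = 0"
    "\<forall>v\<in>V. a u v - div_form w v = load \<Omega> \<Gamma>\<^sub>N f g v"
    using cond.mixed_exists[OF XD_subspace subset_refl load_linear] by (elim bexE conjE)
  have "\<forall>v\<in>V. div_form v u = 0"
    using cond.b_null[OF uw(1) _ uw(3)] by (simp add: div_form_sym[of _ u])
  then have "global_system \<Omega> \<T> p \<Gamma>\<^sub>D \<Gamma>\<^sub>N a f g u (weak_div \<Omega> w)"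
    unfolding global_system_def mixed_solution_dom_iff using uw(1,2,4) by (intro conjI bexI[of _ w] refl)
  from decomposition[OF this] obtain ut qt where
    bs: "boundary_system \<Omega> \<T> p \<Gamma>\<^sub>D \<Gamma>\<^sub>N a f g ut qt" by (elim exE conjE)
  have unique: "u' = ut \<and> (AE x in lebesgue_on \<Omega>. q' x = qt x)"
    if bs': "boundary_system \<Omega> \<T> p \<Gamma>\<^sub>D \<Gamma>\<^sub>N a f g u' q'" for u' q'
  proof -
    obtain w where w: "ut \<in> cond.B" "w \<in> cond.B" "qt = weak_div \<Omega> w"
      "\<forall>v\<in>cond.B'. a ut v - div_form w v = load \<Omega> \<Gamma>\<^sub>N f g v" "\<forall>v\<in>cond.B'. div_form v ut = 0"
      using bs unfolding boundary_system_def mixed_solution_dom_iff XB_cond XB_dagger_cond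
      by (elim conjE bexE)
    obtain w' where w': "u' \<in> cond.B" "w' \<in> cond.B" "q' = weak_div \<Omega> w'"
      "\<forall>v\<in>cond.B'. a u' v - div_form w' v = load \<Omega> \<Gamma>\<^sub>N f g v" "\<forall>v\<in>cond.B'. div_form v u' = 0"
      using bs' unfolding boundary_system_def mixed_solution_dom_iff XB_cond XB_dagger_cond
      by (elim conjE bexE)
    have V: "ut \<in> V" "w \<in> V" "u' \<in> V" "w' \<in> V" using w w' by (auto simp: cond.B_def)
    have B'V: "v \<in> V" if "v \<in> cond.B'" for v using that by (simp add: cond.B'_def)
    have diff: "(\<lambda>x. y x - z x) \<in> cond.B" if "y \<in> cond.B" "z \<in> cond.B" for y z
      by (rule fun_subspace_diff[OF cond.B_subspace that])
    have "(\<lambda>x. ut x - u' x) = (\<lambda>x. 0) \<and> div_form (\<lambda>x. w x - w' x) (\<lambda>x. w x - w' x) = 0"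
    proof (rule cond.boundary_unique)
      show "(\<lambda>x. ut x - u' x) \<in> cond.B" "(\<lambda>x. w x - w' x) \<in> cond.B"
        by (rule diff[OF w(1) w'(1)], rule diff[OF w(2) w'(2)])
      fix v assume v: "v \<in> cond.B'"
      note vV = B'V[OF v]
      have "div_form v (\<lambda>x. ut x - u' x) = div_form v ut - div_form v u'"
        by (rule fun_linear_diff[OF cond.b_right[OF vV] XD_subspace V(1,3)])
      then show "div_form v (\<lambda>x. ut x - u' x) = 0" using w(5) w'(5) v by simp
      have "a (\<lambda>x. ut x - u' x) v = a ut v - a u' v"
        by (rule fun_linear_diff[OF cond.a_left[OF vV] XD_subspace V(1,3)])
      moreover have "div_form (\<lambda>x. w x - w' x) v = div_form w v - div_form w' v"
        by (rule fun_linear_diff[OF cond.b_left[OF vV] XD_subspace V(2,4)])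
      ultimately show "a (\<lambda>x. ut x - u' x) v = div_form (\<lambda>x. w x - w' x) v"
        using bspec[OF w(4) v] bspec[OF w'(4) v] by simp
    qed
    then have eq: "u' = ut" and d: "div_form (\<lambda>x. w x - w' x) (\<lambda>x. w x - w' x) = 0"
      by (simp_all add: fun_eq_iff)
    show ?thesis using eq div_diff_zero_AE[OF V(2,4) d] unfolding w(3) w'(3) by (rule conjI)
  qed
  show ?thesis unfolding uniquely_solvable_def
    by (intro exI[of _ ut] exI[of _ qt] conjI[OF bs] allI impI unique)
qed

text \<open>Coercivity is a property of \<open>a\<close>, not of the single \<open>aK K\<close>. On
  \<open>VK K\<close> the two agree, so the abstract results are applied with \<open>a\<close> and
  translated back by \<open>a_local\<close> and \<open>load_local\<close>.\<close>

lemma local_uniquely_solvable: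
  assumes ut: "ut \<in> V" and K: "K \<in> \<T>"
  shows "uniquely_solvable \<Omega> (local_system \<Omega> \<T> p \<Gamma>\<^sub>D aK f ut K)"
proof -
  let ?l = "\<lambda>v. inner_L2 (lebesgue_on K) f v - aK K ut v"
  note sub = XI_loc_subspace[OF K] XI_loc_subset
  have "fun_linear (VK K) (\<lambda>v. load \<Omega> \<Gamma>\<^sub>N f g v - aK K ut v)"
    by (rule fun_linear_mono[OF fun_linear_combine[OF load_linear aK_linear(1)[OF K ut]] XI_loc_subset])
  from cond.mixed_exists[OF sub this]
  obtain u w where u: "u \<in> VK K" "w \<in> VK K" "div_form u u = 0"
    "\<forall>v\<in>VK K. a u v - div_form w v = load \<Omega> \<Gamma>\<^sub>N f g v - aK K ut v" by (elim bexE conjE)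
  have eq: "aK K u v - div_form w v = ?l v" if "v \<in> VK K" for v
    using bspec[OF u(4) that] a_local[OF K VK_V[OF u(1)] that] load_local[OF K that] by simp
  have div: "div_form v u = 0" if "v \<in> VK K" for v
    using cond.b_null[OF VK_V[OF u(1)] VK_V[OF that] u(3)] div_form_sym[of v u] by simp
  have sol: "local_system \<Omega> \<T> p \<Gamma>\<^sub>D aK f ut K u (weak_div \<Omega> w)"
    unfolding local_system_iff[OF K] using u(1,2) eq div by (intro conjI bexI[of _ w] refl ballI)
  have unique: "u' = u \<and> (AE x in lebesgue_on \<Omega>. q' x = weak_div \<Omega> w x)"
    if sol': "local_system \<Omega> \<T> p \<Gamma>\<^sub>D aK f ut K u' q'" for u' q'
  proof -
    obtain w' where w': "u' \<in> VK K" "w' \<in> VK K" "q' = weak_div \<Omega> w'"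
      "\<forall>v\<in>VK K. aK K u' v - div_form w' v = ?l v" "\<forall>v\<in>VK K. div_form v u' = 0"
      using sol' unfolding local_system_iff[OF K] by (elim conjE bexE)
    have "u = u' \<and> div_form (\<lambda>x. w x - w' x) (\<lambda>x. w x - w' x) = 0"
    proof (rule cond.mixed_unique[OF sub u(1) w'(1) u(2) w'(2), of ?l])
      fix v assume v: "v \<in> VK K"
      show "div_form v u = 0" by (rule div[OF v])
      show "div_form v u' = 0" by (rule bspec[OF w'(5) v])
      show "a u v - div_form w v = ?l v" using eq[OF v] a_local[OF K VK_V[OF u(1)] v] by simp
      show "a u' v - div_form w' v = ?l v" using bspec[OF w'(4) v] a_local[OF K VK_V[OF w'(1)] v] by simp
    qed
    then have eq': "u' = u" and d: "div_form (\<lambda>x. w x - w' x) (\<lambda>x. w x - w' x) = 0" by simp_all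
    show ?thesis
      using eq' div_diff_zero_AE[OF VK_V[OF u(2)] VK_V[OF w'(2)] d] unfolding w'(3) by (rule conjI)
  qed
  show ?thesis unfolding uniquely_solvable_def
    by (intro exI[of _ u] exI[of _ "weak_div \<Omega> w"] conjI[OF sol] allI impI unique)
qed

end

theorem lemma4p4:
  fixes \<Omega> \<Gamma>\<^sub>D \<Gamma>\<^sub>N :: "(real^'n::finite) set"
    and \<T> :: "(real^'n) set set"
    and p :: nat
    and a :: "(real^'n \<Rightarrow> real^'n) \<Rightarrow> (real^'n \<Rightarrow> real^'n) \<Rightarrow> real"
    and aK :: "(real^'n) set \<Rightarrow> (real^'n \<Rightarrow> real^'n) \<Rightarrow> (real^'n \<Rightarrow> real^'n) \<Rightarrow> real"
    and f g :: "real^'n \<Rightarrow> real^'n"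
    and M \<alpha> :: real
  assumes dim: "CARD('n) \<in> {2, 3}"
    and domain: "polyhedral_domain \<Omega>"
    and boundary: "\<Gamma>\<^sub>D \<union> \<Gamma>\<^sub>N = frontier \<Omega>" "\<Gamma>\<^sub>D \<inter> \<Gamma>\<^sub>N = {}"
      "\<Gamma>\<^sub>D \<in> sets borel" "\<Gamma>\<^sub>N \<in> sets borel" "emeasure surface_measure \<Gamma>\<^sub>D > 0"
    and mesh: "simplicial_mesh \<Omega> \<T>"
      "closure \<Gamma>\<^sub>D \<inter> closure \<Gamma>\<^sub>N \<subseteq> \<Union>{E. \<exists>K\<in>\<T>. E face_of K \<and> aff_dim E = int CARD('n) - 2}"
    and form: "bilinear_form_on (H1v \<Omega>) a"
    and const_pos: "M > 0" "\<alpha> > 0"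
    and bounded: "\<forall>u\<in>H1D \<Omega> \<Gamma>\<^sub>D. \<forall>v\<in>H1D \<Omega> \<Gamma>\<^sub>D. \<bar>a u v\<bar> \<le> M * H1_norm \<Omega> u * H1_norm \<Omega> v"
    and coercive: "\<forall>u\<in>H1D \<Omega> \<Gamma>\<^sub>D. a u u \<ge> \<alpha> * (H1_norm \<Omega> u)\<^sup>2"
    and local_form: "\<forall>K\<in>\<T>. bilinear_form_on (H1v \<Omega>) (aK K)"
      "\<forall>K\<in>\<T>. \<forall>u\<in>H1v \<Omega>. \<forall>u'\<in>H1v \<Omega>. \<forall>v\<in>H1v \<Omega>. \<forall>v'\<in>H1v \<Omega>.
         (AE x in lebesgue_on K. u x = u' x) \<and> (AE x in lebesgue_on K. v x = v' x)
         \<longrightarrow> aK K u v = aK K u' v'"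
      "\<forall>u\<in>H1v \<Omega>. \<forall>v\<in>H1v \<Omega>. a u v = (\<Sum>K\<in>\<T>. aK K u v)"
    and data: "f \<in> L2 (lebesgue_on \<Omega>)" "g \<in> L2 (surface_on \<Gamma>\<^sub>N)"
  shows "(\<forall>uX qX. global_system \<Omega> \<T> p \<Gamma>\<^sub>D \<Gamma>\<^sub>N a f g uX qX \<longrightarrow>
            (\<exists>ut qt uK qK. boundary_system \<Omega> \<T> p \<Gamma>\<^sub>D \<Gamma>\<^sub>N a f g ut qt \<and> (\<forall>K\<in>\<T>. local_system \<Omega> \<T> p \<Gamma>\<^sub>D aK f ut K (uK K) (qK K)) \<and>
               uX = (\<lambda>x. ut x + (\<Sum>K\<in>\<T>. uK K x)) \<and>
               (AE x in lebesgue_on \<Omega>. qX x = qt x + (\<Sum>K\<in>\<T>. qK K x)))) \<and>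
         uniquely_solvable \<Omega> (boundary_system \<Omega> \<T> p \<Gamma>\<^sub>D \<Gamma>\<^sub>N a f g) \<and>
         (\<forall>ut qt. boundary_system \<Omega> \<T> p \<Gamma>\<^sub>D \<Gamma>\<^sub>N a f g ut qt \<longrightarrow> (\<forall>K\<in>\<T>. uniquely_solvable \<Omega> (local_system \<Omega> \<T> p \<Gamma>\<^sub>D aK f ut K)))"
proof -
  interpret fem \<Omega> \<T> \<Gamma>\<^sub>D \<Gamma>\<^sub>N p a aK f g \<alpha>
  proof
    show "open \<Omega>" "bounded \<Omega>" using domain by (simp_all add: polyhedral_domain_def)
    show "CARD('n) \<ge> 2" using dim by auto
  qed (fact mesh(1) domain boundary(1) boundary(4) form const_pos(2) coercive local_form data)+
  have "ut \<in> XD \<Omega> \<T> p \<Gamma>\<^sub>D" if "boundary_system \<Omega> \<T> p \<Gamma>\<^sub>D \<Gamma>\<^sub>N a f g ut qt" for ut qt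
    using that by (simp add: boundary_system_def mixed_solution_def XB_def)
  then show ?thesis
    using decomposition boundary_uniquely_solvable local_uniquely_solvable by (intro conjI allI impI ballI) simp_all
qed

end
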